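(* Let $d\ge 3$ and let $\mathcal{T}$ be the maximal triangle averaging operator on $\mathbb{R}^d$. Let $1\le p,q\le\infty$ satisfy $\frac1p+\frac1q<\frac{d-1}{d}$, and let $r$ be given by $\frac1r=\frac1p+\frac1q$. Then $\mathcal{T}$ is bounded from $L^p(\mathbb{R}^d)\times L^q(\mathbb{R}^d)$ into $L^r(\mathbb{R}^d)$.
   Context: Let $M=\{(u,v)\in\mathbb{R}^d\times\mathbb{R}^d : |u|=|v|=|u-v|=1\}$, a compact submanifold of $\mathbb{R}^{2d}$, and let $\mu$ be the surface measure on $M$, normalized to be a probability measure. The maximal triangle averaging operator is $$\mathcal{T}(f,g)(x)=\sup_{t>0}\left|\int_M f(x-tu)\,g(x-tv)\,d\mu(u,v)\right|.$$ Bounded from $L^p\times L^q$ into $L^r$ means that there is a finite constant $C$ with $\|\mathcal{T}(f,g)\|_{L^r}\le C\|f\|_{L^p}\|g\|_{L^q}$ for all Schwartz functions $f,g$ on $\mathbb{R}^d$. The convention $1/\infty=0$ is used. *)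

theory Defs
  imports "HOL-Probability.Probability"
begin

subsection \<open>Hausdorff measure\<close>

text \<open>
  The surface measure of a compact \<open>k\<close>-dimensional submanifold of a Euclidean space is the
  restriction to it of the \<open>k\<close>-dimensional Hausdorff measure.  The factor
  \<open>unit_ball_vol k / 2 ^ k\<close> is the usual normalisation, under which the \<open>k\<close>-dimensional
  Hausdorff measure on \<open>k\<close>-dimensional Euclidean space is Lebesgue measure.
  Empty covering sets are given weight 0 explicitly, so that finite covers are allowed
  also for \<open>k = 0\<close>, where \<open>0 ^ 0 = 1\<close>.
\<close>

definition hausdorff_pre :: "nat \<Rightarrow> real \<Rightarrow> 'a::metric_space set \<Rightarrow> ennreal" where
  "hausdorff_pre k \<delta> A =
     (INF C \<in> {C :: nat \<Rightarrow> 'a set.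
                 A \<subseteq> (\<Union>i. C i) \<and> (\<forall>i. bounded (C i) \<and> diameter (C i) \<le> \<delta>)}.
        \<Sum>i. if C i = {} then 0
            else ennreal (unit_ball_vol (real k) / 2 ^ k * diameter (C i) ^ k))"

definition hausdorff_outer :: "nat \<Rightarrow> 'a::metric_space set \<Rightarrow> ennreal" where
  "hausdorff_outer k A = (SUP \<delta> \<in> {0<..}. hausdorff_pre k \<delta> A)"

text \<open>
  \<open>hausdorff_outer k\<close> is a metric outer measure, hence countably additive on the Borel sets by
  Caratheodory's criterion; so the side condition built into \<^const>\<open>measure_of\<close> holds and
  the measure below assigns \<open>hausdorff_outer k A\<close> to every Borel set \<open>A\<close>.
\<close>

definition hausdorff_measure :: "nat \<Rightarrow> 'a::metric_space measure" where
  "hausdorff_measure k = measure_of UNIV (sets borel) (hausdorff_outer k)"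


subsection \<open>The triangle averaging operator\<close>

definition triangle_manifold :: "((real ^ 'n) \<times> (real ^ 'n)) set" where
  "triangle_manifold = {(u, v). norm u = 1 \<and> norm v = 1 \<and> norm (u - v) = 1}"

text \<open>
  The three defining equations are independent at every point of the manifold, whose dimension is
  therefore \<open>2 * d - 3\<close>.  The metric on the product type is the Euclidean one.
\<close>

definition triangle_measure :: "((real ^ 'n) \<times> (real ^ 'n)) measure" where
  "triangle_measure = uniform_measure (hausdorff_measure (2 * CARD('n) - 3)) triangle_manifold"

definition maximal_triangle ::
    "(real ^ 'n \<Rightarrow> complex) \<Rightarrow> (real ^ 'n \<Rightarrow> complex) \<Rightarrow> real ^ 'n \<Rightarrow> ennreal" where
  "maximal_triangle f g x =
     (SUP t \<in> {0<..}.
        ennreal (norm (\<integral>(u, v). f (x - t *\<^sub>R u) * g (x - t *\<^sub>R v) \<partial>triangle_measure)))"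


subsection \<open>Schwartz functions\<close>

text \<open>\<open>iter_partial [i\<^sub>1, \<dots>, i\<^sub>m] f\<close> is the iterated partial derivative of \<open>f\<close> in the
  coordinate directions \<open>i\<^sub>m\<close>, \<open>\<dots>\<close>, \<open>i\<^sub>1\<close>.\<close>

fun iter_partial :: "'n list \<Rightarrow> (real ^ 'n \<Rightarrow> complex) \<Rightarrow> real ^ 'n \<Rightarrow> complex" where
  "iter_partial [] f = f"
| "iter_partial (i # is) f = (\<lambda>x. frechet_derivative (iter_partial is f) (at x) (axis i 1))"

definition schwartz :: "(real ^ 'n \<Rightarrow> complex) \<Rightarrow> bool" where
  "schwartz f \<longleftrightarrow>
     (\<forall>is. (\<forall>x. iter_partial is f differentiable (at x)) \<and>
           (\<forall>N::nat. \<exists>B::real. \<forall>x. norm x ^ N * norm (iter_partial is f x) \<le> B))"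


subsection \<open>Lebesgue norms\<close>

text \<open>
  Norms are taken in \<^typ>\<open>ennreal\<close>, for functions with values in \<^typ>\<open>ennreal\<close>, so that a
  supremum or an integral that diverges is \<open>\<infinity>\<close> and never a default value.
\<close>

definition ennreal_powr :: "ennreal \<Rightarrow> real \<Rightarrow> ennreal" where
  "ennreal_powr y a = (if y = \<infinity> then \<infinity> else ennreal (enn2real y powr a))"

definition Lp_norm :: "'a measure \<Rightarrow> ennreal \<Rightarrow> ('a \<Rightarrow> ennreal) \<Rightarrow> ennreal" where
  "Lp_norm M p F =
     (if p = \<infinity> then esssup M F
      else ennreal_powr (\<integral>\<^sup>+ x. ennreal_powr (F x) (enn2real p) \<partial>M) (1 / enn2real p))"

definition triangle_bounded :: "'n::finite itself \<Rightarrow> ennreal \<Rightarrow> ennreal \<Rightarrow> ennreal \<Rightarrow> bool" where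
  "triangle_bounded _ p q r \<longleftrightarrow>
     (\<exists>C::real. \<forall>f g :: real ^ 'n \<Rightarrow> complex. schwartz f \<longrightarrow> schwartz g \<longrightarrow>
        Lp_norm lborel r (maximal_triangle f g)
          \<le> ennreal C * Lp_norm lborel p (\<lambda>x. ennreal (norm (f x)))
                      * Lp_norm lborel q (\<lambda>x. ennreal (norm (g x))))"

end

theory Submission
  imports Defs
begin

text \<open>
  Write \<open>s, t\<close> for the values of \<open>|f|, |g|\<close> normalised in \<open>L\<^sup>p, L\<^sup>q\<close>.  Young's inequality
  \<open>s t \<le> (r / p) s\<^bsup>p / r\<^esup> + (r / q) t\<^bsup>q / r\<^esup>\<close> decouples the bilinear average into linear averages
  over the two marginals of the triangle measure.  These are rotation invariant, so their maximal
  functions are bounded on \<open>L\<^sup>r\<close> for \<open>r > d / (d - 1)\<close> by Stein's spherical maximal theorem.  All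
  that is needed of the Hausdorff measure is its invariance under isometries: the arguments below
  work for any rotation invariant \<open>\<sigma>\<close> of mass at most 1 on the unit sphere, including 0.

  Stein's theorem is proved in the logarithmic radius \<open>a = ln t\<close>.  Rotation invariance makes the
  Fourier multiplier of \<open>\<sigma>\<close> solve Bessel's differential equation, which gives its decay.  The mean
  over the sphere is split into dyadic pieces by finite differences in \<open>a\<close> at scale \<open>2\<^bsup>-j\<^esup>\<close>: decay
  and Plancherel bound their square functions in \<open>L\<^sup>2\<close>, the Hardy-Littlewood theorem bounds them
  in weak \<open>L\<^sup>1\<close> with a loss of \<open>2\<^sup>j\<close>, and interpolation sums the pieces.
\<close>

text \<open>The condition 1/p + 1/q < (d-1)/d says r > d/(d-1), which is the range of Stein's
  theorem, so decoupling keeps the whole range. The obstacle is the supremum over a continuum of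
  radii. A Sobolev inequality on the line replaces it by the integrals of the squares of a function
  of \<open>a = ln t\<close> and of its derivative. In this variable dilations become translations:
  the integral over \<open>a\<close> of the squared multiplier at exp a |\<xi>| is the same for all
  \<xi> \<noteq> 0, so one estimate on the line treats all radii and all frequencies together. The
  multiplier does not decay as \<open>a\<close> tends to minus infinity, so that integral would
  diverge; finite differences in \<open>a\<close> remove the limit value and damp frequencies below
  1/h. At scale h this gives the constant h^(d-2) in the weak type (2,2) bound for the measure of
  level sets, against 1/h in weak type (1,1); interpolation leaves a positive power of h exactly
  when q > d/(d-1), a threshold below 2 because d \<ge> 3.\<close>

section \<open>Tame functions and changes of variables\<close>

text \<open>A class that contains the modulus of a Schwartz function and, unlike the Schwartz class,
  is stable under truncation at a height and under powers of exponent at least 1. Boundedness keeps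
  spherical means finite, and continuity makes them jointly continuous in centre and radius.\<close>

definition tame :: "('a::euclidean_space \<Rightarrow> real) \<Rightarrow> bool" where
  "tame g \<longleftrightarrow> continuous_on UNIV g \<and> (\<exists>B. \<forall>x. \<bar>g x\<bar> \<le> B) \<and> integrable lborel g"

lemma tameD_continuous: "tame g \<Longrightarrow> continuous_on UNIV g"
  by (simp add: tame_def)

lemma tameD_integrable: "tame g \<Longrightarrow> integrable lborel g"
  by (simp add: tame_def)

lemma tame_measurable: "tame g \<Longrightarrow> g \<in> borel_measurable borel"
  by (simp add: tame_def borel_measurable_continuous_onI)

lemma tame_bound:
  assumes "tame g"
  obtains B where "B > 0" "\<And>x. \<bar>g x\<bar> \<le> B"
proof -
  from assms obtain B where "\<And>x. \<bar>g x\<bar> \<le> B" by (auto simp: tame_def)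
  moreover have "\<bar>B\<bar> + 1 > 0" "B \<le> \<bar>B\<bar> + 1" by linarith+
  ultimately show ?thesis by (metis that order_trans)
qed

lemma tame_continuous_at: "tame g \<Longrightarrow> isCont g x"
  by (simp add: tame_def continuous_on_eq_continuous_at)

lemma tame_dominated:
  assumes "tame g" and "continuous_on UNIV f" and "\<And>x. \<bar>f x\<bar> \<le> C * \<bar>g x\<bar>"
  shows "tame f"
proof -
  obtain B where B: "\<And>x. \<bar>g x\<bar> \<le> B" using tame_bound[OF assms(1)] by metis
  have "\<bar>f x\<bar> \<le> \<bar>C\<bar> * B" for x
    using assms(3)[of x] B[of x]
    by (meson abs_ge_self abs_ge_zero mult_mono order_trans)
  moreover have "integrable lborel f"
  proof (rule Bochner_Integration.integrable_bound)
    show "integrable lborel (\<lambda>x. C * \<bar>g x\<bar>)"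
      using tameD_integrable[OF assms(1)] by auto
    show "f \<in> borel_measurable lborel"
      using assms(2) by (simp add: borel_measurable_continuous_onI)
    show "AE x in lborel. norm (f x) \<le> norm (C * \<bar>g x\<bar>)"
    proof (intro AE_I2)
      fix x show "norm (f x) \<le> norm (C * \<bar>g x\<bar>)" using assms(3)[of x] by auto
    qed
  qed
  ultimately show ?thesis using assms(2) by (auto simp: tame_def)
qed

lemma tame_cmult: "tame g \<Longrightarrow> tame (\<lambda>x. c * g x)"
  by (rule tame_dominated[of g _ "\<bar>c\<bar>"]) (auto intro!: continuous_intros dest: tameD_continuous simp: abs_mult)

lemma tame_add:
  assumes "tame f" "tame g" shows "tame (\<lambda>x. f x + g x)"
proof -
  obtain B where B: "\<And>x. \<bar>f x\<bar> \<le> B" using tame_bound[OF assms(1)] by metis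
  obtain B' where B': "\<And>x. \<bar>g x\<bar> \<le> B'" using tame_bound[OF assms(2)] by metis
  have "\<bar>f x + g x\<bar> \<le> B + B'" for x using B[of x] B'[of x] by linarith
  then show ?thesis using assms unfolding tame_def by (auto intro!: continuous_intros)
qed

lemma tame_zero: "tame (\<lambda>x. 0)"
  by (auto simp: tame_def)

lemma tame_sum: "(\<And>i. i \<in> I \<Longrightarrow> tame (g i)) \<Longrightarrow> tame (\<lambda>x. \<Sum>i\<in>I. g i x)"
  by (induction I rule: infinite_finite_induct) (auto intro: tame_zero tame_add)

lemma tame_integrable_times:
  assumes "tame f" "tame g" shows "integrable lborel (\<lambda>x. f x * g x)"
proof -
  obtain B where B: "\<And>x. \<bar>f x\<bar> \<le> B" using tame_bound[OF assms(1)] by metis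
  show ?thesis
  proof (rule Bochner_Integration.integrable_bound)
    show "integrable lborel (\<lambda>x. B * g x)" using tameD_integrable[OF assms(2)] by simp
    show "AE x in lborel. norm (f x * g x) \<le> norm (B * g x)"
    proof (intro AE_I2)
      fix x show "norm (f x * g x) \<le> norm (B * g x)" using B[of x] by (auto simp: abs_mult intro!: mult_right_mono)
    qed
  qed (use assms[THEN tame_measurable] in measurable)
qed

lemma nn_integral_affine_euclidean:
  fixes f :: "'a::euclidean_space \<Rightarrow> ennreal"
  assumes [measurable]: "f \<in> borel_measurable borel" and c: "c \<noteq> 0"
  shows "(\<integral>\<^sup>+x. f x \<partial>lborel) = ennreal (\<bar>c\<bar> ^ DIM('a)) * (\<integral>\<^sup>+x. f (t + c *\<^sub>R x) \<partial>lborel)"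
  by (subst lborel_affine[OF c, of t])
     (simp add: nn_integral_density nn_integral_distr nn_integral_cmult)

lemma integral_affine_euclidean:
  fixes f :: "'a::euclidean_space \<Rightarrow> 'b::{banach, second_countable_topology}"
  assumes [measurable]: "f \<in> borel_measurable borel" and c: "c \<noteq> 0"
  shows "(\<integral>x. f x \<partial>lborel) = \<bar>c\<bar> ^ DIM('a) *\<^sub>R (\<integral>x. f (t + c *\<^sub>R x) \<partial>lborel)"
  by (subst lborel_affine[OF c, of t]) (simp add: integral_density integral_distr)

subsection \<open>Gaussian averages and a form of the Plancherel theorem\<close>

text \<open>The standard Gaussian law on a Euclidean space. It serves as a probability weight on the
  frequency side, so that squares of Fourier transforms can be integrated before anything is known
  about their decay.\<close>

definition gauss :: "'a::euclidean_space measure" where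
  "gauss = distr (\<Pi>\<^sub>M b\<in>Basis. std_normal_distribution) borel (\<lambda>f. \<Sum>b\<in>Basis. f b *\<^sub>R b)"

lemma sets_gauss [simp, measurable_cong]: "sets gauss = sets borel"
  by (simp add: gauss_def)

lemma prob_space_gauss: "prob_space (gauss :: 'a::euclidean_space measure)"
proof -
  interpret N: prob_space std_normal_distribution
    by (rule prob_space_normal_density) simp
  interpret product_prob_space "\<lambda>_::'a. std_normal_distribution" Basis
    by standard
  show ?thesis unfolding gauss_def
    by (rule P.prob_space_distr) measurable
qed

lemma gauss_char:
  fixes z :: "'a::euclidean_space"
  shows "(\<integral>w. cis (w \<bullet> z) \<partial>gauss) = complex_of_real (exp (- (norm z)\<^sup>2 / 2))"
proof -
  interpret N: prob_space std_normal_distribution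
    by (rule prob_space_normal_density) simp
  interpret product_sigma_finite "\<lambda>_::'a. std_normal_distribution"
    by standard
  have "(\<integral>w. cis (w \<bullet> z) \<partial>gauss)
      = (\<integral>f. cis ((\<Sum>b\<in>Basis. f b *\<^sub>R b) \<bullet> z) \<partial>(\<Pi>\<^sub>M b\<in>Basis. std_normal_distribution))"
    unfolding gauss_def by (subst integral_distr) (auto simp: cis_conv_exp)
  also have "\<dots> = (\<integral>f. (\<Prod>b\<in>Basis. iexp ((z \<bullet> b) * f b)) \<partial>(\<Pi>\<^sub>M (b::'a)\<in>Basis. std_normal_distribution))"
    by (intro Bochner_Integration.integral_cong refl)
       (simp add: cis_conv_exp inner_sum_right inner_sum_left exp_sum[symmetric] sum_distrib_left inner_commute mult_ac)
  also have "\<dots> = (\<Prod>b\<in>Basis. \<integral>x. iexp ((z \<bullet> b) * x) \<partial>std_normal_distribution)"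
    by (rule product_integral_prod) (auto intro!: N.integrable_const_bound[where B=1])
  also have "\<dots> = (\<Prod>b\<in>Basis. complex_of_real (exp (- ((z \<bullet> b)^2) / 2)))"
    using char_std_normal_distribution unfolding char_def fun_eq_iff by (intro prod.cong refl) blast
  also have "\<dots> = complex_of_real (exp (\<Sum>b\<in>Basis. - ((z \<bullet> b)^2) / 2))"
    by (simp add: exp_sum)
  also have "(\<Sum>b\<in>Basis. - ((z \<bullet> b)^2) / 2) = - (norm z)\<^sup>2 / 2"
    unfolding power2_norm_eq_inner
    by (subst euclidean_inner[of z z]) (simp add: power2_eq_square sum_negf sum_divide_distrib)
  finally show ?thesis .
qed

lemma integrable_lborel_prod:
  fixes f :: "real \<Rightarrow> real"
  assumes "integrable lborel f" "\<And>x. f x \<ge> 0"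
  shows "integrable lborel (\<lambda>x::'a::euclidean_space. \<Prod>b\<in>Basis. f (x \<bullet> b))"
proof -
  have [measurable]: "f \<in> borel_measurable borel" using assms by simp
  have "(\<integral>\<^sup>+x. ennreal (f x) \<partial>lborel) < \<infinity>"
    using assms by (simp add: integrable_iff_bounded)
  then have "(\<Prod>b\<in>(Basis::'a set). (\<integral>\<^sup>+x. ennreal (f x) \<partial>lborel)) < \<infinity>"
    by (auto simp: less_top[symmetric] ennreal_prod_eq_top power_eq_top_ennreal)
  also have "(\<Prod>b\<in>(Basis::'a set). (\<integral>\<^sup>+x. ennreal (f x) \<partial>lborel))
     = integral\<^sup>N lborel (\<lambda>x::'a. \<Prod>b\<in>Basis. ennreal (f (x \<bullet> b)))"
    by (subst nn_integral_lborel_prod) auto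
  finally show ?thesis using assms(2)
    by (intro integrableI_bounded) (auto simp: prod_ennreal abs_prod)
qed

lemma integrable_exp_norm:
  "integrable lborel (\<lambda>z::'a::euclidean_space. exp (- (norm z)\<^sup>2 / 2))"
proof -
  have "integrable lborel (\<lambda>x::real. sqrt (2 * pi) * std_normal_density x)"
    by (intro integrable_mult_right) (simp add: integrable_normal_density)
  then have "integrable lborel (\<lambda>x::real. exp (- x\<^sup>2 / 2))"
    by (simp add: std_normal_density_def)
  from integrable_lborel_prod[OF this, where ?'a='a]
  have "integrable lborel (\<lambda>z::'a. \<Prod>b\<in>Basis. exp (- (z \<bullet> b)\<^sup>2 / 2))" by simp
  also have "(\<lambda>z::'a. \<Prod>b\<in>Basis. exp (- (z \<bullet> b)\<^sup>2 / 2)) = (\<lambda>z. exp (- (norm z)\<^sup>2 / 2))"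
    unfolding power2_norm_eq_inner
    by (subst (2) euclidean_inner) (simp add: exp_sum[symmetric] power2_eq_square sum_negf sum_divide_distrib)
  finally show ?thesis .
qed

lemma integral_exp_norm_pos:
  "integral\<^sup>L lborel (\<lambda>z::'a::euclidean_space. exp (- (norm z)\<^sup>2 / 2)) > 0"
proof -
  have "integral\<^sup>L lborel (\<lambda>z::'a::euclidean_space. exp (- (norm z)\<^sup>2 / 2)) \<noteq> 0"
  proof
    assume "integral\<^sup>L lborel (\<lambda>z::'a::euclidean_space. exp (- (norm z)\<^sup>2 / 2)) = 0"
    then have "AE z::'a in lborel. exp (- (norm z)\<^sup>2 / 2) = 0"
      by (subst (asm) integral_nonneg_eq_0_iff_AE[OF integrable_exp_norm]) auto
    then show False by (simp add: AE_iff_null null_sets_def)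
  qed
  moreover have "integral\<^sup>L lborel (\<lambda>z::'a::euclidean_space. exp (- (norm z)\<^sup>2 / 2)) \<ge> 0"
    by simp
  ultimately show ?thesis by linarith
qed

definition fourier :: "('a::euclidean_space \<Rightarrow> real) \<Rightarrow> 'a \<Rightarrow> complex" where
  "fourier g \<xi> = (\<integral>x. g x *\<^sub>R cis (- (\<xi> \<bullet> x)) \<partial>lborel)"

lemma measurable_cis [measurable]: "cis \<in> borel_measurable borel"
  by (auto intro!: borel_measurable_continuous_onI continuous_intros)

lemma measurable_cnj [measurable]: "cnj \<in> borel_measurable borel"
  by (auto intro!: borel_measurable_continuous_onI continuous_intros)

lemma integrable_fourier:
  assumes "tame g" shows "integrable lborel (\<lambda>x. g x *\<^sub>R cis (- (\<xi> \<bullet> x)))"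
proof -
  note [measurable] = tame_measurable[OF assms]
  show ?thesis using tameD_integrable[OF assms] by (rule Bochner_Integration.integrable_bound) auto
qed

lemma measurable_fourier:
  assumes g: "tame g" shows "fourier g \<in> borel_measurable borel"
proof -
  note [measurable] = tame_measurable[OF g]
  have "(\<lambda>\<xi>. \<integral>x. g x *\<^sub>R cis (- (\<xi> \<bullet> x)) \<partial>lborel) \<in> borel_measurable borel"
    by (rule lborel.borel_measurable_lebesgue_integral) measurable
  then show ?thesis by (simp add: fourier_def[abs_def])
qed

text \<open>The squared modulus is opened into a double integral over x and y, and the Gaussian is
  integrated first: its characteristic function at \<open>s (y - x)\<close> is the kernel on the
  right. Each exchange involves a probability measure and an absolutely convergent integral.\<close>

lemma gauss_fourier:
  fixes g :: "'a::euclidean_space \<Rightarrow> real"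
  assumes g: "tame g"
  shows "(\<integral>w. (cmod (fourier g (s *\<^sub>R w)))\<^sup>2 \<partial>gauss)
       = (\<integral>x. g x * (\<integral>y. g y * exp (- s\<^sup>2 * (norm (x - y))\<^sup>2 / 2) \<partial>lborel) \<partial>lborel)"
proof -
  interpret G: prob_space "gauss :: 'a measure" by (rule prob_space_gauss)
  interpret P: pair_sigma_finite "gauss :: 'a measure" "lborel :: 'a measure" ..
  define B where "B = (\<integral>x. \<bar>g x\<bar> \<partial>lborel)"
  note [measurable] = tame_measurable[OF g] measurable_fourier[OF g]
  have F: "cmod (fourier g \<xi>) \<le> B" for \<xi>
    unfolding fourier_def B_def by (rule order_trans[OF integral_norm_bound]) simp
  have gi: "integrable lborel g" using g by (rule tameD_integrable)
  have "complex_of_real (\<integral>w. (cmod (fourier g (s *\<^sub>R w)))\<^sup>2 \<partial>gauss)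
      = (\<integral>w. fourier g (s *\<^sub>R w) * cnj (fourier g (s *\<^sub>R w)) \<partial>gauss)"
    by (subst integral_complex_of_real[symmetric])
       (simp only: complex_norm_square)
  also have "\<dots> = (\<integral>w. \<integral>x. (g x *\<^sub>R cis (- (s *\<^sub>R w \<bullet> x))) * cnj (fourier g (s *\<^sub>R w)) \<partial>lborel \<partial>gauss)"
    by (subst (1) fourier_def) (simp only: integral_mult_left_zero)
  also have "\<dots> = (\<integral>x. \<integral>w. (g x *\<^sub>R cis (- (s *\<^sub>R w \<bullet> x))) * cnj (fourier g (s *\<^sub>R w)) \<partial>gauss \<partial>lborel)"
  proof (rule P.Fubini_integral[symmetric])
    have i: "integrable (gauss \<Otimes>\<^sub>M lborel) (\<lambda>(w::'a, x). B * \<bar>g x\<bar>)"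
      by (rule P.Fubini_integrable) (use gi in auto)
    show "integrable (gauss \<Otimes>\<^sub>M lborel) (\<lambda>(w::'a, x). g x *\<^sub>R cis (- (s *\<^sub>R w \<bullet> x)) * cnj (fourier g (s *\<^sub>R w)))"
    proof (rule Bochner_Integration.integrable_bound[OF i])
      have "cmod (g x *\<^sub>R cis (- (s *\<^sub>R w \<bullet> x)) * cnj (fourier g (s *\<^sub>R w))) \<le> B * \<bar>g x\<bar>" for w x
        using mult_right_mono[OF F[of "s *\<^sub>R w"], of "\<bar>g x\<bar>"] by (simp add: norm_mult mult.commute)
      then show "AE p in gauss \<Otimes>\<^sub>M lborel. norm (case p of (w, x) \<Rightarrow> g x *\<^sub>R cis (- (s *\<^sub>R w \<bullet> x)) * cnj (fourier g (s *\<^sub>R w)))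
          \<le> norm (case p of (w, x) \<Rightarrow> B * \<bar>g x\<bar>)"
        by (intro AE_I2) (auto intro: order_trans[OF _ abs_ge_self])
    qed measurable
  qed
  also have "\<dots> = (\<integral>x. g x *\<^sub>R complex_of_real (\<integral>y. g y * exp (- s\<^sup>2 * (norm (x - y))\<^sup>2 / 2) \<partial>lborel) \<partial>lborel)"
  proof (rule Bochner_Integration.integral_cong[OF refl])
    fix x :: 'a
    have c: "cnj (fourier g (s *\<^sub>R w)) = (\<integral>y. g y *\<^sub>R cis (s *\<^sub>R w \<bullet> y) \<partial>lborel)" for w
    proof -
      have "cnj (fourier g (s *\<^sub>R w)) = (\<integral>y. cnj (g y *\<^sub>R cis (- (s *\<^sub>R w \<bullet> y))) \<partial>lborel)"
        unfolding fourier_def by (rule Bochner_Integration.integral_cnj[symmetric])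
      also have "\<dots> = (\<integral>y. g y *\<^sub>R cis (s *\<^sub>R w \<bullet> y) \<partial>lborel)"
        by (intro Bochner_Integration.integral_cong refl) (simp add: cis_cnj)
      finally show ?thesis .
    qed
    have "(\<integral>w. (g x *\<^sub>R cis (- (s *\<^sub>R w \<bullet> x))) * cnj (fourier g (s *\<^sub>R w)) \<partial>gauss)
        = g x *\<^sub>R (\<integral>w. \<integral>y. cis (- (s *\<^sub>R w \<bullet> x)) * (g y *\<^sub>R cis (s *\<^sub>R w \<bullet> y)) \<partial>lborel \<partial>gauss)"
      unfolding c by (simp only: integral_scaleR_right integral_mult_right_zero mult_scaleR_left)
    also have "(\<integral>w. \<integral>y. cis (- (s *\<^sub>R w \<bullet> x)) * (g y *\<^sub>R cis (s *\<^sub>R w \<bullet> y)) \<partial>lborel \<partial>gauss)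
       = (\<integral>w. \<integral>y. g y *\<^sub>R cis (w \<bullet> (s *\<^sub>R (y - x))) \<partial>lborel \<partial>gauss)"
      by (intro Bochner_Integration.integral_cong refl)
         (simp add: cis_mult inner_diff_right algebra_simps)
    also have "\<dots> = (\<integral>y. \<integral>w. g y *\<^sub>R cis (w \<bullet> (s *\<^sub>R (y - x))) \<partial>gauss \<partial>lborel)"
    proof (rule P.Fubini_integral[symmetric])
      have i: "integrable (gauss \<Otimes>\<^sub>M lborel) (\<lambda>(w::'a, x). g x)"
        by (rule P.Fubini_integrable) (use gi in auto)
      show "integrable (gauss \<Otimes>\<^sub>M lborel) (\<lambda>(w, y). g y *\<^sub>R cis (w \<bullet> (s *\<^sub>R (y - x))))"
        by (rule Bochner_Integration.integrable_bound[OF i]) auto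
    qed
    also have "\<dots> = (\<integral>y. complex_of_real (g y * exp (- s\<^sup>2 * (norm (x - y))\<^sup>2 / 2)) \<partial>lborel)"
      by (intro Bochner_Integration.integral_cong refl)
         (simp only: integral_scaleR_right gauss_char,
          simp add: power_mult_distrib norm_minus_commute scaleR_conv_of_real)
    also have "\<dots> = complex_of_real (\<integral>y. g y * exp (- s\<^sup>2 * (norm (x - y))\<^sup>2 / 2) \<partial>lborel)"
      by (rule integral_complex_of_real)
    finally show "(\<integral>w. (g x *\<^sub>R cis (- (s *\<^sub>R w \<bullet> x))) * cnj (fourier g (s *\<^sub>R w)) \<partial>gauss)
      = g x *\<^sub>R complex_of_real (\<integral>y. g y * exp (- s\<^sup>2 * (norm (x - y))\<^sup>2 / 2) \<partial>lborel)" .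
  qed
  also have "\<dots> = (\<integral>x. complex_of_real (g x * (\<integral>y. g y * exp (- s\<^sup>2 * (norm (x - y))\<^sup>2 / 2) \<partial>lborel)) \<partial>lborel)"
    by (simp add: scaleR_conv_of_real)
  also have "\<dots> = complex_of_real (\<integral>x. g x * (\<integral>y. g y * exp (- s\<^sup>2 * (norm (x - y))\<^sup>2 / 2) \<partial>lborel) \<partial>lborel)"
    by (rule integral_complex_of_real)
  finally show ?thesis unfolding of_real_eq_iff .
qed

text \<open>Plancherel's theorem in disguise: multiplied by \<open>s^d\<close>, the average at
  dilation s integrates the squared transform against a Gaussian density stretched by s. The
  substitution \<open>y = x + z / s\<close> in \<open>gauss_fourier\<close> absorbs
  \<open>s^d\<close> and leaves an approximate identity. The constant will cancel, since only two
  such limits are compared.\<close>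

lemma plancherel_limit:
  fixes g :: "'a::euclidean_space \<Rightarrow> real"
  assumes g: "tame g"
  shows "(\<lambda>n. real (Suc n) ^ DIM('a) * (\<integral>w. (cmod (fourier g (real (Suc n) *\<^sub>R w)))\<^sup>2 \<partial>gauss))
     \<longlonglongrightarrow> integral\<^sup>L lborel (\<lambda>z::'a. exp (- (norm z)\<^sup>2 / 2)) * (\<integral>x. (g x)\<^sup>2 \<partial>lborel)"
proof -
  note [measurable] = tame_measurable[OF g]
  obtain B where B: "B > 0" "\<And>x. \<bar>g x\<bar> \<le> B" using tame_bound[OF g] by metis
  have gi: "integrable lborel g" using g by (rule tameD_integrable)
  let ?e = "\<lambda>z::'a. exp (- (norm z)\<^sup>2 / 2)"
  have i: "integrable (lborel \<Otimes>\<^sub>M lborel) (\<lambda>(x, z). \<bar>g x\<bar> * (B * ?e z))"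
    by (rule lborel_pair.Fubini_integrable) (use gi integrable_exp_norm in \<open>auto simp: abs_mult\<close>)
  define s where "s n = real (Suc n)" for n
  have s: "s n > 0" for n by (simp add: s_def)
  have bd: "\<bar>g x * g y * ?e z\<bar> \<le> \<bar>g x\<bar> * (B * ?e z)" for x y z
    using B by (simp add: abs_mult mult.assoc mult_left_mono mult_right_mono)
  have bd': "norm (g x * g y * ?e z) \<le> norm (\<bar>g x\<bar> * (B * ?e z))" for x y z
    using bd[of x y z] by (auto intro: order_trans[OF _ abs_ge_self])
  have in1: "integrable (lborel \<Otimes>\<^sub>M lborel) (\<lambda>(x, z). g x * g (x + z /\<^sub>R s n) * ?e z)" for n
    by (rule Bochner_Integration.integrable_bound[OF i])
       (measurable, intro AE_I2, simp only: split_beta, rule bd')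
  have "s n ^ DIM('a) * (\<integral>w. (cmod (fourier g (s n *\<^sub>R w)))\<^sup>2 \<partial>gauss)
     = (\<integral>p. (case p of (x, z) \<Rightarrow> g x * g (x + z /\<^sub>R s n) * ?e z) \<partial>(lborel \<Otimes>\<^sub>M lborel))" for n
  proof -
    have "s n ^ DIM('a) * (\<integral>y. g y * exp (- (s n)\<^sup>2 * (norm (x - y))\<^sup>2 / 2) \<partial>lborel)
        = (\<integral>z. g (x + z /\<^sub>R s n) * ?e z \<partial>lborel)" for x
    proof -
      have "(\<integral>y. g y * exp (- (s n)\<^sup>2 * (norm (x - y))\<^sup>2 / 2) \<partial>lborel)
         = \<bar>1 / s n\<bar> ^ DIM('a) *\<^sub>R (\<integral>z. g (x + (1 / s n) *\<^sub>R z) * exp (- (s n)\<^sup>2 * (norm (x - (x + (1 / s n) *\<^sub>R z)))\<^sup>2 / 2) \<partial>lborel)"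
        by (rule integral_affine_euclidean) (use s[of n] in auto)
      also have "\<dots> = (1 / s n ^ DIM('a)) * (\<integral>z. g (x + z /\<^sub>R s n) * ?e z \<partial>lborel)"
        using s[of n] by (simp add: power_mult_distrib power_divide inverse_eq_divide)
      finally show ?thesis using s[of n] by simp
    qed
    then have "s n ^ DIM('a) * (\<integral>w. (cmod (fourier g (s n *\<^sub>R w)))\<^sup>2 \<partial>gauss)
      = (\<integral>x. g x * (\<integral>z. g (x + z /\<^sub>R s n) * ?e z \<partial>lborel) \<partial>lborel)"
      unfolding gauss_fourier[OF g]
      by (subst integral_mult_right_zero[symmetric]) (simp add: mult.left_commute)
    also have "\<dots> = (\<integral>x. (\<integral>z. g x * g (x + z /\<^sub>R s n) * ?e z \<partial>lborel) \<partial>lborel)"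
      by (simp add: mult.assoc)
    also have "\<dots> = (\<integral>p. (case p of (x, z) \<Rightarrow> g x * g (x + z /\<^sub>R s n) * ?e z) \<partial>(lborel \<Otimes>\<^sub>M lborel))"
      using lborel_pair.integral_fst'[OF in1[of n]] by simp
    finally show ?thesis .
  qed
  moreover have "(\<lambda>n. \<integral>p. (case p of (x, z) \<Rightarrow> g x * g (x + z /\<^sub>R s n) * ?e z) \<partial>(lborel \<Otimes>\<^sub>M lborel))
     \<longlonglongrightarrow> (\<integral>p. (case p of (x, z) \<Rightarrow> g x * g x * ?e z) \<partial>(lborel \<Otimes>\<^sub>M lborel))"
  proof (rule integral_dominated_convergence[OF _ _ i])
    show "AE p in lborel \<Otimes>\<^sub>M lborel. (\<lambda>n. case p of (x, z) \<Rightarrow> g x * g (x + z /\<^sub>R s n) * ?e z)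
        \<longlonglongrightarrow> (case p of (x, z) \<Rightarrow> g x * g x * ?e z)"
    proof (intro AE_I2, clarify)
      fix x z :: 'a
      have "(\<lambda>n. inverse (s n)) \<longlonglongrightarrow> 0"
        unfolding s_def by (rule LIMSEQ_inverse_real_of_nat)
      then have "(\<lambda>n. x + z /\<^sub>R s n) \<longlonglongrightarrow> x + 0 *\<^sub>R z"
        by (intro tendsto_intros)
      then have "(\<lambda>n. g (x + z /\<^sub>R s n)) \<longlonglongrightarrow> g x"
        using isCont_tendsto_compose[OF tame_continuous_at[OF g, of x]] by simp
      then show "(\<lambda>n. g x * g (x + z /\<^sub>R s n) * ?e z) \<longlonglongrightarrow> g x * g x * ?e z"
        by (intro tendsto_intros)
    qed
    show "AE p in lborel \<Otimes>\<^sub>M lborel. norm (case p of (x, z) \<Rightarrow> g x * g (x + z /\<^sub>R s n) * ?e z)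
          \<le> (case p of (x, z) \<Rightarrow> \<bar>g x\<bar> * (B * ?e z))" for n
      by (intro AE_I2) (use bd in \<open>simp split: prod.split\<close>)
  qed measurable
  moreover have "(\<integral>p. (case p of (x, z) \<Rightarrow> g x * g x * ?e z) \<partial>(lborel \<Otimes>\<^sub>M lborel))
      = (\<integral>z. ?e z \<partial>lborel) * (\<integral>x. (g x)\<^sup>2 \<partial>lborel)"
  proof -
    have "integrable (lborel \<Otimes>\<^sub>M lborel) (\<lambda>(x, z). g x * g x * ?e z)"
      by (rule Bochner_Integration.integrable_bound[OF i])
         (measurable, intro AE_I2, simp only: split_beta, rule bd')
    from lborel_pair.integral_fst'[OF this]
    show ?thesis by (simp add: power2_eq_square mult.commute)
  qed
  ultimately show ?thesis unfolding s_def by simp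
qed

text \<open>Dominated convergence of difference quotients, which the mean value inequality bounds by
  K. That inequality is used along the whole line for a fixed u, hence the quantifier over s inside
  the almost everywhere statement; on the sphere the exceptional set is where |u| differs from
  1.\<close>

lemma has_real_derivative_integral:
  fixes F F' :: "real \<Rightarrow> 'b \<Rightarrow> real"
  assumes "finite_measure M"
    and int: "\<And>s. integrable M (F s)"
    and meas [measurable]: "F' s0 \<in> borel_measurable M"
    and deriv: "\<And>s u. ((\<lambda>s. F s u) has_real_derivative F' s u) (at s)"
    and bound: "AE u in M. \<forall>s. \<bar>F' s u\<bar> \<le> K"
  shows "((\<lambda>s. \<integral>u. F s u \<partial>M) has_real_derivative (\<integral>u. F' s0 u \<partial>M)) (at s0)"
proof -
  interpret finite_measure M by fact
  have [measurable]: "F s \<in> borel_measurable M" for s using int by auto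
  show ?thesis
    unfolding has_field_derivative_iff tendsto_at_iff_sequentially
  proof (intro allI impI)
    fix X :: "nat \<Rightarrow> real" assume X: "\<forall>i. X i \<in> UNIV - {s0}" "X \<longlonglongrightarrow> s0"
    have "((\<lambda>y. ((\<integral>u. F y u \<partial>M) - (\<integral>u. F s0 u \<partial>M)) / (y - s0)) \<circ> X)
        = (\<lambda>i. \<integral>u. (F (X i) u - F s0 u) / (X i - s0) \<partial>M)"
      using int by (auto simp: fun_eq_iff)
    moreover have "(\<lambda>i. \<integral>u. (F (X i) u - F s0 u) / (X i - s0) \<partial>M) \<longlonglongrightarrow> (\<integral>u. F' s0 u \<partial>M)"
    proof (rule integral_dominated_convergence[where w="\<lambda>_. K"])
      show "AE u in M. (\<lambda>i. (F (X i) u - F s0 u) / (X i - s0)) \<longlonglongrightarrow> F' s0 u"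
      proof (intro AE_I2)
        fix u
        from deriv[of u s0] X show "(\<lambda>i. (F (X i) u - F s0 u) / (X i - s0)) \<longlonglongrightarrow> F' s0 u"
          unfolding has_field_derivative_iff tendsto_at_iff_sequentially comp_def by blast
      qed
      show "AE u in M. norm ((F (X i) u - F s0 u) / (X i - s0)) \<le> K" for i
        using bound
      proof eventually_elim
        case (elim u)
        have ne: "X i \<noteq> s0" using X by auto
        have "norm (F (X i) u - F s0 u) \<le> K * norm (X i - s0)"
          by (rule field_differentiable_bound[where S=UNIV and f'="\<lambda>s. F' s u"])
             (use deriv elim in auto)
        with ne show ?case by (simp add: field_simps)
      qed
    qed (auto simp: integrable_const)
    ultimately show "((\<lambda>y. ((\<integral>u. F y u \<partial>M) - (\<integral>u. F s0 u \<partial>M)) / (y - s0)) \<circ> X) \<longlonglongrightarrow> (\<integral>u. F' s0 u \<partial>M)"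
      by simp
  qed
qed

text \<open>For a \<noteq> b, the reflection in the hyperplane orthogonal to a - b; equality of the
  norms is what makes it send a to b.\<close>

lemma orthogonal_transformation_exists_euclidean:
  fixes a b :: "'a::euclidean_space"
  assumes "norm a = norm b"
  obtains T where "orthogonal_transformation T" "T a = b"
proof (cases "a = b")
  case True
  then show ?thesis using that[of "\<lambda>x. x"] by (simp add: orthogonal_transformation_id)
next
  case False
  define w where "w = a - b"
  define T where "T x = x - (2 * (x \<bullet> w) / (w \<bullet> w)) *\<^sub>R w" for x
  have w: "w \<bullet> w \<noteq> 0" using False by (simp add: w_def)
  have "T x \<bullet> T y = x \<bullet> y" for x y
  proof -
    have "T x \<bullet> T y = x \<bullet> y - 2 * (x \<bullet> w) / (w \<bullet> w) * (w \<bullet> y) - 2 * (y \<bullet> w) / (w \<bullet> w) * (x \<bullet> w)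
        + 2 * (x \<bullet> w) / (w \<bullet> w) * (2 * (y \<bullet> w) / (w \<bullet> w) * (w \<bullet> w))"
      by (simp add: T_def inner_diff_left inner_diff_right algebra_simps)
    also have "\<dots> = x \<bullet> y" using w by (simp add: inner_commute)
    finally show ?thesis .
  qed
  moreover have "linear T"
    unfolding T_def
    by (intro linearI) (simp_all add: inner_add_left scaleR_diff_right add_divide_distrib distrib_left scaleR_left_distrib)
  ultimately have "orthogonal_transformation T" by (simp add: orthogonal_transformation_def)
  moreover have "T a = b"
  proof -
    have "w \<bullet> w = 2 * (a \<bullet> w)"
      using assms by (simp add: w_def norm_eq inner_diff_left inner_diff_right inner_commute)
    then have "2 * (a \<bullet> w) / (w \<bullet> w) = 1" using w by (metis divide_self)
    then show ?thesis unfolding T_def by (simp only: scaleR_one) (simp add: w_def)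
  qed
  ultimately show ?thesis by (rule that)
qed

subsection \<open>Rotation invariant measures on the sphere\<close>

text \<open>Rotation invariance enters twice: it makes the Fourier transform radial, which leads to
  the differential equation, and it reduces \<open>cone_ball\<close> to the pole. The dimension
  bound puts the threshold d/(d-1) below 2, where L^2 estimates help, and keeps the exponents d - 2
  and d - 3 from being truncated by natural subtraction.\<close>

locale sphere_measure =
  fixes \<sigma> :: "'a::euclidean_space measure"
  assumes sets_\<sigma> [simp, measurable_cong]: "sets \<sigma> = sets borel"
    and mass: "emeasure \<sigma> UNIV \<le> 1"
    and invariant: "orthogonal_transformation T \<Longrightarrow> distr \<sigma> borel T = \<sigma>"
    and unit: "AE u in \<sigma>. norm u = 1"
    and dim: "DIM('a) \<ge> 3"
begin

lemma space_\<sigma> [simp]: "space \<sigma> = UNIV"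
  using sets_eq_imp_space_eq[OF sets_\<sigma>] by simp

sublocale finite_measure \<sigma>
  by standard (use mass in \<open>auto simp: top_unique\<close>)

lemma measure_le_1: "measure \<sigma> UNIV \<le> 1"
  using mass by (simp add: emeasure_eq_measure)

lemma integral_invariant:
  fixes f :: "'a \<Rightarrow> 'b::{banach, second_countable_topology}"
  assumes T: "orthogonal_transformation T" and [measurable]: "f \<in> borel_measurable borel"
  shows "(\<integral>u. f (T u) \<partial>\<sigma>) = (\<integral>u. f u \<partial>\<sigma>)"
proof -
  have [measurable]: "T \<in> borel_measurable borel"
    using T by (intro borel_measurable_continuous_onI linear_continuous_on)
      (simp add: linear_linear orthogonal_transformation_linear)
  have "(\<integral>u. f u \<partial>\<sigma>) = (\<integral>u. f u \<partial>(distr \<sigma> borel T))" by (simp add: invariant T)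
  also have "\<dots> = (\<integral>u. f (T u) \<partial>\<sigma>)" by (rule integral_distr) auto
  finally show ?thesis ..
qed

lemma nn_integral_invariant:
  assumes T: "orthogonal_transformation T" and [measurable]: "f \<in> borel_measurable borel"
  shows "(\<integral>\<^sup>+u. f (T u) \<partial>\<sigma>) = (\<integral>\<^sup>+u. f u \<partial>\<sigma>)"
proof -
  have [measurable]: "T \<in> borel_measurable borel"
    using T by (intro borel_measurable_continuous_onI linear_continuous_on)
      (simp add: linear_linear orthogonal_transformation_linear)
  have "(\<integral>\<^sup>+u. f u \<partial>\<sigma>) = (\<integral>\<^sup>+u. f u \<partial>(distr \<sigma> borel T))" by (simp add: invariant T)
  also have "\<dots> = (\<integral>\<^sup>+u. f (T u) \<partial>\<sigma>)" by (rule nn_integral_distr) auto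
  finally show ?thesis ..
qed

lemma integrable_bounded:
  fixes f :: "'a \<Rightarrow> 'b::{banach, second_countable_topology}"
  assumes "f \<in> borel_measurable borel" "\<And>u. norm u = 1 \<Longrightarrow> norm (f u) \<le> B"
  shows "integrable \<sigma> f"
  using unit assms by (intro integrable_const_bound[where B=B]) auto

lemma norm_integral_le:
  fixes f :: "'a \<Rightarrow> 'b::{banach, second_countable_topology}"
  assumes [measurable]: "f \<in> borel_measurable borel" and "\<And>u. norm u = 1 \<Longrightarrow> norm (f u) \<le> B" and "B \<ge> 0"
  shows "norm (\<integral>u. f u \<partial>\<sigma>) \<le> B"
proof -
  have i: "integrable \<sigma> f" using assms by (intro integrable_bounded) auto
  have "norm (\<integral>u. f u \<partial>\<sigma>) \<le> (\<integral>u. norm (f u) \<partial>\<sigma>)" by (rule integral_norm_bound)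
  also have "\<dots> \<le> (\<integral>u. B \<partial>\<sigma>)"
    by (intro integral_mono_AE integrable_norm i) (use unit assms(2) in auto)
  also have "\<dots> = measure \<sigma> UNIV * B" by simp
  also have "\<dots> \<le> 1 * B" using assms(3) measure_le_1 by (intro mult_right_mono) auto
  finally show ?thesis by simp
qed

definition pole :: 'a where "pole = (SOME b. b \<in> Basis)"

lemma pole_Basis: "pole \<in> Basis"
  unfolding pole_def using nonempty_Basis by (metis ex_in_conv someI_ex)

text \<open>The Fourier transform of the measure at distance r from the origin. Its sine part
  vanishes by the symmetry u -> -u, see \<open>integral_sin\<close>, so a real function
  suffices.\<close>

definition multiplier :: "real \<Rightarrow> real" where
  "multiplier r = (\<integral>u. cos (r * (u \<bullet> pole)) \<partial>\<sigma>)"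

definition multiplier' :: "real \<Rightarrow> real" where
  "multiplier' r = (\<integral>u. - ((u \<bullet> pole) * sin (r * (u \<bullet> pole))) \<partial>\<sigma>)"

definition multiplier'' :: "real \<Rightarrow> real" where
  "multiplier'' r = (\<integral>u. - ((u \<bullet> pole)\<^sup>2 * cos (r * (u \<bullet> pole))) \<partial>\<sigma>)"

lemma abs_inner_Basis_le: "b \<in> Basis \<Longrightarrow> norm u = 1 \<Longrightarrow> \<bar>u \<bullet> b\<bar> \<le> 1"
  using Basis_le_norm[of b u] by simp

lemma power2_inner_Basis_le: "b \<in> Basis \<Longrightarrow> norm u = 1 \<Longrightarrow> (u \<bullet> b)\<^sup>2 \<le> 1"
  using abs_inner_Basis_le[of b u] by (simp add: abs_square_le_1)

text \<open>The extra frequency c in the direction a makes one statement serve for derivatives along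
  the pole (c = 0) and for those transverse to it, taken at a point of the axis through the
  pole.\<close>

lemma DERIV_plane_cos:
  assumes b: "b \<in> Basis"
  shows "((\<lambda>s. \<integral>u. cos (c * (u \<bullet> a) + s * (u \<bullet> b)) \<partial>\<sigma>) has_real_derivative
          (\<integral>u. - ((u \<bullet> b) * sin (c * (u \<bullet> a) + s * (u \<bullet> b))) \<partial>\<sigma>)) (at s)"
proof (rule has_real_derivative_integral[where K=1])
  show "AE u in \<sigma>. \<forall>s. \<bar>- ((u \<bullet> b) * sin (c * (u \<bullet> a) + s * (u \<bullet> b)))\<bar> \<le> 1"
    using unit by eventually_elim
      (use abs_inner_Basis_le[OF b] in \<open>auto simp: abs_mult intro!: mult_le_one\<close>)
qed (auto intro!: derivative_eq_intros integrable_const_bound[where B=1] finite_measure_axioms)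

lemma DERIV_plane_sin:
  assumes b: "b \<in> Basis"
  shows "((\<lambda>s. \<integral>u. - ((u \<bullet> b) * sin (c * (u \<bullet> a) + s * (u \<bullet> b))) \<partial>\<sigma>) has_real_derivative
          (\<integral>u. - ((u \<bullet> b)\<^sup>2 * cos (c * (u \<bullet> a) + s * (u \<bullet> b))) \<partial>\<sigma>)) (at s)"
proof (rule has_real_derivative_integral[where K=1])
  show "AE u in \<sigma>. \<forall>s. \<bar>- ((u \<bullet> b)\<^sup>2 * cos (c * (u \<bullet> a) + s * (u \<bullet> b)))\<bar> \<le> 1"
    using unit by eventually_elim
      (use power2_inner_Basis_le[OF b] in \<open>auto simp: abs_mult intro!: mult_le_one\<close>)
  show "integrable \<sigma> (\<lambda>u. - ((u \<bullet> b) * sin (c * (u \<bullet> a) + s * (u \<bullet> b))))" for s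
    by (rule integrable_bounded[where B=1])
      (use abs_inner_Basis_le[OF b] in \<open>auto simp: abs_mult intro!: mult_le_one\<close>)
qed (auto intro!: derivative_eq_intros finite_measure_axioms simp: power2_eq_square)

lemma DERIV_multiplier: "(multiplier has_real_derivative multiplier' r) (at r)"
  using DERIV_plane_cos[OF pole_Basis, of 0 0 r]
  by (simp add: multiplier_def[abs_def] multiplier'_def)

lemma DERIV_multiplier': "(multiplier' has_real_derivative multiplier'' r) (at r)"
  using DERIV_plane_sin[OF pole_Basis, of 0 0 r]
  by (simp add: multiplier'_def[abs_def] multiplier''_def)

lemma integral_cos: "(\<integral>u. cos (\<xi> \<bullet> u) \<partial>\<sigma>) = multiplier (norm \<xi>)"
proof -
  have "norm \<xi> = norm (norm \<xi> *\<^sub>R pole)" using pole_Basis by simp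
  then obtain T where T: "orthogonal_transformation T" "T \<xi> = norm \<xi> *\<^sub>R pole"
    by (rule orthogonal_transformation_exists_euclidean)
  have "\<xi> \<bullet> u = T \<xi> \<bullet> T u" for u using T(1) by (simp add: orthogonal_transformation_def)
  then have "(\<integral>u. cos (\<xi> \<bullet> u) \<partial>\<sigma>) = (\<integral>u. cos ((norm \<xi> *\<^sub>R pole) \<bullet> T u) \<partial>\<sigma>)"
    by (simp add: T)
  also have "\<dots> = (\<integral>u. cos ((norm \<xi> *\<^sub>R pole) \<bullet> u) \<partial>\<sigma>)"
    by (rule integral_invariant[OF T(1)]) measurable
  finally show ?thesis by (simp add: multiplier_def inner_commute)
qed

lemma integral_sin: "(\<integral>u. sin (\<xi> \<bullet> u) \<partial>\<sigma>) = 0"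
proof -
  have "(\<integral>u. sin (\<xi> \<bullet> (- u)) \<partial>\<sigma>) = (\<integral>u. sin (\<xi> \<bullet> u) \<partial>\<sigma>)"
    by (rule integral_invariant)
      (auto simp: orthogonal_transformation_def intro: linear_compose_neg linear_ident linearI)
  then show ?thesis by simp
qed

lemma integral_cis: "(\<integral>u. cis (- (\<xi> \<bullet> u)) \<partial>\<sigma>) = complex_of_real (multiplier (norm \<xi>))"
proof -
  have "cis (- (\<xi> \<bullet> u)) = complex_of_real (cos (\<xi> \<bullet> u)) - \<i> * complex_of_real (sin (\<xi> \<bullet> u))" for u
    by (simp add: complex_eq_iff)
  moreover have "integrable \<sigma> (\<lambda>u. complex_of_real (cos (\<xi> \<bullet> u)))"
    "integrable \<sigma> (\<lambda>u. \<i> * complex_of_real (sin (\<xi> \<bullet> u)))"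
    by (auto intro!: integrable_const_bound[where B=1] simp: norm_mult)
  ultimately have "(\<integral>u. cis (- (\<xi> \<bullet> u)) \<partial>\<sigma>)
     = (\<integral>u. complex_of_real (cos (\<xi> \<bullet> u)) \<partial>\<sigma>) - (\<integral>u. \<i> * complex_of_real (sin (\<xi> \<bullet> u)) \<partial>\<sigma>)"
    by simp
  then show ?thesis by (simp add: integral_cos integral_sin)
qed

text \<open>Both sides of \<open>\<integral>cos (r u\<^sub>1 + s u\<^sub>b) = multiplier (sqrt (r\<^sup>2 + s\<^sup>2))\<close> are differentiated twice
  in \<open>s\<close> at \<open>s = 0\<close>.\<close>
lemma integral_tangential:
  assumes b: "b \<in> Basis" "b \<noteq> pole" and r: "r > 0"
  shows "(\<integral>u. - ((u \<bullet> b)\<^sup>2 * cos (r * (u \<bullet> pole))) \<partial>\<sigma>) = multiplier' r / r"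
proof -
  have nrm: "norm (r *\<^sub>R pole + s *\<^sub>R b) = sqrt (r\<^sup>2 + s\<^sup>2)" for s
    using b pole_Basis
    by (simp add: norm_eq_sqrt_inner inner_add_left inner_add_right inner_Basis inner_commute power2_eq_square)
  have G: "(\<integral>u. cos (r * (u \<bullet> pole) + s * (u \<bullet> b)) \<partial>\<sigma>) = multiplier (sqrt (r\<^sup>2 + s\<^sup>2))" for s
    using integral_cos[of "r *\<^sub>R pole + s *\<^sub>R b"] by (simp add: nrm inner_add_left inner_add_right inner_commute)
  have pos: "r\<^sup>2 + s\<^sup>2 > 0" for s using r by (simp add: add_pos_nonneg)
  have D1: "(\<integral>u. - ((u \<bullet> b) * sin (r * (u \<bullet> pole) + s * (u \<bullet> b))) \<partial>\<sigma>)
      = multiplier' (sqrt (r\<^sup>2 + s\<^sup>2)) * (s / sqrt (r\<^sup>2 + s\<^sup>2))" for s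
  proof (rule DERIV_unique)
    show "((\<lambda>s. multiplier (sqrt (r\<^sup>2 + s\<^sup>2))) has_real_derivative
       (\<integral>u. - ((u \<bullet> b) * sin (r * (u \<bullet> pole) + s * (u \<bullet> b))) \<partial>\<sigma>)) (at s)"
      using DERIV_plane_cos[OF b(1), of r pole s] by (simp only: G)
    show "((\<lambda>s. multiplier (sqrt (r\<^sup>2 + s\<^sup>2))) has_real_derivative
       multiplier' (sqrt (r\<^sup>2 + s\<^sup>2)) * (s / sqrt (r\<^sup>2 + s\<^sup>2))) (at s)"
      by (rule DERIV_chain2[OF DERIV_multiplier])
         (use pos[of s] in \<open>auto intro!: derivative_eq_intros simp: field_simps\<close>)
  qed
  show ?thesis
  proof (rule DERIV_unique)
    show "((\<lambda>s. multiplier' (sqrt (r\<^sup>2 + s\<^sup>2)) * (s / sqrt (r\<^sup>2 + s\<^sup>2))) has_real_derivative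
       (\<integral>u. - ((u \<bullet> b)\<^sup>2 * cos (r * (u \<bullet> pole))) \<partial>\<sigma>)) (at 0)"
      using DERIV_plane_sin[OF b(1), of r pole 0] by (simp only: D1) simp
    show "((\<lambda>s. multiplier' (sqrt (r\<^sup>2 + s\<^sup>2)) * (s / sqrt (r\<^sup>2 + s\<^sup>2))) has_real_derivative
       multiplier' r / r) (at 0)"
    proof -
      \<comment> \<open>The distance to the origin is stationary at s = 0, so only the factor
        \<open>s / sqrt (...)\<close> of the product contributes to the derivative.\<close>
      have "((\<lambda>s. sqrt (r\<^sup>2 + s\<^sup>2)) has_real_derivative 0) (at 0)"
        using r by (auto intro!: derivative_eq_intros)
      from DERIV_chain2[OF DERIV_multiplier' this]
      have 1: "((\<lambda>s. multiplier' (sqrt (r\<^sup>2 + s\<^sup>2))) has_real_derivative 0) (at 0)" by simp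
      have 2: "((\<lambda>s. s / sqrt (r\<^sup>2 + s\<^sup>2)) has_real_derivative 1 / r) (at 0)"
        using r by (auto intro!: derivative_eq_intros simp: power2_eq_square)
      show ?thesis using DERIV_mult[OF 1 2] r by simp
    qed
  qed
qed

text \<open>On the sphere the squared coordinates sum to 1, so the Laplacian of the transform is
  minus the transform. The pole contributes the second radial derivative and each of the other d - 1
  directions contributes \<open>multiplier' r / r\<close>.\<close>

lemma multiplier_ode:
  assumes r: "r > 0"
  shows "multiplier'' r = - multiplier r - (real DIM('a) - 1) * multiplier' r / r"
proof -
  have i: "integrable \<sigma> (\<lambda>u. - ((u \<bullet> b)\<^sup>2 * cos (r * (u \<bullet> pole))))" if "b \<in> Basis" for b
    by (rule integrable_bounded[where B=1])
      (use power2_inner_Basis_le[OF that] in \<open>auto simp: abs_mult intro!: mult_le_one\<close>)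
  have "- multiplier r = (\<integral>u. - cos (r * (u \<bullet> pole)) \<partial>\<sigma>)" by (simp add: multiplier_def)
  also have "\<dots> = (\<integral>u. (\<Sum>b\<in>Basis. - ((u \<bullet> b)\<^sup>2 * cos (r * (u \<bullet> pole)))) \<partial>\<sigma>)"
  proof (rule integral_cong_AE)
    show "AE u in \<sigma>. - cos (r * (u \<bullet> pole)) = (\<Sum>b\<in>Basis. - ((u \<bullet> b)\<^sup>2 * cos (r * (u \<bullet> pole))))"
      using unit
    proof eventually_elim
      case (elim u)
      have "(\<Sum>b\<in>Basis. (u \<bullet> b)\<^sup>2) = (norm u)\<^sup>2"
        unfolding power2_norm_eq_inner by (subst euclidean_inner) (simp add: power2_eq_square)
      then show ?case by (simp add: sum_negf sum_distrib_right[symmetric] elim)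
    qed
  qed auto
  also have "\<dots> = (\<Sum>b\<in>Basis. \<integral>u. - ((u \<bullet> b)\<^sup>2 * cos (r * (u \<bullet> pole))) \<partial>\<sigma>)"
    by (rule Bochner_Integration.integral_sum) (rule i)
  also have "\<dots> = multiplier'' r + (\<Sum>b\<in>Basis - {pole}. \<integral>u. - ((u \<bullet> b)\<^sup>2 * cos (r * (u \<bullet> pole))) \<partial>\<sigma>)"
    using pole_Basis by (simp add: sum.remove[of Basis pole] multiplier''_def)
  also have "(\<Sum>b\<in>Basis - {pole}. \<integral>u. - ((u \<bullet> b)\<^sup>2 * cos (r * (u \<bullet> pole))) \<partial>\<sigma>)
      = (\<Sum>b\<in>Basis - {pole}. multiplier' r / r)"
    using integral_tangential[OF _ _ r] by (intro sum.cong) auto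
  also have "(\<Sum>b\<in>Basis - {pole}. multiplier' r / r) = (real DIM('a) - 1) * multiplier' r / r"
    using pole_Basis DIM_positive[where 'a='a] by (simp add: card_Diff_singleton of_nat_diff Suc_leI)
  finally show ?thesis by linarith
qed

lemma abs_multiplier_le: "\<bar>multiplier r\<bar> \<le> 1"
  unfolding multiplier_def real_norm_def[symmetric]
  by (rule norm_integral_le) auto

lemma abs_multiplier'_le: "\<bar>multiplier' r\<bar> \<le> 1"
  unfolding multiplier'_def real_norm_def[symmetric]
  by (rule norm_integral_le) (use abs_inner_Basis_le[OF pole_Basis] in \<open>auto simp: abs_mult intro!: mult_le_one\<close>)

text \<open>With \<open>n = DIM('a) - 1\<close>, the energy \<open>r\<^sup>n (m\<^sup>2 + m'\<^sup>2 + n m m' / r)\<close> has derivative \<open>- n r\<^bsup>n-2\<^esup> m m'\<close>,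
  which is at most \<open>n / r\<^sup>2\<close> times the energy, so the energy stays bounded.\<close>
lemma multiplier_decay:
  obtains C where "C > 0" "\<And>r. r > 0 \<Longrightarrow> (multiplier r)\<^sup>2 + (multiplier' r)\<^sup>2 \<le> C / r ^ (DIM('a) - 1)"
proof -
  define n where "n = DIM('a) - 1"
  have n: "n \<ge> 2" "real DIM('a) - 1 = real n" using dim by (auto simp: n_def)
  let ?m = multiplier and ?m1 = multiplier'
  let ?q = "\<lambda>r. (?m r)\<^sup>2 + (?m1 r)\<^sup>2"
  define F where "F r = r ^ n * ?q r + real n * r ^ (n - 1) * (?m r * ?m1 r)" for r
  have am: "2 * \<bar>?m r * ?m1 r\<bar> \<le> ?q r" for r
    using sum_squares_bound[of "\<bar>?m r\<bar>" "\<bar>?m1 r\<bar>"] by (simp add: abs_mult mult.assoc)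
  have q2: "?q r \<le> 2" for r
  proof -
    have "(?m r)\<^sup>2 \<le> 1" "(?m1 r)\<^sup>2 \<le> 1"
      using abs_multiplier_le[of r] abs_multiplier'_le[of r] by (simp_all add: abs_square_le_1)
    then show ?thesis by linarith
  qed
  have neg: "- (c * y) \<le> c * \<bar>y\<bar>" if "c \<ge> 0" for c y :: real
    using that abs_ge_minus_self[of "c * y"] by (simp add: abs_mult)
  obtain k where k: "n = Suc (Suc k)" using n(1) by (metis add_2_eq_Suc le_Suc_ex)
  have DF: "(F has_real_derivative - (real n * r ^ k * (?m r * ?m1 r))) (at r)" if r: "r > 0" for r
  proof -
    have ode: "multiplier'' r = - ?m r - real n * ?m1 r / r" using multiplier_ode[OF r] n by simp
    have 1: "((\<lambda>r. ?q r) has_real_derivative 2 * ?m r * ?m1 r + 2 * ?m1 r * multiplier'' r) (at r)"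
      by (auto intro!: derivative_eq_intros DERIV_multiplier DERIV_multiplier')
    have 2: "((\<lambda>r. ?m r * ?m1 r) has_real_derivative ?m1 r * ?m1 r + multiplier'' r * ?m r) (at r)"
      by (rule DERIV_mult[OF DERIV_multiplier DERIV_multiplier'])
    have 3: "((\<lambda>r. r ^ n) has_real_derivative real n * r ^ Suc k) (at r)"
      using DERIV_pow[of n r] by (simp add: k)
    have 4: "((\<lambda>r. real n * r ^ (n - 1)) has_real_derivative real n * (real (Suc k) * r ^ k)) (at r)"
      using DERIV_cmult[OF DERIV_pow[of "Suc k" r]] by (simp add: k)
    have "(F has_real_derivative real n * r ^ Suc k * ?q r
        + (2 * ?m r * ?m1 r + 2 * ?m1 r * multiplier'' r) * r ^ n
        + (real n * (real (Suc k) * r ^ k) * (?m r * ?m1 r)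
          + (?m1 r * ?m1 r + multiplier'' r * ?m r) * (real n * r ^ (n - 1)))) (at r)"
      unfolding F_def[abs_def] by (rule DERIV_add[OF DERIV_mult[OF 3 1] DERIV_mult[OF 4 2]])
    moreover have "real n * r ^ Suc k * ?q r
        + (2 * ?m r * ?m1 r + 2 * ?m1 r * multiplier'' r) * r ^ n
        + (real n * (real (Suc k) * r ^ k) * (?m r * ?m1 r)
          + (?m1 r * ?m1 r + multiplier'' r * ?m r) * (real n * r ^ (n - 1)))
        = - (real n * r ^ k * (?m r * ?m1 r))"
    proof -
      have rn: "r ^ n = r ^ k * r\<^sup>2" "r ^ (n - 1) = r ^ k * r" "r ^ Suc k = r ^ k * r" "real (Suc k) = real n - 1"
        using k by (simp_all add: power2_eq_square)
      have *: "r * multiplier'' r = - r * ?m r - real n * ?m1 r"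
        using ode r by (simp add: field_simps)
      have "real n * (r ^ k * r) * ?q r
        + (2 * ?m r * ?m1 r + 2 * ?m1 r * multiplier'' r) * (r ^ k * r\<^sup>2)
        + (real n * ((real n - 1) * r ^ k) * (?m r * ?m1 r)
          + (?m1 r * ?m1 r + multiplier'' r * ?m r) * (real n * (r ^ k * r)))
        = r ^ k * (real n * r * ?q r + 2 * ?m r * ?m1 r * r\<^sup>2 + 2 * ?m1 r * (r * multiplier'' r) * r
            + real n * (real n - 1) * (?m r * ?m1 r) + ?m1 r * ?m1 r * real n * r
            + real n * ?m r * (r * multiplier'' r))"
        by (simp add: algebra_simps power2_eq_square)
      also have "\<dots> = - (real n * r ^ k * (?m r * ?m1 r))"
        unfolding * by (simp add: algebra_simps power2_eq_square)
      finally show ?thesis unfolding rn .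
    qed
    ultimately show ?thesis by simp
  qed
  \<comment> \<open>From r = n on, the cross term of F is at most half of the main term, so F
    controls the energy.\<close>
  have Fge: "r ^ n * ?q r \<le> 2 * F r" if "r \<ge> real n" for r
  proof -
    have r: "r > 0" using that n by linarith
    have "real n * r ^ (n - 1) * \<bar>?m r * ?m1 r\<bar> \<le> r * r ^ (n - 1) * \<bar>?m r * ?m1 r\<bar>"
      using that r by (intro mult_right_mono) auto
    also have "r * r ^ (n - 1) = r ^ n" by (simp add: k)
    finally have "2 * (real n * r ^ (n - 1) * \<bar>?m r * ?m1 r\<bar>) \<le> r ^ n * (2 * \<bar>?m r * ?m1 r\<bar>)" by simp
    also have "\<dots> \<le> r ^ n * ?q r" using am[of r] r by (intro mult_left_mono) auto
    finally have *: "2 * (real n * r ^ (n - 1) * \<bar>?m r * ?m1 r\<bar>) \<le> r ^ n * ?q r" .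
    have "- (real n * r ^ (n - 1) * (?m r * ?m1 r)) \<le> real n * r ^ (n - 1) * \<bar>?m r * ?m1 r\<bar>"
      using r by (intro neg) simp
    have "A \<le> 2 * (A + y)" if "2 * x \<le> A" "- y \<le> x" for x y A :: real
      using that by (simp add: distrib_left)
    from this[OF * \<open>- (real n * r ^ (n - 1) * (?m r * ?m1 r)) \<le> _\<close>] show ?thesis unfolding F_def .
  qed
  have bound: "F r \<le> F (real n) * exp 1" if "r \<ge> real n" for r
  proof -
    \<comment> \<open>\<open>exp (n / r)\<close> is the integrating factor for F' \<le> (n / r^2) F;
      it equals \<open>exp 1\<close> at r = n and is never below 1.\<close>
    have "(\<lambda>r. F r * exp (real n / r)) r \<le> (\<lambda>r. F r * exp (real n / r)) (real n)"
    proof (rule DERIV_nonpos_imp_nonincreasing[OF that])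
      fix x assume x: "real n \<le> x" "x \<le> r"
      then have x0: "x > 0" using n by linarith
      have "((\<lambda>r. F r * exp (real n / r)) has_real_derivative
         exp (real n / x) * (- (real n * x ^ k * (?m x * ?m1 x)) - real n / x\<^sup>2 * F x)) (at x)"
        using x0 by (auto intro!: derivative_eq_intros DF simp: field_simps power2_eq_square)
      moreover have "- (real n * x ^ k * (?m x * ?m1 x)) \<le> real n / x\<^sup>2 * F x"
      proof -
        have "- (real n * x ^ k * (?m x * ?m1 x)) \<le> real n * x ^ k * \<bar>?m x * ?m1 x\<bar>"
          using x0 by (intro neg) simp
        also have "\<dots> \<le> real n * x ^ k * (?q x / 2)"
          using am[of x] x0 by (intro mult_left_mono) auto
        also have "\<dots> = real n / x\<^sup>2 * (x ^ n * ?q x / 2)"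
          using x0 by (simp add: k power2_eq_square field_simps)
        also have "\<dots> \<le> real n / x\<^sup>2 * F x"
          using Fge[OF x(1)] by (intro mult_left_mono) auto
        finally show ?thesis .
      qed
      ultimately show "\<exists>y. ((\<lambda>r. F r * exp (real n / r)) has_real_derivative y) (at x) \<and> y \<le> 0"
        by (intro exI conjI) (assumption, simp add: mult_le_0_iff)
    qed
    moreover have "F r * 1 \<le> F r * exp (real n / r)"
    proof (rule mult_left_mono)
      show "F r \<ge> 0" using Fge[OF that] that by (smt (verit) mult_nonneg_nonneg of_nat_0_le_iff sum_power2_ge_zero zero_le_power)
    qed (use that in auto)
    ultimately show ?thesis using n by simp
  qed
  \<comment> \<open>The first summand covers r < n, where the trivial bound 2 is used; the second
    covers r \<ge> n.\<close>
  define C where "C = 2 * real n ^ n + 2 * \<bar>F (real n) * exp 1\<bar>"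
  show thesis
  proof (rule that[of C])
    show "C > 0" using n by (auto simp: C_def intro!: add_pos_nonneg)
    show "?q r \<le> C / r ^ (DIM('a) - 1)" if r: "r > 0" for r
    proof (cases "r \<ge> real n")
      case True
      have "r ^ n * ?q r \<le> 2 * F r" by (rule Fge[OF True])
      also have "\<dots> \<le> 2 * (F (real n) * exp 1)" using bound[OF True] by simp
      also have "\<dots> \<le> C" unfolding C_def using n by (simp add: add_increasing)
      finally show ?thesis using r by (simp add: field_simps n_def)
    next
      case False
      have "r ^ n * ?q r \<le> real n ^ n * 2" using False r q2[of r] by (intro mult_mono power_mono) auto
      also have "\<dots> \<le> C" unfolding C_def by simp
      finally show ?thesis using r by (simp add: field_simps n_def)
    qed
  qed
qed

end

subsection \<open>Finite differences\<close>

text \<open>The power \<open>(1 - T)\<^sup>N\<close> of the translation T by b; the forward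
  difference has the opposite sign when N is odd.\<close>

definition fdiff :: "nat \<Rightarrow> real \<Rightarrow> (real \<Rightarrow> real) \<Rightarrow> real \<Rightarrow> real" where
  "fdiff N b F a = (\<Sum>k\<le>N. (- 1) ^ k * real (N choose k) * F (a + real k * b))"

lemma fdiff_0 [simp]: "fdiff 0 b F a = F a"
  by (simp add: fdiff_def)

lemma fdiff_Suc: "fdiff (Suc N) b F a = fdiff N b F a - fdiff N b F (a + b)"
proof -
  let ?f = "\<lambda>k. (- 1) ^ k * F (a + real k * b)"
  have "fdiff (Suc N) b F a = (\<Sum>k\<le>Suc N. real (Suc N choose k) * ?f k)"
    by (simp add: fdiff_def mult_ac)
  also have "\<dots> = ?f 0 + (\<Sum>k\<le>N. real (Suc N choose Suc k) * ?f (Suc k))"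
    by (subst sum.atMost_Suc_shift) simp
  also have "\<dots> = (?f 0 + (\<Sum>k\<le>N. real (N choose Suc k) * ?f (Suc k))) + (\<Sum>k\<le>N. real (N choose k) * ?f (Suc k))"
    by (simp only: binomial_Suc_Suc of_nat_add distrib_right sum.distrib add.assoc add.left_commute)
  also have "?f 0 + (\<Sum>k\<le>N. real (N choose Suc k) * ?f (Suc k)) = (\<Sum>k\<le>Suc N. real (N choose k) * ?f k)"
    by (subst sum.atMost_Suc_shift) simp
  also have "\<dots> = fdiff N b F a"
    by (simp add: fdiff_def mult_ac)
  also have "(\<Sum>k\<le>N. real (N choose k) * ?f (Suc k)) = - fdiff N b F (a + b)"
    by (simp add: fdiff_def sum_negf[symmetric] algebra_simps)
  finally show ?thesis by simp
qed

lemma DERIV_fdiff: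
  assumes "\<And>x. (F has_real_derivative F' x) (at x)"
  shows "(fdiff N b F has_real_derivative fdiff N b F' a) (at a)"
proof -
  have *: "((\<lambda>x. F (x + c)) has_real_derivative F' (a + c)) (at a)" for c
  proof -
    have "((\<lambda>x. x + c) has_real_derivative 1) (at a)" by (auto intro!: derivative_eq_intros)
    from DERIV_chain2[OF assms this] show ?thesis by simp
  qed
  show ?thesis unfolding fdiff_def[abs_def] by (intro DERIV_sum DERIV_cmult *)
qed

text \<open>Each factor 1 - T costs one derivative and gains b by the mean value inequality. The
  whole family D is carried along so that the induction can pass from j to j + 1.\<close>

lemma abs_fdiff_le:
  assumes D: "\<And>k x. (D k has_real_derivative D (Suc k) x) (at x)" and b: "b \<ge> 0"
  shows "(\<And>x. a \<le> x \<Longrightarrow> x \<le> a + real N * b \<Longrightarrow> \<bar>D (j + N) x\<bar> \<le> B) \<Longrightarrow> \<bar>fdiff N b (D j) a\<bar> \<le> b ^ N * B"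
proof (induction N arbitrary: a j)
  case (Suc N)
  have *: "\<bar>fdiff N b (D (Suc j)) x\<bar> \<le> b ^ N * B" if x: "a \<le> x" "x \<le> a + b" for x
  proof (rule Suc.IH)
    fix y assume "x \<le> y" "y \<le> x + real N * b"
    then have "a \<le> y" "y \<le> a + real (Suc N) * b" using x by (auto simp: algebra_simps)
    then show "\<bar>D (Suc j + N) y\<bar> \<le> B" using Suc.prems[of y] by simp
  qed
  have "norm (fdiff N b (D j) a - fdiff N b (D j) (a + b)) \<le> (b ^ N * B) * norm (a - (a + b))"
  proof (rule field_differentiable_bound[where S="{a..a+b}" and f'="\<lambda>x. fdiff N b (D (Suc j)) x"])
    show "(fdiff N b (D j) has_field_derivative fdiff N b (D (Suc j)) x) (at x within {a..a + b})" for x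
      by (rule has_field_derivative_at_within, rule DERIV_fdiff, rule D)
  qed (use * b in auto)
  then show ?case using b by (simp add: fdiff_Suc mult_ac)
qed auto

lemma abs_fdiff_le_sup:
  assumes "\<And>x. x \<ge> a \<Longrightarrow> \<bar>F x\<bar> \<le> B" and b: "b \<ge> 0"
  shows "\<bar>fdiff N b F a\<bar> \<le> 2 ^ N * B"
proof -
  have "\<bar>fdiff N b F a\<bar> \<le> (\<Sum>k\<le>N. \<bar>(- 1) ^ k * real (N choose k) * F (a + real k * b)\<bar>)"
    unfolding fdiff_def by (rule sum_abs)
  also have "\<dots> \<le> (\<Sum>k\<le>N. real (N choose k) * B)"
    using assms by (intro sum_mono) (auto simp: abs_mult power_abs intro!: mult_left_mono)
  also have "\<dots> = 2 ^ N * B"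
    by (simp add: sum_distrib_right[symmetric] choose_row_sum flip: of_nat_sum)
  finally show ?thesis .
qed

text \<open>The derivative in \<open>a\<close> of \<open>- \<Sum>\<^sub>k (-1)\<^sup>k (N choose k) / (k h) \<integral>\<^bsub>[a, a + k h]\<^esub> F\<close>.\<close>
definition smooth_deriv :: "nat \<Rightarrow> real \<Rightarrow> (real \<Rightarrow> real) \<Rightarrow> real \<Rightarrow> real" where
  "smooth_deriv N h F a = - (\<Sum>k=1..N. (- 1) ^ k * real (N choose k) * ((F (a + real k * h) - F a) / (real k * h)))"

lemma smooth_deriv_approx:
  assumes D: "\<And>k x. (D k has_real_derivative D (Suc k) x) (at x)" and h: "h > 0"
    and B: "\<And>x. a \<le> x \<Longrightarrow> x \<le> a + real N * h \<Longrightarrow> \<bar>D (Suc N) x\<bar> \<le> B"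
  shows "\<bar>D 1 a - smooth_deriv N h (D 0) a\<bar> \<le> h ^ N * B"
proof -
  \<comment> \<open>The error times the step, as a function of the step s. It vanishes at 0 and its
    derivative in s is the N-th difference of \<open>D 1\<close>, of size \<open>s^N B\<close>, so
    integrating up to h gains one factor h, which cancels.\<close>
  define \<Phi> where "\<Phi> s = s * D 1 a + (\<Sum>k=1..N. (- 1) ^ k * real (N choose k) * ((D 0 (a + real k * s) - D 0 a) / real k))" for s
  have B0: "B \<ge> 0" using B[of a] h by (smt (verit) mult_nonneg_nonneg of_nat_0_le_iff)
  have D\<Phi>: "(\<Phi> has_real_derivative fdiff N s (D 1) a) (at s)" for s
  proof -
    have "((\<lambda>s. (- 1) ^ k * real (N choose k) * ((D 0 (a + real k * s) - D 0 a) / real k))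
      has_real_derivative (- 1) ^ k * real (N choose k) * D 1 (a + real k * s)) (at s)" if "k \<in> {1..N}" for k
    proof -
      have "((\<lambda>s. a + real k * s) has_real_derivative real k) (at s)"
        by (auto intro!: derivative_eq_intros)
      from DERIV_chain2[OF D[of 0] this]
      have *: "((\<lambda>s. D 0 (a + real k * s)) has_real_derivative D 1 (a + real k * s) * real k) (at s)" by simp
      show ?thesis using that
        by (auto intro!: derivative_eq_intros *)
    qed
    then have "(\<Phi> has_real_derivative D 1 a + (\<Sum>k=1..N. (- 1) ^ k * real (N choose k) * D 1 (a + real k * s))) (at s)"
      unfolding \<Phi>_def[abs_def]
      by (intro DERIV_add DERIV_sum) (auto intro!: derivative_eq_intros)
    also have "D 1 a + (\<Sum>k=1..N. (- 1) ^ k * real (N choose k) * D 1 (a + real k * s)) = fdiff N s (D 1) a"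
      unfolding fdiff_def by (simp add: atMost_atLeast0 sum.atLeast_Suc_atMost)
    finally show ?thesis .
  qed
  have "norm (\<Phi> h - \<Phi> 0) \<le> (h ^ N * B) * norm (h - 0)"
  proof (rule field_differentiable_bound[where S="{0..h}" and f'="\<lambda>s. fdiff N s (D 1) a"])
    show "(\<Phi> has_field_derivative fdiff N s (D 1) a) (at s within {0..h})" for s
      by (rule has_field_derivative_at_within, rule D\<Phi>)
    fix s assume s: "s \<in> {0..h}"
    have "\<bar>fdiff N s (D 1) a\<bar> \<le> s ^ N * B"
    proof (rule abs_fdiff_le[where D=D, OF D])
      fix x assume x: "a \<le> x" "x \<le> a + real N * s"
      note x(2)
      also have "a + real N * s \<le> a + real N * h" using s by (auto intro!: mult_left_mono)
      finally show "\<bar>D (1 + N) x\<bar> \<le> B" using B[of x] x by simp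
    qed (use s in auto)
    also have "\<dots> \<le> h ^ N * B" using s B0 by (intro mult_right_mono power_mono) auto
    finally show "norm (fdiff N s (D 1) a) \<le> h ^ N * B" by simp
  qed (use h in auto)
  moreover have "\<Phi> h - \<Phi> 0 = h * (D 1 a - smooth_deriv N h (D 0) a)"
  proof -
    have "(\<Sum>k=1..N. (- 1) ^ k * real (N choose k) * ((D 0 (a + real k * h) - D 0 a) / real k))
        = h * (\<Sum>k=1..N. (- 1) ^ k * real (N choose k) * ((D 0 (a + real k * h) - D 0 a) / (real k * h)))"
      unfolding sum_distrib_left using h by (intro sum.cong refl) (simp add: field_simps)
    then show ?thesis by (simp add: \<Phi>_def smooth_deriv_def distrib_left)
  qed
  ultimately have "h * \<bar>D 1 a - smooth_deriv N h (D 0) a\<bar> \<le> h * (h ^ N * B)"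
    using h by (simp add: abs_mult mult.commute)
  then show ?thesis using h by (simp only: mult_le_cancel_left_pos)
qed

lemma abs_smooth_deriv_le_sup:
  assumes B: "\<And>x. x \<ge> a \<Longrightarrow> \<bar>F x\<bar> \<le> B" and h: "h > 0"
  shows "\<bar>smooth_deriv N h F a\<bar> \<le> 2 ^ N * (2 * B / h)"
proof -
  have B0: "B \<ge> 0" using B[of a] by linarith
  have "\<bar>smooth_deriv N h F a\<bar> \<le> (\<Sum>k=1..N. \<bar>(- 1) ^ k * real (N choose k) * ((F (a + real k * h) - F a) / (real k * h))\<bar>)"
    unfolding smooth_deriv_def abs_minus_cancel by (rule sum_abs)
  also have "\<dots> \<le> (\<Sum>k=1..N. real (N choose k) * (2 * B / h))"
  proof (intro sum_mono)
    fix k assume k: "k \<in> {1..N}"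
    have "\<bar>F (a + real k * h) - F a\<bar> \<le> 2 * B"
      using B[of a] B[of "a + real k * h"] h by (simp add: abs_le_iff)
    then have "\<bar>F (a + real k * h) - F a\<bar> / (real k * h) \<le> 2 * B / h"
      using k h B0 by (intro frac_le) auto
    from mult_left_mono[OF this, of "real (N choose k)"]
    show "\<bar>(- 1) ^ k * real (N choose k) * ((F (a + real k * h) - F a) / (real k * h))\<bar> \<le> real (N choose k) * (2 * B / h)"
      using h by (simp add: abs_mult power_abs)
  qed
  also have "\<dots> \<le> (\<Sum>k\<le>N. real (N choose k) * (2 * B / h))"
    using B0 h by (intro sum_mono2) auto
  also have "\<dots> = 2 ^ N * (2 * B / h)"
    by (simp only: sum_distrib_right[symmetric] of_nat_sum[symmetric] choose_row_sum) simp
  finally show ?thesis .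
qed

lemma abs_poly_le:
  fixes x :: real
  assumes "x \<ge> 0"
  shows "\<bar>poly P x\<bar> \<le> (\<Sum>i\<le>degree P. \<bar>coeff P i\<bar>) * max 1 x ^ degree P"
proof -
  have "\<bar>poly P x\<bar> \<le> (\<Sum>i\<le>degree P. \<bar>coeff P i * x ^ i\<bar>)"
    unfolding poly_altdef by (rule sum_abs)
  also have "\<dots> \<le> (\<Sum>i\<le>degree P. \<bar>coeff P i\<bar> * max 1 x ^ degree P)"
  proof (intro sum_mono)
    fix i assume "i \<in> {..degree P}"
    then have "x ^ i \<le> max 1 x ^ i" "max 1 x ^ i \<le> max 1 x ^ degree P"
      using assms by (auto intro!: power_mono power_increasing)
    then show "\<bar>coeff P i * x ^ i\<bar> \<le> \<bar>coeff P i\<bar> * max 1 x ^ degree P"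
      using assms by (simp add: abs_mult mult_left_mono)
  qed
  finally show ?thesis by (simp add: sum_distrib_right)
qed

lemma nn_integral_exp_le:
  assumes "c > 0"
  shows "(\<integral>\<^sup>+a. ennreal (exp (c * a)) * indicator {..L} a \<partial>lborel) = ennreal (exp (c * L) / c)"
proof -
  have "(\<integral>\<^sup>+a. ennreal (exp (c * a)) * indicator {..L} a \<partial>lborel)
      = (\<integral>\<^sup>+a. ennreal (exp (- c * a)) * indicator {-L..} a \<partial>lborel)"
    by (subst nn_integral_real_affine[where c="-1" and t=0])
       (auto intro!: nn_integral_cong simp: indicator_def)
  also have "\<dots> = ennreal (exp (- c * - L) / c)"
    by (rule nn_integral_has_integral_lebesgue'[OF _ has_integral_exp_minus_to_infinity]) (use assms in auto)
  finally show ?thesis by simp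
qed

lemma nn_integral_exp_ge:
  assumes "c > 0"
  shows "(\<integral>\<^sup>+a. ennreal (exp (- (c * a))) * indicator {L..} a \<partial>lborel) = ennreal (exp (- (c * L)) / c)"
  using nn_integral_has_integral_lebesgue'[OF _ has_integral_exp_minus_to_infinity[OF assms, of L]] by simp

lemma nn_integral_two_sided_exp_le:
  assumes "\<And>a. a \<le> L \<Longrightarrow> f a \<le> A * (exp (\<alpha> * a) + exp (\<beta> * a))"
    and "\<And>a. a \<ge> L \<Longrightarrow> f a \<le> B * exp (- \<gamma> * a)"
    and "A \<ge> 0" "B \<ge> 0" "\<alpha> > 0" "\<beta> > 0" "\<gamma> > 0"
  shows "(\<integral>\<^sup>+a. ennreal (f a) \<partial>lborel)
     \<le> ennreal (A * (exp (\<alpha> * L) / \<alpha> + exp (\<beta> * L) / \<beta>) + B * (exp (- \<gamma> * L) / \<gamma>))"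
proof -
  let ?g = "\<lambda>a. ennreal A * (ennreal (exp (\<alpha> * a)) * indicator {..L} a)
      + ennreal A * (ennreal (exp (\<beta> * a)) * indicator {..L} a)
      + ennreal B * (ennreal (exp (- \<gamma> * a)) * indicator {L..} a)"
  have "(\<integral>\<^sup>+a. ennreal (f a) \<partial>lborel) \<le> (\<integral>\<^sup>+a. ?g a \<partial>lborel)"
  proof (intro nn_integral_mono)
    fix a
    show "ennreal (f a) \<le> ?g a"
    proof (cases "a \<le> L")
      case True
      have "ennreal (f a) \<le> ennreal (A * exp (\<alpha> * a) + A * exp (\<beta> * a))"
        using assms(1)[OF True] by (intro ennreal_leI) (simp add: distrib_left)
      also have "\<dots> = ennreal A * ennreal (exp (\<alpha> * a)) + ennreal A * ennreal (exp (\<beta> * a))"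
        using assms by (simp add: ennreal_mult)
      also have "\<dots> \<le> ?g a" using True by simp
      finally show ?thesis .
    next
      case False
      have "ennreal (f a) \<le> ennreal (B * exp (- \<gamma> * a))"
        using assms(2)[of a] False by (intro ennreal_leI) simp
      also have "\<dots> = ?g a" using False assms by (simp add: ennreal_mult)
      finally show ?thesis .
    qed
  qed
  also have "\<dots> = ennreal A * ennreal (exp (\<alpha> * L) / \<alpha>) + ennreal A * ennreal (exp (\<beta> * L) / \<beta>)
      + ennreal B * ennreal (exp (- \<gamma> * L) / \<gamma>)"
    using assms by (simp add: nn_integral_add nn_integral_cmult nn_integral_exp_le nn_integral_exp_ge)
  also have "\<dots> = ennreal (A * (exp (\<alpha> * L) / \<alpha> + exp (\<beta> * L) / \<beta>) + B * (exp (- \<gamma> * L) / \<gamma>))"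
  proof -
    have "ennreal A * ennreal x + ennreal A * ennreal y + ennreal B * ennreal z = ennreal (A * (x + y) + B * z)"
      if "x \<ge> 0" "y \<ge> 0" "z \<ge> 0" for x y z
      using assms that by (simp add: ennreal_mult ennreal_plus distrib_left)
    then show ?thesis using assms by simp
  qed
  finally show ?thesis .
qed

section \<open>The multiplier as a function of the logarithmic radius\<close>

context sphere_measure
begin

definition log_multiplier :: "real \<Rightarrow> real" where
  "log_multiplier a = multiplier (exp a)"

text \<open>In the variable \<open>X = exp (2 a)\<close>, every derivative of \<open>log_multiplier\<close> is a polynomial combination of
  \<open>log_multiplier\<close> and its first derivative, by the differential equation.\<close>
lemma log_multiplier_derivatives:
  obtains D where "D 0 = log_multiplier"
    "\<And>k a. (D k has_real_derivative D (Suc k) a) (at a)"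
    "\<And>k. \<exists>C>0. \<forall>a\<ge>0. \<bar>D k a\<bar> \<le> C * exp ((real k - real (DIM('a) - 1) / 2) * a)"
    "\<And>k. \<exists>C>0. \<forall>a\<le>0. \<bar>D (Suc k) a\<bar> \<le> C * exp a"
proof -
  define \<delta> where "\<delta> = real DIM('a) - 2"
  let ?X = "[:0, 1:] :: real poly"
  \<comment> \<open>The coefficients of \<open>log_multiplier\<close> and V in the k-th derivative,
    computed from X' = 2 X, log_multiplier' = V and V' = - X log_multiplier - \<delta> V.\<close>
  define pq where "pq = rec_nat (1, 0) (\<lambda>_ (p, q).
     (smult 2 (?X * pderiv p) - ?X * q, smult 2 (?X * pderiv q) + p - smult \<delta> q))"
  define p where "p k = fst (pq k)" for k
  define q where "q k = snd (pq k)" for k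
  have p0: "p 0 = 1" and q0: "q 0 = 0" by (simp_all add: p_def q_def pq_def)
  have pS: "p (Suc k) = smult 2 (?X * pderiv (p k)) - ?X * q k"
    and qS: "q (Suc k) = smult 2 (?X * pderiv (q k)) + p k - smult \<delta> (q k)" for k
    by (simp_all add: p_def q_def pq_def split: prod.split)
  define V where "V a = exp a * multiplier' (exp a)" for a
  define D where "D k a = poly (p k) (exp (2 * a)) * log_multiplier a + poly (q k) (exp (2 * a)) * V a" for k a
  have e2: "exp (2 * a) = exp a * exp a" for a :: real by (simp add: exp_add[symmetric])
  have D1: "(log_multiplier has_real_derivative V a) (at a)" for a
  proof -
    have "(exp has_real_derivative exp a) (at a)" by (rule DERIV_exp)
    from DERIV_chain2[OF DERIV_multiplier this] show ?thesis
      by (simp add: log_multiplier_def[abs_def] V_def mult.commute)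
  qed
  have D2: "(V has_real_derivative - exp (2 * a) * log_multiplier a - \<delta> * V a) (at a)" for a
  proof -
    have "(exp has_real_derivative exp a) (at a)" by (rule DERIV_exp)
    from DERIV_mult[OF DERIV_exp DERIV_chain2[OF DERIV_multiplier' this]]
    have "(V has_real_derivative exp a * multiplier' (exp a) + multiplier'' (exp a) * exp a * exp a) (at a)"
      by (simp add: V_def[abs_def])
    moreover have ode: "multiplier'' (exp a) * exp a = - multiplier (exp a) * exp a - (real DIM('a) - 1) * multiplier' (exp a)"
      by (simp add: multiplier_ode field_simps)
    have "exp a * multiplier' (exp a) + multiplier'' (exp a) * exp a * exp a
        = - exp (2 * a) * log_multiplier a - \<delta> * V a"
      unfolding ode V_def log_multiplier_def \<delta>_def e2 by (simp add: algebra_simps)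
    ultimately show ?thesis by simp
  qed
  have DP: "((\<lambda>a. poly P (exp (2 * a))) has_real_derivative poly (smult 2 (?X * pderiv P)) (exp (2 * a))) (at a)" for P a
  proof -
    have "((\<lambda>a. exp (2 * a)) has_real_derivative 2 * exp (2 * a)) (at a)"
      by (auto intro!: derivative_eq_intros)
    from DERIV_chain2[OF poly_DERIV this] show ?thesis by (simp add: mult_ac)
  qed
  have DD: "(D k has_real_derivative D (Suc k) a) (at a)" for k a
  proof -
    have "(D k has_real_derivative
        poly (smult 2 (?X * pderiv (p k))) (exp (2 * a)) * log_multiplier a + V a * poly (p k) (exp (2 * a))
      + (poly (smult 2 (?X * pderiv (q k))) (exp (2 * a)) * V a
        + (- exp (2 * a) * log_multiplier a - \<delta> * V a) * poly (q k) (exp (2 * a)))) (at a)"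
      unfolding D_def[abs_def] by (rule DERIV_add[OF DERIV_mult[OF DP D1] DERIV_mult[OF DP D2]])
    then show ?thesis by (simp add: D_def pS qS algebra_simps)
  qed
  \<comment> \<open>With weight 2 for X and weight 1 for V, which carries a factor exp a, each
    differentiation raises the weight by at most 1. The alternative \<open>q k = 0\<close> covers k
    = 0, where the degree of the zero polynomial would violate the inequality.\<close>
  have deg: "2 * degree (p k) \<le> k \<and> (q k = 0 \<or> 2 * degree (q k) + 1 \<le> k)" for k
  proof (induction k)
    case 0 then show ?case by (simp add: p0 q0)
  next
    case (Suc k)
    have xd: "degree (?X * pderiv P) \<le> degree P" for P :: "real poly"
    proof (cases "pderiv P = 0")
      case False
      then have "degree P \<noteq> 0" by (metis pderiv_eq_0_iff)
      then show ?thesis using False by (simp add: degree_mult_eq degree_pderiv)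
    qed simp
    have sd: "degree (smult 2 (?X * pderiv P)) \<le> degree P" for P :: "real poly"
      using degree_smult_le xd order_trans by blast
    have 1: "2 * degree (smult 2 (?X * pderiv (p k))) \<le> Suc k"
      using sd[of "p k"] Suc.IH by linarith
    have 2: "2 * degree (?X * q k) \<le> Suc k"
      using Suc by (cases "q k = 0") (auto simp: degree_mult_eq)
    have 3: "2 * degree (p (Suc k)) \<le> Suc k"
      unfolding pS using degree_diff_le_max[of "smult 2 (?X * pderiv (p k))" "?X * q k"] 1 2 by linarith
    have 4: "2 * degree (smult 2 (?X * pderiv (q k))) \<le> k"
      using sd[of "q k"] Suc.IH by (cases "q k = 0") (simp, linarith)
    have 5: "2 * degree (smult \<delta> (q k)) \<le> k"
      using degree_smult_le[of \<delta> "q k"] Suc.IH by (cases "q k = 0") (simp, linarith)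
    have "degree (q (Suc k)) \<le> max (max (degree (smult 2 (?X * pderiv (q k)))) (degree (p k))) (degree (smult \<delta> (q k)))"
      unfolding qS by (meson degree_diff_le_max degree_add_le_max order_trans max.mono order_refl)
    then have "2 * degree (q (Suc k)) \<le> k" using 4 5 Suc by linarith
    with 3 show ?case by simp
  qed
  obtain C where C: "C > 0" "\<And>r. r > 0 \<Longrightarrow> (multiplier r)\<^sup>2 + (multiplier' r)\<^sup>2 \<le> C / r ^ (DIM('a) - 1)"
    using multiplier_decay by blast
  define \<nu> where "\<nu> = real (DIM('a) - 1) / 2"
  have dec: "\<bar>multiplier (exp a)\<bar> \<le> sqrt C * exp (- \<nu> * a)" "\<bar>multiplier' (exp a)\<bar> \<le> sqrt C * exp (- \<nu> * a)" for a
  proof -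
    let ?E = "sqrt C * exp (- \<nu> * a)"
    have "exp a ^ (DIM('a) - 1) = exp (2 * (\<nu> * a))"
      unfolding exp_of_nat_mult[symmetric] by (simp add: \<nu>_def)
    then have "C / exp a ^ (DIM('a) - 1) = ?E\<^sup>2"
      using C(1) by (simp add: power_mult_distrib exp_double exp_minus divide_inverse power_inverse)
    with C(2)[of "exp a"] have "(multiplier (exp a))\<^sup>2 + (multiplier' (exp a))\<^sup>2 \<le> ?E\<^sup>2" by simp
    then have "(multiplier (exp a))\<^sup>2 \<le> ?E\<^sup>2" "(multiplier' (exp a))\<^sup>2 \<le> ?E\<^sup>2"
      using zero_le_power2[of "multiplier (exp a)"] zero_le_power2[of "multiplier' (exp a)"] by linarith+
    moreover have "\<bar>?E\<bar> = ?E" using C(1) by simp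
    ultimately show "\<bar>multiplier (exp a)\<bar> \<le> ?E" "\<bar>multiplier' (exp a)\<bar> \<le> ?E"
      by (simp_all only: abs_le_square_iff[symmetric])
  qed
  let ?S = "\<lambda>P :: real poly. \<Sum>i\<le>degree P. \<bar>coeff P i\<bar>"
  have S0: "?S P \<ge> 0" for P by (simp add: sum_nonneg)
  have pol: "\<bar>poly P (exp (2 * a))\<bar> \<le> ?S P * exp (real j * a)" if "2 * degree P \<le> j" "a \<ge> 0" for P j a
  proof -
    have "\<bar>poly P (exp (2 * a))\<bar> \<le> ?S P * max 1 (exp (2 * a)) ^ degree P"
      by (rule abs_poly_le) simp
    also have "max 1 (exp (2 * a)) = exp (2 * a)" using that by simp
    also have "exp (2 * a) ^ degree P = exp (real (degree P) * (2 * a))"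
      by (rule exp_of_nat_mult[symmetric])
    also have "real (degree P) * (2 * a) = real (2 * degree P) * a" by simp
    also have "?S P * exp (real (2 * degree P) * a) \<le> ?S P * exp (real j * a)"
    proof (intro mult_left_mono S0)
      have "real (2 * degree P) * a \<le> real j * a"
        using that by (intro mult_right_mono) (simp_all only: of_nat_le_iff)
      then show "exp (real (2 * degree P) * a) \<le> exp (real j * a)" by simp
    qed
    finally show ?thesis .
  qed
  have pol0: "\<bar>poly P (exp (2 * a))\<bar> \<le> ?S P" if "a \<le> 0" for P a
    using abs_poly_le[of "exp (2 * a)" P] that by (simp add: max_def split: if_splits)
  have big: "\<exists>C>0. \<forall>a\<ge>0. \<bar>D k a\<bar> \<le> C * exp ((real k - \<nu>) * a)" for k
  proof (intro exI conjI allI impI)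
    fix a :: real assume a: "a \<ge> 0"
    have "\<bar>poly (p k) (exp (2 * a)) * log_multiplier a\<bar> \<le> (?S (p k) * exp (real k * a)) * (sqrt C * exp (- \<nu> * a))"
      unfolding abs_mult log_multiplier_def using deg[of k] a S0 by (intro mult_mono pol dec) auto
    moreover have "\<bar>poly (q k) (exp (2 * a)) * V a\<bar> \<le> (?S (q k) * exp (real k * a)) * (sqrt C * exp (- \<nu> * a))"
    proof (cases "q k = 0")
      case False
      then obtain j where j: "k = Suc j" "2 * degree (q k) \<le> j" using deg[of k] by (cases k) auto
      have "\<bar>poly (q k) (exp (2 * a)) * V a\<bar> \<le> (?S (q k) * exp (real j * a)) * (exp a * (sqrt C * exp (- \<nu> * a)))"
        unfolding abs_mult V_def using j a S0 C(1) by (intro mult_mono pol dec) auto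
      also have "\<dots> = (?S (q k) * (exp (real j * a) * exp a)) * (sqrt C * exp (- \<nu> * a))" by (simp add: mult_ac)
      also have "exp (real j * a) * exp a = exp (real k * a)" by (simp add: j exp_add[symmetric] algebra_simps)
      finally show ?thesis .
    qed (use C(1) in auto)
    ultimately have "\<bar>D k a\<bar> \<le> (?S (p k) + ?S (q k)) * sqrt C * (exp (real k * a) * exp (- \<nu> * a))"
      unfolding D_def by (simp add: algebra_simps)
    also have "exp (real k * a) * exp (- \<nu> * a) = exp ((real k - \<nu>) * a)"
      by (simp add: exp_add[symmetric] algebra_simps)
    finally have "\<bar>D k a\<bar> \<le> (?S (p k) + ?S (q k)) * sqrt C * exp ((real k - \<nu>) * a)" .
    also have "\<dots> \<le> ((?S (p k) + ?S (q k)) * sqrt C + 1) * exp ((real k - \<nu>) * a)"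
      by (intro mult_right_mono) auto
    finally show "\<bar>D k a\<bar> \<le> ((?S (p k) + ?S (q k)) * sqrt C + 1) * exp ((real k - \<nu>) * a)" .
  qed (use C(1) S0 in \<open>auto intro!: add_nonneg_pos mult_nonneg_nonneg add_nonneg_nonneg\<close>)
  have small: "\<exists>C>0. \<forall>a\<le>0. \<bar>D (Suc k) a\<bar> \<le> C * exp a" for k
  proof (intro exI conjI allI impI)
    fix a :: real assume a: "a \<le> 0"
    \<comment> \<open>In positive order the coefficient p has a factor X, and V has a factor exp a;
      this is the vanishing at small radii.\<close>
    define P where "P = smult 2 (pderiv (p k)) - q k"
    have pP: "poly (p (Suc k)) x = x * poly P x" for x by (simp add: pS P_def algebra_simps)
    have "\<bar>poly (p (Suc k)) (exp (2 * a)) * log_multiplier a\<bar> \<le> (exp a * ?S P) * 1"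
      unfolding abs_mult log_multiplier_def pP
      using a S0[of P] abs_multiplier_le by (intro mult_mono pol0) auto
    moreover have "\<bar>poly (q (Suc k)) (exp (2 * a)) * V a\<bar> \<le> ?S (q (Suc k)) * (exp a * 1)"
      unfolding abs_mult V_def using a S0 abs_multiplier'_le by (intro mult_mono pol0) auto
    ultimately have "\<bar>D (Suc k) a\<bar> \<le> (?S P + ?S (q (Suc k))) * exp a"
      using abs_triangle_ineq[of "poly (p (Suc k)) (exp (2 * a)) * log_multiplier a" "poly (q (Suc k)) (exp (2 * a)) * V a"]
      unfolding D_def by (simp add: algebra_simps)
    also have "\<dots> \<le> (?S P + ?S (q (Suc k)) + 1) * exp a" by (intro mult_right_mono) auto
    finally show "\<bar>D (Suc k) a\<bar> \<le> (?S (smult 2 (pderiv (p k)) - q k) + ?S (q (Suc k)) + 1) * exp a"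
      unfolding P_def .
  qed (use S0 in \<open>auto intro!: add_nonneg_pos add_nonneg_nonneg\<close>)
  show thesis
    by (rule that[of D]) (use DD big small in \<open>auto simp: D_def fun_eq_iff p0 q0 \<nu>_def\<close>)
qed

subsection \<open>Spherical means\<close>

definition log_mean :: "('a \<Rightarrow> real) \<Rightarrow> 'a \<Rightarrow> real \<Rightarrow> real" where
  "log_mean g x a = (\<integral>u. g (x - exp a *\<^sub>R u) \<partial>\<sigma>)"

lemma integrable_translate:
  assumes "tame g" shows "integrable \<sigma> (\<lambda>u. g (x - t *\<^sub>R u))"
proof -
  note [measurable] = tame_measurable[OF assms]
  obtain B where B: "\<And>x. \<bar>g x\<bar> \<le> B" using tame_bound[OF assms] by metis
  show ?thesis by (rule integrable_bounded[where B=B]) (use B in auto)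
qed

lemma abs_log_mean_le:
  assumes "tame g" "\<And>x. \<bar>g x\<bar> \<le> B" shows "\<bar>log_mean g x a\<bar> \<le> B"
proof -
  note [measurable] = tame_measurable[OF assms(1)]
  have "B \<ge> 0" using assms(2)[of undefined] by linarith
  then show ?thesis unfolding log_mean_def real_norm_def[symmetric]
    by (intro norm_integral_le) (use assms(2) in auto)
qed

lemma log_mean_nonneg: "(\<And>x. g x \<ge> 0) \<Longrightarrow> log_mean g x a \<ge> 0"
  unfolding log_mean_def by (rule integral_nonneg_AE) simp

lemma log_mean_add:
  assumes "tame f" "tame g" shows "log_mean (\<lambda>x. f x + g x) x a = log_mean f x a + log_mean g x a"
  unfolding log_mean_def using assms by (intro Bochner_Integration.integral_add integrable_translate)

lemma continuous_log_mean:
  assumes g: "tame g" shows "continuous_on UNIV (\<lambda>p. log_mean g (fst p) (snd p))"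
  unfolding continuous_on_eq_continuous_at[OF open_UNIV]
proof
  fix p :: "'a \<times> real"
  note [measurable] = tame_measurable[OF g]
  obtain B where B: "\<And>x. \<bar>g x\<bar> \<le> B" using tame_bound[OF g] by metis
  show "isCont (\<lambda>p. log_mean g (fst p) (snd p)) p"
    unfolding continuous_at_sequentially comp_def
  proof (intro allI impI)
    fix X :: "nat \<Rightarrow> 'a \<times> real" assume X: "X \<longlonglongrightarrow> p"
    show "(\<lambda>n. log_mean g (fst (X n)) (snd (X n))) \<longlonglongrightarrow> log_mean g (fst p) (snd p)"
      unfolding log_mean_def
    proof (rule integral_dominated_convergence[where w="\<lambda>_. B"])
      show "AE u in \<sigma>. (\<lambda>n. g (fst (X n) - exp (snd (X n)) *\<^sub>R u)) \<longlonglongrightarrow> g (fst p - exp (snd p) *\<^sub>R u)"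
      proof (intro AE_I2)
        fix u
        have "(\<lambda>n. fst (X n) - exp (snd (X n)) *\<^sub>R u) \<longlonglongrightarrow> fst p - exp (snd p) *\<^sub>R u"
          by (intro tendsto_intros X)
        then show "(\<lambda>n. g (fst (X n) - exp (snd (X n)) *\<^sub>R u)) \<longlonglongrightarrow> g (fst p - exp (snd p) *\<^sub>R u)"
          by (rule isCont_tendsto_compose[OF tame_continuous_at[OF g]])
      qed
    qed (use B in auto)
  qed
qed

lemma continuous_log_mean_snd:
  assumes g: "tame g" shows "continuous_on UNIV (log_mean g x)"
proof -
  have "continuous_on UNIV (\<lambda>a::real. (x, a))"
    by (intro continuous_on_Pair continuous_on_const continuous_on_id)
  from continuous_on_compose2[OF continuous_log_mean[OF g] this subset_UNIV] show ?thesis by simp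
qed

lemma continuous_log_mean_fst:
  assumes g: "tame g" shows "continuous_on UNIV (\<lambda>x. log_mean g x a)"
proof -
  have "continuous_on UNIV (\<lambda>x::'a. (x, a))"
    by (intro continuous_on_Pair continuous_on_const continuous_on_id)
  from continuous_on_compose2[OF continuous_log_mean[OF g] this subset_UNIV] show ?thesis by simp
qed

lemma measurable_log_mean:
  assumes g: "tame g" shows "(\<lambda>p. log_mean g (fst p) (snd p)) \<in> borel_measurable (borel \<Otimes>\<^sub>M borel)"
  using borel_measurable_continuous_onI[OF continuous_log_mean[OF g]] by (simp add: borel_prod)

lemma pair_sigma_finite_lborel: "pair_sigma_finite (lborel :: 'a measure) \<sigma>" ..

lemma integrable_pair_translate:
  assumes g: "tame g"
  shows "integrable (lborel \<Otimes>\<^sub>M \<sigma>) (\<lambda>(x, u). g (x - t *\<^sub>R u))"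
proof -
  note [measurable] = tame_measurable[OF g]
  interpret P: pair_sigma_finite "lborel :: 'a measure" \<sigma> by (rule pair_sigma_finite_lborel)
  have "(\<integral>\<^sup>+p. norm (case p of (x, u) \<Rightarrow> g (x - t *\<^sub>R u)) \<partial>(lborel \<Otimes>\<^sub>M \<sigma>))
      = (\<integral>\<^sup>+u. \<integral>\<^sup>+x. norm (g (x - t *\<^sub>R u)) \<partial>lborel \<partial>\<sigma>)"
    by (subst P.nn_integral_snd[symmetric]) auto
  also have "\<dots> = (\<integral>\<^sup>+u. \<integral>\<^sup>+x. norm (g x) \<partial>lborel \<partial>\<sigma>)"
  proof (rule nn_integral_cong)
    fix u
    show "(\<integral>\<^sup>+x. norm (g (x - t *\<^sub>R u)) \<partial>lborel) = (\<integral>\<^sup>+x. norm (g x) \<partial>lborel)"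
      using nn_integral_affine_euclidean[of "\<lambda>x. ennreal (norm (g x))" 1 "- (t *\<^sub>R u)"] by simp
  qed
  also have "\<dots> = (\<integral>\<^sup>+x. norm (g x) \<partial>lborel) * emeasure \<sigma> UNIV" by simp
  also have "\<dots> < \<infinity>"
  proof -
    have "emeasure \<sigma> UNIV < \<infinity>" using mass by (rule order_le_less_trans) simp
    then show ?thesis
      using tameD_integrable[OF g] by (simp add: integrable_iff_bounded ennreal_mult_less_top)
  qed
  finally show ?thesis by (intro integrableI_bounded) auto
qed

lemma tame_log_mean:
  assumes g: "tame g" shows "tame (\<lambda>x. log_mean g x a)"
proof -
  interpret P: pair_sigma_finite "lborel :: 'a measure" \<sigma> by (rule pair_sigma_finite_lborel)
  obtain B where B: "\<And>x. \<bar>g x\<bar> \<le> B" using tame_bound[OF g] by metis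
  have "integrable lborel (\<lambda>x. log_mean g x a)"
    using P.integrable_fst[OF integrable_pair_translate[OF g, of "exp a"]] by (simp add: log_mean_def)
  then show ?thesis
    using continuous_log_mean_fst[OF g] abs_log_mean_le[OF g B] by (auto simp: tame_def)
qed

text \<open>The mean is a convolution with the dilated measure, whose transform factors out after
  Fubini; by \<open>integral_cis\<close> it is real and radial.\<close>

lemma fourier_log_mean:
  assumes g: "tame g"
  shows "fourier (\<lambda>x. log_mean g x a) \<xi> = multiplier (exp a * norm \<xi>) *\<^sub>R fourier g \<xi>"
proof -
  note [measurable] = tame_measurable[OF g]
  interpret P: pair_sigma_finite "lborel :: 'a measure" \<sigma> by (rule pair_sigma_finite_lborel)
  have "fourier (\<lambda>x. log_mean g x a) \<xi> = (\<integral>x. \<integral>u. g (x - exp a *\<^sub>R u) *\<^sub>R cis (- (\<xi> \<bullet> x)) \<partial>\<sigma> \<partial>lborel)"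
    unfolding fourier_def log_mean_def by (simp add: integrable_translate[OF g])
  also have "\<dots> = (\<integral>u. \<integral>x. g (x - exp a *\<^sub>R u) *\<^sub>R cis (- (\<xi> \<bullet> x)) \<partial>lborel \<partial>\<sigma>)"
    by (rule P.Fubini_integral[symmetric],
        rule Bochner_Integration.integrable_bound[OF integrable_pair_translate[OF g, of "exp a"]]) auto
  also have "\<dots> = (\<integral>u. cis (- (exp a *\<^sub>R \<xi> \<bullet> u)) * fourier g \<xi> \<partial>\<sigma>)"
  proof (intro Bochner_Integration.integral_cong refl)
    fix u
    have "(\<integral>x. g (x - exp a *\<^sub>R u) *\<^sub>R cis (- (\<xi> \<bullet> x)) \<partial>lborel)
       = (\<integral>x. g x *\<^sub>R cis (- (\<xi> \<bullet> (exp a *\<^sub>R u + x))) \<partial>lborel)"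
      using integral_affine_euclidean[of "\<lambda>x. g (x - exp a *\<^sub>R u) *\<^sub>R cis (- (\<xi> \<bullet> x))" 1 "exp a *\<^sub>R u"] by simp
    also have "\<dots> = (\<integral>x. cis (- (exp a *\<^sub>R \<xi> \<bullet> u)) * (g x *\<^sub>R cis (- (\<xi> \<bullet> x))) \<partial>lborel)"
      by (intro Bochner_Integration.integral_cong refl) (simp add: inner_add_right cis_mult)
    also have "\<dots> = cis (- (exp a *\<^sub>R \<xi> \<bullet> u)) * fourier g \<xi>"
      unfolding fourier_def by (rule integral_mult_right_zero)
    finally show "(\<integral>x. g (x - exp a *\<^sub>R u) *\<^sub>R cis (- (\<xi> \<bullet> x)) \<partial>lborel) = cis (- (exp a *\<^sub>R \<xi> \<bullet> u)) * fourier g \<xi>" .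
  qed
  also have "\<dots> = (\<integral>u. cis (- (exp a *\<^sub>R \<xi> \<bullet> u)) \<partial>\<sigma>) * fourier g \<xi>"
    by (rule integral_mult_left_zero)
  also have "(\<integral>u. cis (- (exp a *\<^sub>R \<xi> \<bullet> u)) \<partial>\<sigma>) = complex_of_real (multiplier (exp a * norm \<xi>))"
    unfolding integral_cis by simp
  finally show ?thesis by (simp only: scaleR_conv_of_real)
qed

lemma continuous_multiplier: "continuous_on UNIV multiplier"
  using DERIV_multiplier by (meson DERIV_isCont continuous_at_imp_continuous_on)

lemma measurable_multiplier [measurable]: "multiplier \<in> borel_measurable borel"
  by (rule borel_measurable_continuous_onI[OF continuous_multiplier])

text \<open>Finite differences, and differences of \<open>smooth_deriv\<close> at two scales, are
  both combinations of translates in the logarithmic radius; in this form a single L^2 estimate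
  serves for both.\<close>

lemma tame_shift_sum: "tame g \<Longrightarrow> tame (\<lambda>x. \<Sum>i\<in>I. c i * log_mean g x (a + s i))"
  by (intro tame_sum tame_cmult tame_log_mean)

lemma fourier_shift_sum:
  assumes g: "tame g" and I: "finite I"
  shows "fourier (\<lambda>x. \<Sum>i\<in>I. c i * log_mean g x (a + s i)) \<xi>
       = (\<Sum>i\<in>I. c i * multiplier (exp (a + s i) * norm \<xi>)) *\<^sub>R fourier g \<xi>"
proof -
  have "fourier (\<lambda>x. \<Sum>i\<in>I. c i * log_mean g x (a + s i)) \<xi>
      = (\<integral>x. (\<Sum>i\<in>I. c i *\<^sub>R (log_mean g x (a + s i) *\<^sub>R cis (- (\<xi> \<bullet> x)))) \<partial>lborel)"
    unfolding fourier_def by (simp add: scaleR_sum_left)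
  also have "\<dots> = (\<Sum>i\<in>I. \<integral>x. c i *\<^sub>R (log_mean g x (a + s i) *\<^sub>R cis (- (\<xi> \<bullet> x))) \<partial>lborel)"
    by (intro Bochner_Integration.integral_sum integrable_scaleR_right integrable_fourier tame_log_mean g)
  also have "\<dots> = (\<Sum>i\<in>I. c i *\<^sub>R fourier (\<lambda>x. log_mean g x (a + s i)) \<xi>)"
    by (simp only: integral_scaleR_right fourier_def)
  finally show ?thesis by (simp add: fourier_log_mean[OF g] scaleR_sum_left)
qed

text \<open>By Plancherel and the dilation invariance of \<open>da\<close>, the \<open>L\<^sup>2\<close> norm over \<open>(a, x)\<close> of a shift
  combination of spherical means is governed by the same combination of the multiplier.\<close>
lemma shift_sum_L2:
  assumes g: "tame g" and I: "finite I" and c0: "(\<Sum>i\<in>I. c i) = 0"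
    and B: "(\<integral>\<^sup>+a. ennreal ((\<Sum>i\<in>I. c i * log_multiplier (a + s i))\<^sup>2) \<partial>lborel) \<le> ennreal B"
  shows "(\<integral>\<^sup>+x. \<integral>\<^sup>+a. ennreal ((\<Sum>i\<in>I. c i * log_mean g x (a + s i))\<^sup>2) \<partial>lborel \<partial>lborel)
      \<le> ennreal B * (\<integral>\<^sup>+x. ennreal ((g x)\<^sup>2) \<partial>lborel)"
proof -
  note [measurable] = tame_measurable[OF g] measurable_fourier[OF g]
  interpret G: prob_space "gauss :: 'a measure" by (rule prob_space_gauss)
  interpret P: pair_sigma_finite "lborel :: real measure" "gauss :: 'a measure" ..
  define W where "W a x = (\<Sum>i\<in>I. c i * log_mean g x (a + s i))" for a x
  define M where "M a \<xi> = (\<Sum>i\<in>I. c i * multiplier (exp (a + s i) * norm \<xi>))" for a and \<xi> :: 'a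
  define K where "K = integral\<^sup>L lborel (\<lambda>z::'a. exp (- (norm z)\<^sup>2 / 2))"
  have K: "K > 0" unfolding K_def by (rule integral_exp_norm_pos)
  have tW: "tame (W a)" for a unfolding W_def[abs_def] by (rule tame_shift_sum[OF g])
  have FW: "fourier (W a) \<xi> = M a \<xi> *\<^sub>R fourier g \<xi>" for a \<xi>
    unfolding W_def[abs_def] M_def by (rule fourier_shift_sum[OF g I])
  have [measurable]: "(\<lambda>(a, \<xi>). M a \<xi>) \<in> borel_measurable (borel \<Otimes>\<^sub>M borel)"
    unfolding M_def by measurable
  have [measurable]: "(\<lambda>(a, \<xi>). M a \<xi>) \<in> borel_measurable (lborel \<Otimes>\<^sub>M gauss)"
    by (subst measurable_cong_sets[OF sets_pair_measure_cong refl]) (auto simp: sets_gauss)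
  have [measurable]: "M a \<in> borel_measurable borel" for a
    unfolding M_def[abs_def] by measurable
  \<comment> \<open>For \<xi> \<noteq> 0, translating \<open>a\<close> by ln (norm \<xi>) removes
    \<xi>. At \<xi> = 0 the multiplier does not depend on \<open>a\<close>, and \<open>c0\<close>
    keeps the integral from diverging.\<close>
  have MB: "(\<integral>\<^sup>+a. ennreal ((M a \<xi>)\<^sup>2) \<partial>lborel) \<le> ennreal B" for \<xi>
  proof (cases "\<xi> = 0")
    case True
    then show ?thesis by (simp add: M_def sum_distrib_right[symmetric] c0)
  next
    case False
    have [measurable]: "log_multiplier \<in> borel_measurable borel"
      unfolding log_multiplier_def[abs_def] by measurable
    have "M a \<xi> = (\<Sum>i\<in>I. c i * log_multiplier (ln (norm \<xi>) + 1 * a + s i))" for a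
      using False by (simp add: M_def log_multiplier_def exp_add mult_ac)
    then have "(\<integral>\<^sup>+a. ennreal ((M a \<xi>)\<^sup>2) \<partial>lborel)
       = (\<integral>\<^sup>+a. ennreal ((\<Sum>i\<in>I. c i * log_multiplier (ln (norm \<xi>) + 1 * a + s i))\<^sup>2) \<partial>lborel)" by simp
    also have "\<dots> = (\<integral>\<^sup>+a. ennreal ((\<Sum>i\<in>I. c i * log_multiplier (a + s i))\<^sup>2) \<partial>lborel)"
      by (subst nn_integral_real_affine[where c=1 and t="ln (norm \<xi>)"
            and f="\<lambda>a. ennreal ((\<Sum>i\<in>I. c i * log_multiplier (a + s i))\<^sup>2)"]) auto
    finally show ?thesis using B by simp
  qed
  define X where "X n a = (\<integral>w. (cmod (fourier (W a) (real (Suc n) *\<^sub>R w)))\<^sup>2 \<partial>gauss)" for n a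
  define Y where "Y n = (\<integral>w. (cmod (fourier g (real (Suc n) *\<^sub>R w)))\<^sup>2 \<partial>gauss)" for n
  define v where "v n = real (Suc n) ^ DIM('a)" for n
  have v: "v n \<ge> 0" for n by (simp add: v_def)
  have bdd: "cmod (fourier f \<xi>) \<le> (\<integral>x. \<bar>f x\<bar> \<partial>lborel)" for f :: "'a \<Rightarrow> real" and \<xi>
    unfolding fourier_def by (rule order_trans[OF integral_norm_bound]) simp
  have nn: "(\<integral>\<^sup>+w. ennreal ((cmod (fourier f (real (Suc n) *\<^sub>R w)))\<^sup>2) \<partial>gauss)
      = ennreal (\<integral>w. (cmod (fourier f (real (Suc n) *\<^sub>R w)))\<^sup>2 \<partial>gauss)" if f: "tame f" for f :: "'a \<Rightarrow> real" and n
  proof (rule nn_integral_eq_integral)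
    note [measurable] = measurable_fourier[OF f]
    show "integrable gauss (\<lambda>w. (cmod (fourier f (real (Suc n) *\<^sub>R w)))\<^sup>2)"
      by (rule G.integrable_const_bound[where B="(\<integral>x. \<bar>f x\<bar> \<partial>lborel)\<^sup>2"])
         (auto intro!: AE_I2 power_mono bdd simp del: of_nat_Suc)
  qed simp
  have X: "ennreal (X n a) = (\<integral>\<^sup>+w. ennreal ((M a (real (Suc n) *\<^sub>R w))\<^sup>2) * ennreal ((cmod (fourier g (real (Suc n) *\<^sub>R w)))\<^sup>2) \<partial>gauss)" for n a
    unfolding X_def nn[OF tW, symmetric] by (simp add: FW power_mult_distrib ennreal_mult del: of_nat_Suc)
  have XI: "(\<integral>\<^sup>+a. ennreal (X n a) \<partial>lborel) \<le> ennreal B * ennreal (Y n)" for n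
  proof -
    have "(\<integral>\<^sup>+a. ennreal (X n a) \<partial>lborel)
       = (\<integral>\<^sup>+w. \<integral>\<^sup>+a. ennreal ((M a (real (Suc n) *\<^sub>R w))\<^sup>2) * ennreal ((cmod (fourier g (real (Suc n) *\<^sub>R w)))\<^sup>2) \<partial>lborel \<partial>gauss)"
      unfolding X by (rule P.Fubini'[symmetric]) measurable
    also have "\<dots> = (\<integral>\<^sup>+w. (\<integral>\<^sup>+a. ennreal ((M a (real (Suc n) *\<^sub>R w))\<^sup>2) \<partial>lborel) * ennreal ((cmod (fourier g (real (Suc n) *\<^sub>R w)))\<^sup>2) \<partial>gauss)"
      by (intro nn_integral_cong nn_integral_multc) measurable
    also have "\<dots> \<le> (\<integral>\<^sup>+w. ennreal B * ennreal ((cmod (fourier g (real (Suc n) *\<^sub>R w)))\<^sup>2) \<partial>gauss)"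
      by (intro nn_integral_mono mult_right_mono MB) simp
    also have "\<dots> = ennreal B * ennreal (Y n)"
      unfolding Y_def nn[OF g, symmetric] by (rule nn_integral_cmult) measurable
    finally show ?thesis .
  qed
  have XM: "(\<lambda>a. ennreal (X n a)) \<in> borel_measurable lborel" for n
    unfolding X by measurable
  \<comment> \<open>Fatou's lemma carries the Plancherel limit of the combinations through the
    integral over \<open>a\<close>; for g the limit exists and brings the same constant K, which
    then cancels.\<close>
  have "(\<integral>\<^sup>+a. ennreal (K * (\<integral>x. (W a x)\<^sup>2 \<partial>lborel)) \<partial>lborel)
     = (\<integral>\<^sup>+a. liminf (\<lambda>n. ennreal (v n) * ennreal (X n a)) \<partial>lborel)"
  proof (intro nn_integral_cong)
    fix a
    have "(\<lambda>n. ennreal (v n * X n a)) \<longlonglongrightarrow> ennreal (K * (\<integral>x. (W a x)\<^sup>2 \<partial>lborel))"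
      unfolding X_def K_def v_def by (intro tendsto_ennrealI plancherel_limit tW)
    then have "liminf (\<lambda>n. ennreal (v n * X n a)) = ennreal (K * (\<integral>x. (W a x)\<^sup>2 \<partial>lborel))"
      by (rule lim_imp_Liminf[rotated]) simp
    then show "ennreal (K * (\<integral>x. (W a x)\<^sup>2 \<partial>lborel)) = liminf (\<lambda>n. ennreal (v n) * ennreal (X n a))"
      using v by (simp add: ennreal_mult' )
  qed
  also have "\<dots> \<le> liminf (\<lambda>n. \<integral>\<^sup>+a. ennreal (v n) * ennreal (X n a) \<partial>lborel)"
    using XM by (intro nn_integral_liminf) auto
  also have "\<dots> \<le> liminf (\<lambda>n. ennreal B * ennreal (v n * Y n))"
  proof (intro Liminf_mono always_eventually allI)
    fix n
    have "(\<integral>\<^sup>+a. ennreal (v n) * ennreal (X n a) \<partial>lborel) = ennreal (v n) * (\<integral>\<^sup>+a. ennreal (X n a) \<partial>lborel)"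
      using XM by (rule nn_integral_cmult)
    also have "\<dots> \<le> ennreal (v n) * (ennreal B * ennreal (Y n))" by (intro mult_left_mono XI) simp
    also have "\<dots> = ennreal B * ennreal (v n * Y n)"
      unfolding ennreal_mult'[OF v] by (simp only: mult_ac)
    finally show "(\<integral>\<^sup>+a. ennreal (v n) * ennreal (X n a) \<partial>lborel) \<le> ennreal B * ennreal (v n * Y n)" .
  qed
  also have "liminf (\<lambda>n. ennreal B * ennreal (v n * Y n)) \<le> ennreal B * ennreal (K * (\<integral>x. (g x)\<^sup>2 \<partial>lborel))"
  proof -
    have "(\<lambda>n. ennreal B * ennreal (v n * Y n)) \<longlonglongrightarrow> ennreal B * ennreal (K * (\<integral>x. (g x)\<^sup>2 \<partial>lborel))"
      unfolding Y_def K_def v_def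
      by (intro ennreal_tendsto_cmult tendsto_ennrealI plancherel_limit g) simp
    then show ?thesis using lim_imp_Liminf[OF sequentially_bot] by (metis order_refl)
  qed
  finally have *: "(\<integral>\<^sup>+a. ennreal (K * (\<integral>x. (W a x)\<^sup>2 \<partial>lborel)) \<partial>lborel) \<le> ennreal B * ennreal (K * (\<integral>x. (g x)\<^sup>2 \<partial>lborel))" .
  have sq: "ennreal (\<integral>x. (f x)\<^sup>2 \<partial>lborel) = (\<integral>\<^sup>+x. ennreal ((f x)\<^sup>2) \<partial>lborel)" if "tame f" for f :: "'a \<Rightarrow> real"
    using tame_integrable_times[OF that that] by (subst nn_integral_eq_integral) (auto simp: power2_eq_square)
  have WM: "(\<lambda>(a, x). ennreal ((W a x)\<^sup>2)) \<in> borel_measurable (borel \<Otimes>\<^sub>M borel)"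
  proof -
    have "(\<lambda>p. log_mean g (snd p) (fst p + c)) \<in> borel_measurable (borel \<Otimes>\<^sub>M borel)" for c
    proof -
      have "(\<lambda>p. (snd p, fst p + c)) \<in> (borel :: real measure) \<Otimes>\<^sub>M (borel :: 'a measure) \<rightarrow>\<^sub>M borel \<Otimes>\<^sub>M borel"
        by measurable
      from measurable_compose[OF this measurable_log_mean[OF g]] show ?thesis by simp
    qed
    then have "(\<lambda>p. W (fst p) (snd p)) \<in> borel_measurable (borel \<Otimes>\<^sub>M borel)"
      unfolding W_def by (intro borel_measurable_sum borel_measurable_times) auto
    then show ?thesis unfolding case_prod_beta by measurable
  qed
  then have WM': "(\<lambda>(a, x). ennreal ((W a x)\<^sup>2)) \<in> borel_measurable (lborel \<Otimes>\<^sub>M lborel)"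
    by (simp cong: measurable_cong_sets sets_pair_measure_cong)
  have "(\<integral>\<^sup>+x. \<integral>\<^sup>+a. ennreal ((W a x)\<^sup>2) \<partial>lborel \<partial>lborel) = (\<integral>\<^sup>+a. \<integral>\<^sup>+x. ennreal ((W a x)\<^sup>2) \<partial>lborel \<partial>lborel)"
    by (rule lborel_pair.Fubini'[OF WM'])
  then have eq: "ennreal K * (\<integral>\<^sup>+x. \<integral>\<^sup>+a. ennreal ((W a x)\<^sup>2) \<partial>lborel \<partial>lborel)
     = (\<integral>\<^sup>+a. ennreal K * (\<integral>\<^sup>+x. ennreal ((W a x)\<^sup>2) \<partial>lborel) \<partial>lborel)"
    using WM' by (simp add: nn_integral_cmult)
  also have "\<dots> = (\<integral>\<^sup>+a. ennreal (K * (\<integral>x. (W a x)\<^sup>2 \<partial>lborel)) \<partial>lborel)"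
    using K by (simp only: sq[OF tW, symmetric] ennreal_mult')
  also note *
  also have "ennreal B * ennreal (K * (\<integral>x. (g x)\<^sup>2 \<partial>lborel)) = ennreal K * (ennreal B * (\<integral>\<^sup>+x. ennreal ((g x)\<^sup>2) \<partial>lborel))"
    using K by (simp only: sq[OF g, symmetric] ennreal_mult' mult_ac)
  finally show ?thesis
    using K unfolding W_def by (subst (asm) ennreal_mult_le_mult_iff) auto
qed

end

section \<open>Smoothing in the logarithmic radius and a Sobolev inequality on the line\<close>

lemma continuous_antiderivative:
  fixes F :: "real \<Rightarrow> real"
  assumes "continuous_on UNIV F"
  obtains P where "\<And>x. (P has_real_derivative F x) (at x)"
proof -
  have "\<exists>P. \<forall>x::real. -\<infinity> < ereal x \<longrightarrow> ereal x < \<infinity> \<longrightarrow> (P has_vector_derivative F x) (at x)"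
    by (rule einterval_antiderivative) (use assms in \<open>auto simp: continuous_on_eq_continuous_at\<close>)
  then show ?thesis using that by (auto simp: has_real_derivative_iff_has_vector_derivative)
qed

text \<open>For N \<ge> 1 the coefficients \<open>- (- 1) ^ k * (N choose k)\<close> with k \<ge> 1
  sum to 1, so this is a signed combination of means of F over \<open>[a, a + k h]\<close>. It is
  obtained from F by subtracting the N-th differences averaged over step sizes in
  \<open>[0, h]\<close>, which makes the smoothing of high order with an explicit remainder.\<close>

definition smooth_avg :: "nat \<Rightarrow> real \<Rightarrow> (real \<Rightarrow> real) \<Rightarrow> real \<Rightarrow> real" where
  "smooth_avg N h F a = - (\<Sum>k=1..N. (- 1) ^ k * real (N choose k) * (integral {a..a + real k * h} F / (real k * h)))"

lemma integral_antiderivative: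
  fixes P F :: "real \<Rightarrow> real"
  assumes "\<And>x. (P has_real_derivative F x) (at x)" "c \<ge> 0"
  shows "integral {a..a + c} F = P (a + c) - P a"
  by (rule integral_unique, rule fundamental_theorem_of_calculus)
     (use assms in \<open>auto simp: has_real_derivative_iff_has_vector_derivative[symmetric] intro: DERIV_subset\<close>)

lemma DERIV_smooth_avg:
  assumes F: "continuous_on UNIV F" and h: "h > 0"
  shows "(smooth_avg N h F has_real_derivative smooth_deriv N h F a) (at a)"
proof -
  obtain P where P: "\<And>x. (P has_real_derivative F x) (at x)"
    using continuous_antiderivative[OF F] by blast
  have sh: "((\<lambda>x. P (x + c)) has_real_derivative F (a + c)) (at a)" for c
  proof -
    have "((\<lambda>x. x + c) has_real_derivative 1) (at a)" by (auto intro!: derivative_eq_intros)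
    from DERIV_chain2[OF P this] show ?thesis by simp
  qed
  have eq: "smooth_avg N h F = (\<lambda>a. - (\<Sum>k=1..N. (- 1) ^ k * real (N choose k) * ((P (a + real k * h) - P a) / (real k * h))))"
    unfolding smooth_avg_def[abs_def] using h by (simp add: integral_antiderivative[OF P])
  show ?thesis unfolding eq smooth_deriv_def
    by (intro DERIV_minus DERIV_sum DERIV_cmult DERIV_cdivide DERIV_diff sh P)
qed

text \<open>Averaging \<open>F (a + k h b)\<close> over b in \<open>[0, 1]\<close> gives the mean of
  F over \<open>[a, a + k h]\<close>, while the term k = 0 of the difference remains
  \<open>F a\<close>.\<close>

lemma smooth_avg_remainder:
  assumes F: "continuous_on UNIV F" and h: "h > 0"
  shows "((\<lambda>b. fdiff N (h * b) F a) has_integral (F a - smooth_avg N h F a)) {0..1}"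
proof -
  obtain P where P: "\<And>x. (P has_real_derivative F x) (at x)"
    using continuous_antiderivative[OF F] by blast
  have 1: "((\<lambda>b. F (a + real k * (h * b))) has_integral (integral {a..a + real k * h} F / (real k * h))) {0..1}"
    if "k \<in> {1..N}" for k
  proof -
    have kh: "real k * h > 0" using that h by simp
    have "((\<lambda>b. F (a + real k * (h * b))) has_integral
       P (a + real k * (h * 1)) / (real k * h) - P (a + real k * (h * 0)) / (real k * h)) {0..1}"
    proof (rule fundamental_theorem_of_calculus)
      fix b :: real
      have "((\<lambda>b. a + real k * (h * b)) has_real_derivative real k * h) (at b)"
        by (auto intro!: derivative_eq_intros)
      note D = DERIV_cdivide[OF DERIV_chain2[OF P this], of "real k * h"]
      have "x * (real k * h) / (real k * h) = x" for x
        by (rule nonzero_mult_div_cancel_right[OF less_imp_neq[OF kh, THEN not_sym]])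
      from D[unfolded this]
      have "((\<lambda>b. P (a + real k * (h * b)) / (real k * h)) has_real_derivative F (a + real k * (h * b))) (at b)" .
      then show "((\<lambda>b. P (a + real k * (h * b)) / (real k * h)) has_vector_derivative F (a + real k * (h * b))) (at b within {0..1})"
        unfolding has_real_derivative_iff_has_vector_derivative[symmetric] by (rule DERIV_subset) simp
    qed simp
    then show ?thesis using kh by (simp add: integral_antiderivative[OF P] diff_divide_distrib)
  qed
  have "((\<lambda>b. F a + (\<Sum>k=1..N. (- 1) ^ k * real (N choose k) * F (a + real k * (h * b)))) has_integral
     F a + (\<Sum>k=1..N. (- 1) ^ k * real (N choose k) * (integral {a..a + real k * h} F / (real k * h)))) {0..1}"
    using has_integral_const_real[of "F a" 0 1]
    by (intro has_integral_add has_integral_sum has_integral_mult_right 1) auto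
  then show ?thesis
    unfolding fdiff_def smooth_avg_def by (simp add: atMost_atLeast0 sum.atLeast_Suc_atMost)
qed

text \<open>Jensen's inequality for the square, obtained by integrating the squared deviation of the
  differences from their mean J.\<close>

lemma smooth_avg_remainder_sq:
  assumes F: "continuous_on UNIV F" and h: "h > 0"
  shows "ennreal ((F a - smooth_avg N h F a)\<^sup>2)
    \<le> (\<integral>\<^sup>+b. ennreal ((fdiff N (h * b) F a)\<^sup>2) * indicator {0..1} b \<partial>lborel)"
proof -
  define \<phi> where "\<phi> b = fdiff N (h * b) F a" for b
  define J where "J = F a - smooth_avg N h F a"
  have i1: "(\<phi> has_integral J) {0..1}"
    using smooth_avg_remainder[OF F h] by (simp add: \<phi>_def[abs_def] J_def)
  have c: "continuous_on {0..1} \<phi>"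
    unfolding \<phi>_def[abs_def] fdiff_def
    by (intro continuous_intros continuous_on_compose2[OF F]) auto
  then have i2: "(\<lambda>b. (\<phi> b)\<^sup>2) integrable_on {0..1}"
    by (intro integrable_continuous_real continuous_intros)
  have "((\<lambda>b. (\<phi> b)\<^sup>2 - 2 * J * \<phi> b + J\<^sup>2) has_integral (integral {0..1} (\<lambda>b. (\<phi> b)\<^sup>2) - 2 * J * J + J\<^sup>2)) {0..1}"
    using has_integral_const_real[of "J\<^sup>2" 0 1]
    by (intro has_integral_add has_integral_diff has_integral_mult_right i1 integrable_integral i2) auto
  moreover have "(\<phi> b)\<^sup>2 - 2 * J * \<phi> b + J\<^sup>2 \<ge> 0" for b
    using zero_le_power2[of "\<phi> b - J"] by (simp add: power2_diff algebra_simps)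
  ultimately have "integral {0..1} (\<lambda>b. (\<phi> b)\<^sup>2) - 2 * J * J + J\<^sup>2 \<ge> 0"
    by (rule has_integral_nonneg)
  then have "J\<^sup>2 \<le> integral {0..1} (\<lambda>b. (\<phi> b)\<^sup>2)"
    by (simp add: power2_eq_square)
  then have "ennreal (J\<^sup>2) \<le> ennreal (integral {0..1} (\<lambda>b. (\<phi> b)\<^sup>2))" by (rule ennreal_leI)
  also have "\<dots> = (\<integral>\<^sup>+b. ennreal ((\<phi> b)\<^sup>2) * indicator {0..1} b \<partial>lborel)"
    by (rule nn_integral_has_integral_lebesgue'[symmetric]) (use i2 in auto)
  finally show ?thesis unfolding J_def \<phi>_def .
qed

text \<open>If w is square integrable, it is arbitrarily small at some b to the right of
  \<open>a\<close>; then w(a)^2 - w(b)^2 is the integral of - 2 w w', and 2 |w w'| \<le> \<rho> w^2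
  + w'^2 / \<rho>. The weight \<rho> allows the two terms to be balanced later.\<close>

lemma sq_le_sobolev:
  assumes w: "\<And>x. (w has_real_derivative w' x) (at x)" and w': "continuous_on UNIV w'" and \<rho>: "\<rho> > 0"
  shows "ennreal ((w a)\<^sup>2) \<le> ennreal \<rho> * (\<integral>\<^sup>+s. ennreal ((w s)\<^sup>2) \<partial>lborel)
      + ennreal (1 / \<rho>) * (\<integral>\<^sup>+s. ennreal ((w' s)\<^sup>2) \<partial>lborel)"
proof -
  have cw: "continuous_on UNIV w"
    using w by (meson DERIV_isCont continuous_at_imp_continuous_on)
  have [measurable]: "w \<in> borel_measurable borel" "w' \<in> borel_measurable borel"
    using cw w' by (auto intro: borel_measurable_continuous_onI)
  let ?I = "\<integral>\<^sup>+s. ennreal ((w s)\<^sup>2) \<partial>lborel"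
  let ?R = "ennreal \<rho> * ?I + ennreal (1 / \<rho>) * (\<integral>\<^sup>+s. ennreal ((w' s)\<^sup>2) \<partial>lborel)"
  show ?thesis
  proof (cases "?I = \<infinity>")
    case True
    then show ?thesis using \<rho> by (simp add: ennreal_mult_top)
  next
    case False
    show ?thesis
    proof (rule ennreal_le_epsilon)
      fix \<eta> :: real assume \<eta>: "\<eta> > 0"
      have "\<exists>b\<ge>a. (w b)\<^sup>2 \<le> \<eta>"
      proof (rule ccontr)
        assume "\<not> ?thesis"
        then have lt: "\<eta> < (w s)\<^sup>2" if "s \<ge> a" for s using that by (meson not_le)
        define i where "i = enn2real ?I"
        have i: "?I = ennreal i" "i \<ge> 0" using False by (simp_all add: i_def less_top)
        \<comment> \<open>If w^2 > \<eta> on an interval of length T, that interval alone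
          contributes i + 1, more than the total i.\<close>
        define T where "T = (i + 1) / \<eta>"
        have T: "T \<ge> 0" "\<eta> * T = i + 1" using \<eta> i by (simp_all add: T_def)
        have "ennreal (i + 1) = ennreal \<eta> * emeasure lborel {a..a + T}"
          using T \<eta> by (simp add: ennreal_mult[symmetric])
        also have "\<dots> = (\<integral>\<^sup>+s. ennreal \<eta> * indicator {a..a + T} s \<partial>lborel)" by (simp add: nn_integral_cmult_indicator)
        also have "\<dots> \<le> ?I"
          using lt by (intro nn_integral_mono) (auto simp: indicator_def intro!: ennreal_leI less_imp_le)
        finally show False using i by simp
      qed
      then obtain b where b: "b \<ge> a" "(w b)\<^sup>2 \<le> \<eta>" by blast
      define \<psi> where "\<psi> s = \<rho> * (w s)\<^sup>2 + 1 / \<rho> * (w' s)\<^sup>2" for s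
      have \<psi>0: "\<psi> s \<ge> 0" for s using \<rho> by (simp add: \<psi>_def)
      have i: "\<psi> integrable_on {a..b}" unfolding \<psi>_def[abs_def]
        by (intro integrable_continuous_real continuous_intros continuous_on_subset[OF cw] continuous_on_subset[OF w']) auto
      have "((\<lambda>s. 2 * w s * w' s) has_integral (w b)\<^sup>2 - (w a)\<^sup>2) {a..b}"
      proof (rule fundamental_theorem_of_calculus[OF b(1)])
        fix s
        have "((\<lambda>s. (w s)\<^sup>2) has_real_derivative 2 * w s * w' s) (at s)"
          using DERIV_power[OF w, of 2] by (simp add: mult_ac)
        then show "((\<lambda>s. (w s)\<^sup>2) has_vector_derivative 2 * w s * w' s) (at s within {a..b})"
          unfolding has_real_derivative_iff_has_vector_derivative[symmetric] by (rule DERIV_subset) simp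
      qed
      from has_integral_neg[OF this]
      have "((\<lambda>s. - (2 * w s * w' s)) has_integral (w a)\<^sup>2 - (w b)\<^sup>2) {a..b}" by simp
      then have "(w a)\<^sup>2 - (w b)\<^sup>2 \<le> integral {a..b} \<psi>"
      proof (rule has_integral_le[OF _ integrable_integral[OF i]])
        fix s
        have "0 \<le> (sqrt \<rho> * w s + 1 / sqrt \<rho> * w' s)\<^sup>2" by simp
        also have "\<dots> = \<psi> s + 2 * w s * w' s"
          using \<rho> by (simp add: \<psi>_def power2_sum power_mult_distrib power_divide field_simps)
        finally show "- (2 * w s * w' s) \<le> \<psi> s" by simp
      qed
      then have "(w a)\<^sup>2 \<le> integral {a..b} \<psi> + \<eta>" using b by simp
      then have "ennreal ((w a)\<^sup>2) \<le> ennreal (integral {a..b} \<psi> + \<eta>)" by (rule ennreal_leI)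
      also have "\<dots> = ennreal (integral {a..b} \<psi>) + ennreal \<eta>"
        using \<eta> by (intro ennreal_plus) (auto intro!: integral_nonneg i \<psi>0)
      also have "ennreal (integral {a..b} \<psi>) = (\<integral>\<^sup>+s. ennreal (\<psi> s) * indicator {a..b} s \<partial>lborel)"
        by (rule nn_integral_has_integral_lebesgue'[symmetric]) (use i \<psi>0 in auto)
      also have "\<dots> \<le> (\<integral>\<^sup>+s. ennreal \<rho> * ennreal ((w s)\<^sup>2) + ennreal (1 / \<rho>) * ennreal ((w' s)\<^sup>2) \<partial>lborel)"
        using \<rho> by (intro nn_integral_mono)
          (auto simp: \<psi>_def indicator_def ennreal_mult'[symmetric] ennreal_plus[symmetric] simp del: ennreal_plus)
      also have "\<dots> = ?R"
        by (subst nn_integral_add) (auto simp: nn_integral_cmult)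
      finally show "ennreal ((w a)\<^sup>2) \<le> ?R + ennreal \<eta>" by (simp add: add_right_mono)
    qed
  qed
qed

text \<open>The cut at - ln b is where the frequency exp a times the step b equals 1: below it
  differences are small by smoothness, above it by decay. Halves appear in the exponents because
  they become integers after squaring.\<close>

lemma nn_integral_frequency_split:
  assumes b: "0 < b"
    and lo: "\<And>a. a \<le> - ln b \<Longrightarrow> \<bar>f a\<bar> \<le> A * (exp a + exp (real m / 2 * a))"
    and hi: "\<And>a. a \<ge> - ln b \<Longrightarrow> \<bar>f a\<bar> \<le> B * exp (- (real n / 2) * a)"
    and mn: "m \<ge> 1" "n \<ge> 1"
  shows "(\<integral>\<^sup>+a. ennreal ((f a)\<^sup>2) \<partial>lborel) \<le> ennreal (2 * A\<^sup>2 * (1 / b\<^sup>2 + 1 / b ^ m) + B\<^sup>2 * b ^ n)"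
proof -
  have e: "exp (real k * - ln b) = 1 / b ^ k" for k
    using b by (simp add: exp_minus exp_of_nat_mult inverse_eq_divide)
  have e': "exp (- real k * - ln b) = b ^ k" for k
    using b by (simp add: exp_of_nat_mult)
  have "(\<integral>\<^sup>+a. ennreal ((f a)\<^sup>2) \<partial>lborel)
    \<le> ennreal (2 * A\<^sup>2 * (exp (2 * - ln b) / 2 + exp (real m * - ln b) / real m) + B\<^sup>2 * (exp (- real n * - ln b) / real n))"
  proof (rule nn_integral_two_sided_exp_le)
    fix a assume "a \<le> - ln b"
    from lo[OF this] have "\<bar>f a\<bar>\<^sup>2 \<le> (A * (exp a + exp (real m / 2 * a)))\<^sup>2"
      by (intro power_mono) auto
    also have "\<dots> \<le> A\<^sup>2 * (2 * (exp a)\<^sup>2 + 2 * (exp (real m / 2 * a))\<^sup>2)"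
      using sum_squares_bound[of "exp a" "exp (real m / 2 * a)"]
      unfolding power_mult_distrib by (intro mult_left_mono) (auto simp: power2_sum)
    also have "\<dots> = 2 * A\<^sup>2 * (exp (2 * a) + exp (real m * a))"
      by (simp add: exp_double[symmetric] algebra_simps)
    finally show "(f a)\<^sup>2 \<le> 2 * A\<^sup>2 * (exp (2 * a) + exp (real m * a))" by simp
  next
    fix a assume "a \<ge> - ln b"
    from hi[OF this] have "\<bar>f a\<bar>\<^sup>2 \<le> (B * exp (- (real n / 2) * a))\<^sup>2"
      by (intro power_mono) auto
    also have "\<dots> = B\<^sup>2 * exp (- real n * a)"
      by (simp add: power_mult_distrib exp_double[symmetric])
    finally show "(f a)\<^sup>2 \<le> B\<^sup>2 * exp (- real n * a)" by simp
  qed (use mn in auto)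
  also have "\<dots> \<le> ennreal (2 * A\<^sup>2 * (1 / b\<^sup>2 + 1 / b ^ m) + B\<^sup>2 * b ^ n)"
  proof (intro ennreal_leI add_mono mult_left_mono)
    have dv: "x / real k \<le> x" if "x \<ge> 0" "k \<ge> 1" for x k
      using frac_le[of x x 1 "real k"] that by simp
    show "exp (2 * - ln b) / 2 \<le> 1 / b\<^sup>2" using e[of 2] dv[of "1 / b\<^sup>2" 2] b by simp
    show "exp (real m * - ln b) / real m \<le> 1 / b ^ m"
      unfolding e using b mn by (intro dv) auto
    show "exp (- real n * - ln b) / real n \<le> b ^ n"
      unfolding e' using b mn by (intro dv) auto
  qed auto
  finally show ?thesis .
qed

section \<open>Square integrals of differences of the multiplier\<close>

context sphere_measure
begin

text \<open>Put n = d - 1. Below the cut, \<open>b^N\<close> times the growth exp ((N - n/2) a)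
  gives, squared and integrated, b^(2N) b^(-(2N - n)) = b^n; above it the decay exp (- n a / 2)
  gives b^n as well. For \<open>smooth_deriv\<close> the approximation uses one more derivative and
  the crude bound above the cut loses 1 / h; either costs h^(-2) after squaring, which leaves n - 2
  = d - 3.\<close>

lemma multiplier_L2:
  obtains C where "C > 0"
    "\<And>b. 0 \<le> b \<Longrightarrow> b \<le> 1 \<Longrightarrow>
      (\<integral>\<^sup>+a. ennreal ((fdiff DIM('a) b log_multiplier a)\<^sup>2) \<partial>lborel) \<le> ennreal (C * b ^ (DIM('a) - 1))"
    "\<And>h. 0 < h \<Longrightarrow> h \<le> 1 \<Longrightarrow>
      (\<integral>\<^sup>+a. ennreal ((smooth_deriv DIM('a) (h / 2) log_multiplier a - smooth_deriv DIM('a) h log_multiplier a)\<^sup>2) \<partial>lborel)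
        \<le> ennreal (C * h ^ (DIM('a) - 3))"
proof -
  obtain D where D0: "D 0 = log_multiplier"
    and D: "\<And>k a. (D k has_real_derivative D (Suc k) a) (at a)"
    and big: "\<And>k. \<exists>C>0. \<forall>a\<ge>0. \<bar>D k a\<bar> \<le> C * exp ((real k - real (DIM('a) - 1) / 2) * a)"
    and small: "\<And>k. \<exists>C>0. \<forall>a\<le>0. \<bar>D (Suc k) a\<bar> \<le> C * exp a"
    using log_multiplier_derivatives by blast
  define N where "N = DIM('a)"
  define n where "n = DIM('a) - 1"
  obtain j where "DIM('a) = 3 + j" using le_Suc_ex[OF dim] by blast
  then have j: "DIM('a) = Suc (Suc (Suc j))" by simp
  have Nn: "N = Suc n" "N = Suc (Suc (Suc j))" "n = Suc (Suc j)" by (simp_all add: N_def n_def j)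
  \<comment> \<open>One bound on the whole line: exp a comes from the vanishing at small radii, the
    other term from the growth at large ones. Moving x by at most N to the right of \<open>a\<close>
    changes only the constant, and all steps used are at most 1.\<close>
  have comb: "\<exists>C>0. \<forall>a x. a \<le> x \<longrightarrow> x \<le> a + real N \<longrightarrow> \<bar>D k x\<bar> \<le> C * (exp a + exp (real (2 * k - n) / 2 * a))"
    if k: "k \<ge> N" for k
  proof -
    obtain C1 where C1: "C1 > 0" "\<And>a. a \<ge> 0 \<Longrightarrow> \<bar>D k a\<bar> \<le> C1 * exp ((real k - real n / 2) * a)"
      using big[of k] unfolding n_def by blast
    obtain C2 where C2: "C2 > 0" "\<And>a. a \<le> 0 \<Longrightarrow> \<bar>D k a\<bar> \<le> C2 * exp a"
      using small[of "k - 1"] k Nn by (auto simp: Suc_diff_Suc)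
    define \<kappa> where "\<kappa> = real (2 * k - n) / 2"
    have "n < 2 * k" using k Nn(1) by linarith
    then have \<kappa>: "\<kappa> = real k - real n / 2" "\<kappa> > 0"
      by (simp_all add: \<kappa>_def of_nat_diff diff_divide_distrib)
    show ?thesis unfolding \<kappa>_def[symmetric]
    proof (intro exI[of _ "C1 * exp (\<kappa> * real N) + C2 * exp (real N)"] conjI allI impI)
      fix a x assume x: "a \<le> x" "x \<le> a + real N"
      show "\<bar>D k x\<bar> \<le> (C1 * exp (\<kappa> * real N) + C2 * exp (real N)) * (exp a + exp (\<kappa> * a))"
      proof (cases "x \<ge> 0")
        case True
        have "\<bar>D k x\<bar> \<le> C1 * exp (\<kappa> * x)" using C1(2)[OF True] by (simp add: \<kappa>)
        also have "\<dots> \<le> C1 * exp (\<kappa> * (a + real N))" using x C1 \<kappa>(2) by (intro mult_left_mono) auto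
        also have "\<dots> = C1 * exp (\<kappa> * real N) * exp (\<kappa> * a)" by (simp add: distrib_left exp_add mult_ac)
        also have "\<dots> \<le> (C1 * exp (\<kappa> * real N) + C2 * exp (real N)) * (exp a + exp (\<kappa> * a))"
          using C1 C2 by (intro mult_mono) auto
        finally show ?thesis .
      next
        case False
        have "\<bar>D k x\<bar> \<le> C2 * exp x" using C2(2)[of x] False by simp
        also have "\<dots> \<le> C2 * exp (a + real N)" using x C2 by (intro mult_left_mono) auto
        also have "\<dots> = C2 * exp (real N) * exp a" by (simp add: exp_add mult_ac)
        also have "\<dots> \<le> (C1 * exp (\<kappa> * real N) + C2 * exp (real N)) * (exp a + exp (\<kappa> * a))"
          using C1 C2 by (intro mult_mono) auto
        finally show ?thesis .
      qed
    qed (use C1 C2 in \<open>auto intro!: add_pos_pos\<close>)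
  qed
  have e: "2 * N - n = n + 2" "2 * Suc N - n = n + 4" using Nn by simp_all
  obtain A1 where A1: "A1 > 0" "\<And>a x. a \<le> x \<Longrightarrow> x \<le> a + real N \<Longrightarrow> \<bar>D N x\<bar> \<le> A1 * (exp a + exp (real (n + 2) / 2 * a))"
    using comb[of N] unfolding e by blast
  obtain A2 where A2: "A2 > 0" "\<And>a x. a \<le> x \<Longrightarrow> x \<le> a + real N \<Longrightarrow> \<bar>D (Suc N) x\<bar> \<le> A2 * (exp a + exp (real (n + 4) / 2 * a))"
    using comb[of "Suc N"] unfolding e by (meson le_SucI order_refl)
  obtain B where B: "B > 0" "\<And>a. a \<ge> 0 \<Longrightarrow> \<bar>log_multiplier a\<bar> \<le> B * exp (- (real n / 2) * a)"
    using big[of 0] unfolding D0 n_def by auto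
  have dec: "\<bar>log_multiplier x\<bar> \<le> B * exp (- (real n / 2) * a)" if "0 \<le> a" "a \<le> x" for a x
  proof -
    have "\<bar>log_multiplier x\<bar> \<le> B * exp (- (real n / 2) * x)" using B(2) that by auto
    also have "\<dots> \<le> B * exp (- (real n / 2) * a)"
      using that B(1) by (intro mult_left_mono) (auto intro!: mult_left_mono)
    finally show ?thesis .
  qed
  define C where "C = (4 * A1\<^sup>2 + (2 ^ N * B)\<^sup>2) + (4 * (2 * A2)\<^sup>2 + (6 * 2 ^ N * B)\<^sup>2)"
  have pw: "b ^ (2 * N) / b\<^sup>2 = b ^ (2 * n)" "b ^ (2 * N) / b ^ (n + 2) = b ^ n" "b ^ (2 * N) / b ^ (n + 4) = b ^ j"
     if "b > 0" for b :: real
  proof -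
    have "b ^ (i + k) / b ^ k = b ^ i" for i k using that by (simp add: power_add)
    moreover have "2 * N = 2 * n + 2" "2 * N = n + (n + 2)" "2 * N = j + (n + 4)" using Nn by simp_all
    ultimately show "b ^ (2 * N) / b\<^sup>2 = b ^ (2 * n)" "b ^ (2 * N) / b ^ (n + 2) = b ^ n" "b ^ (2 * N) / b ^ (n + 4) = b ^ j"
      by metis+
  qed
  show thesis
  proof (rule that[of C])
    show "C > 0" using A1 B by (auto simp: C_def intro!: add_pos_nonneg)
    fix b :: real assume b: "0 \<le> b" "b \<le> 1"
    show "(\<integral>\<^sup>+a. ennreal ((fdiff DIM('a) b log_multiplier a)\<^sup>2) \<partial>lborel) \<le> ennreal (C * b ^ (DIM('a) - 1))"
    proof (cases "b = 0")
      case True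
      \<comment> \<open>Step 0 is an endpoint of the range over which steps are averaged; there the
        power of b vanishes, and so does the alternating binomial sum.\<close>
      have "fdiff N 0 F a = 0" for F a
        unfolding fdiff_def using choose_alternating_sum[of N, where 'a=real] Nn
        by (simp add: sum_distrib_right[symmetric])
      then show ?thesis by (simp add: True N_def[symmetric])
    next
      case False
      then have b0: "b > 0" using b by simp
      have L: "- ln b \<ge> 0" using b b0 by simp
      have "(\<integral>\<^sup>+a. ennreal ((fdiff N b log_multiplier a)\<^sup>2) \<partial>lborel)
         \<le> ennreal (2 * (b ^ N * A1)\<^sup>2 * (1 / b\<^sup>2 + 1 / b ^ (n + 2)) + (2 ^ N * B)\<^sup>2 * b ^ n)"
      proof (rule nn_integral_frequency_split[OF b0])
        fix a assume "a \<le> - ln b"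
        have "\<bar>fdiff N b (D 0) a\<bar> \<le> b ^ N * (A1 * (exp a + exp (real (n + 2) / 2 * a)))"
        proof (rule abs_fdiff_le[where D=D, OF D])
          fix x assume x: "a \<le> x" "x \<le> a + real N * b"
          note x(2)
          also have "a + real N * b \<le> a + real N" using b by (simp add: mult_left_le)
          finally show "\<bar>D (0 + N) x\<bar> \<le> A1 * (exp a + exp (real (n + 2) / 2 * a))" using A1(2) x by simp
        qed (use b in auto)
        then show "\<bar>fdiff N b log_multiplier a\<bar> \<le> b ^ N * A1 * (exp a + exp (real (n + 2) / 2 * a))"
          by (simp add: D0 mult.assoc)
      next
        fix a assume a: "a \<ge> - ln b"
        have "\<bar>fdiff N b log_multiplier a\<bar> \<le> 2 ^ N * (B * exp (- (real n / 2) * a))"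
          by (rule abs_fdiff_le_sup) (use dec a L b in auto)
        then show "\<bar>fdiff N b log_multiplier a\<bar> \<le> 2 ^ N * B * exp (- (real n / 2) * a)" by (simp add: mult.assoc)
      qed (use Nn in auto)
      also have "2 * (b ^ N * A1)\<^sup>2 * (1 / b\<^sup>2 + 1 / b ^ (n + 2)) = 2 * A1\<^sup>2 * (b ^ (2 * N) / b\<^sup>2 + b ^ (2 * N) / b ^ (n + 2))"
        by (simp add: power_mult_distrib power_mult[symmetric] algebra_simps)
      also have "\<dots> = 2 * A1\<^sup>2 * (b ^ (2 * n) + b ^ n)" by (simp only: pw[OF b0])
      also have "ennreal (2 * A1\<^sup>2 * (b ^ (2 * n) + b ^ n) + (2 ^ N * B)\<^sup>2 * b ^ n) \<le> ennreal (C * b ^ n)"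
      proof (intro ennreal_leI)
        have "b ^ (2 * n) \<le> b ^ n" using b by (intro power_decreasing) auto
        then have "2 * A1\<^sup>2 * (b ^ (2 * n) + b ^ n) \<le> 2 * A1\<^sup>2 * (b ^ n + b ^ n)" by (intro mult_left_mono) auto
        then have "2 * A1\<^sup>2 * (b ^ (2 * n) + b ^ n) + (2 ^ N * B)\<^sup>2 * b ^ n \<le> (4 * A1\<^sup>2 + (2 ^ N * B)\<^sup>2) * b ^ n"
          by (simp add: algebra_simps)
        also have "\<dots> \<le> C * b ^ n" unfolding C_def using b by (intro mult_right_mono) auto
        finally show "2 * A1\<^sup>2 * (b ^ (2 * n) + b ^ n) + (2 ^ N * B)\<^sup>2 * b ^ n \<le> C * b ^ n" .
      qed
      finally show ?thesis by (simp add: N_def n_def)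
    qed
  next
    fix h :: real assume h: "0 < h" "h \<le> 1"
    let ?f = "\<lambda>a. smooth_deriv N (h / 2) log_multiplier a - smooth_deriv N h log_multiplier a"
    have L: "- ln h \<ge> 0" using h by simp
    have "(\<integral>\<^sup>+a. ennreal ((?f a)\<^sup>2) \<partial>lborel)
       \<le> ennreal (2 * (h ^ N * (2 * A2))\<^sup>2 * (1 / h\<^sup>2 + 1 / h ^ (n + 4)) + (6 * 2 ^ N * B / h)\<^sup>2 * h ^ n)"
    proof (rule nn_integral_frequency_split[OF h(1)])
      fix a assume "a \<le> - ln h"
      define E where "E = A2 * (exp a + exp (real (n + 4) / 2 * a))"
      have E0: "E \<ge> 0" using A2 by (simp add: E_def)
      \<comment> \<open>Both scales approximate the same derivative \<open>D 1\<close>, which drops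
        out of their difference.\<close>
      have *: "\<bar>D 1 a - smooth_deriv N k (D 0) a\<bar> \<le> h ^ N * E" if k: "0 < k" "k \<le> h" for k
      proof -
        have "\<bar>D 1 a - smooth_deriv N k (D 0) a\<bar> \<le> k ^ N * E"
        proof (rule smooth_deriv_approx[where D=D, OF D k(1)])
          fix x assume x: "a \<le> x" "x \<le> a + real N * k"
          note x(2)
          also have "a + real N * k \<le> a + real N" using h k by (simp add: mult_left_le)
          finally show "\<bar>D (Suc N) x\<bar> \<le> E" using A2(2) x by (simp add: E_def)
        qed
        also have "\<dots> \<le> h ^ N * E" using k E0 by (intro mult_right_mono power_mono) auto
        finally show ?thesis .
      qed
      have "\<bar>?f a\<bar> \<le> h ^ N * E + h ^ N * E"
      proof -
        have "\<bar>D 1 a - smooth_deriv N h log_multiplier a\<bar> \<le> h ^ N * E"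
          "\<bar>D 1 a - smooth_deriv N (h / 2) log_multiplier a\<bar> \<le> h ^ N * E"
          using *[of h] *[of "h / 2"] h unfolding D0 by simp_all
        then show ?thesis by linarith
      qed
      then show "\<bar>?f a\<bar> \<le> h ^ N * (2 * A2) * (exp a + exp (real (n + 4) / 2 * a))"
        by (simp add: E_def algebra_simps)
    next
      fix a assume a: "a \<ge> - ln h"
      define E where "E = B * exp (- (real n / 2) * a)"
      have s: "\<bar>smooth_deriv N k log_multiplier a\<bar> \<le> 2 ^ N * (2 * E / k)" if "k > 0" for k
        unfolding E_def by (rule abs_smooth_deriv_le_sup) (use dec a L that in auto)
      have "\<bar>?f a\<bar> \<le> 2 ^ N * (2 * E / (h / 2)) + 2 ^ N * (2 * E / h)"
        by (intro order_trans[OF abs_triangle_ineq4] add_mono s) (use h in auto)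
      also have "\<dots> = 6 * 2 ^ N * B / h * exp (- (real n / 2) * a)"
        using h by (simp add: E_def field_simps)
      finally show "\<bar>?f a\<bar> \<le> 6 * 2 ^ N * B / h * exp (- (real n / 2) * a)" .
    qed (use Nn in auto)
    also have "2 * (h ^ N * (2 * A2))\<^sup>2 * (1 / h\<^sup>2 + 1 / h ^ (n + 4)) = 2 * (2 * A2)\<^sup>2 * (h ^ (2 * N) / h\<^sup>2 + h ^ (2 * N) / h ^ (n + 4))"
      by (simp add: power_mult_distrib power_mult[symmetric] algebra_simps)
    also have "\<dots> = 2 * (2 * A2)\<^sup>2 * (h ^ (2 * n) + h ^ j)" by (simp only: pw[OF h(1)])
    also have "(6 * 2 ^ N * B / h)\<^sup>2 * h ^ n = (6 * 2 ^ N * B)\<^sup>2 * h ^ j"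
      using h by (simp add: Nn power_divide power2_eq_square)
    also have "ennreal (2 * (2 * A2)\<^sup>2 * (h ^ (2 * n) + h ^ j) + (6 * 2 ^ N * B)\<^sup>2 * h ^ j) \<le> ennreal (C * h ^ j)"
    proof (intro ennreal_leI)
      have "h ^ (2 * n) \<le> h ^ j" using h Nn by (intro power_decreasing) auto
      then have "2 * (2 * A2)\<^sup>2 * (h ^ (2 * n) + h ^ j) \<le> 2 * (2 * A2)\<^sup>2 * (h ^ j + h ^ j)" by (intro mult_left_mono) auto
      then have "2 * (2 * A2)\<^sup>2 * (h ^ (2 * n) + h ^ j) + (6 * 2 ^ N * B)\<^sup>2 * h ^ j \<le> (4 * (2 * A2)\<^sup>2 + (6 * 2 ^ N * B)\<^sup>2) * h ^ j"
        by (simp add: algebra_simps)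
      also have "\<dots> \<le> C * h ^ j" unfolding C_def using h by (intro mult_right_mono) auto
      finally show "2 * (2 * A2)\<^sup>2 * (h ^ (2 * n) + h ^ j) + (6 * 2 ^ N * B)\<^sup>2 * h ^ j \<le> C * h ^ j" .
    qed
    finally show "(\<integral>\<^sup>+a. ennreal ((smooth_deriv DIM('a) (h / 2) log_multiplier a - smooth_deriv DIM('a) h log_multiplier a)\<^sup>2) \<partial>lborel)
        \<le> ennreal (C * h ^ (DIM('a) - 3))" by (simp add: N_def[symmetric] Nn)
  qed
qed

end

lemma measurable_balls [measurable]:
  fixes x :: "'a::euclidean_space"
  shows "cball x r \<in> sets borel" "ball x r \<in> sets borel"
  by auto

subsection \<open>The Hardy-Littlewood maximal theorem\<close>

text \<open>An outer-measure bound, which spares the measurability of the exceptional sets.\<close>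
definition outer_le :: "'a::euclidean_space set \<Rightarrow> ennreal \<Rightarrow> bool" where
  "outer_le E c \<longleftrightarrow> (\<exists>S\<in>sets borel. E \<subseteq> S \<and> emeasure lborel S \<le> c)"

lemma outer_le_mono: "outer_le E c \<Longrightarrow> F \<subseteq> E \<Longrightarrow> c \<le> d \<Longrightarrow> outer_le F d"
  unfolding outer_le_def by (meson order_trans)

lemma outer_le_Un:
  assumes "outer_le E c" "outer_le F d" shows "outer_le (E \<union> F) (c + d)"
proof -
  obtain S T where "S \<in> sets borel" "E \<subseteq> S" "emeasure lborel S \<le> c" "T \<in> sets borel" "F \<subseteq> T" "emeasure lborel T \<le> d"
    using assms by (auto simp: outer_le_def)
  moreover from this have "emeasure lborel (S \<union> T) \<le> c + d"
    by (intro order_trans[OF emeasure_subadditive] add_mono) auto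
  ultimately show ?thesis unfolding outer_le_def by (intro bexI[of _ "S \<union> T"]) auto
qed

lemma outer_le_UN:
  fixes E :: "nat \<Rightarrow> 'a::euclidean_space set"
  assumes "\<And>j. outer_le (E j) (c j)" shows "outer_le (\<Union>j. E j) (\<Sum>j. c j)"
proof -
  obtain S where S: "\<And>j. S j \<in> sets borel" "\<And>j. E j \<subseteq> S j" "\<And>j. emeasure lborel (S j) \<le> c j"
    using assms unfolding outer_le_def by metis
  have "emeasure lborel (\<Union>j. S j) \<le> (\<Sum>j. emeasure lborel (S j))"
    using S(1) by (intro emeasure_subadditive_countably) auto
  also have "\<dots> \<le> (\<Sum>j. c j)" by (intro suminf_le S(3)) auto
  finally show ?thesis unfolding outer_le_def using S by (intro bexI[of _ "\<Union>j. S j"]) blast+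
qed

text \<open>Vitali's covering lemma: finiteness of the integral bounds the admissible radii, so a
  countable disjoint family of balls can be chosen whose fivefold enlargements cover E; disjointness
  bounds the sum of the integrals of G over the balls by one integral.\<close>

lemma hardy_littlewood_outer:
  fixes G :: "'a::euclidean_space \<Rightarrow> ennreal"
  assumes G[measurable]: "G \<in> borel_measurable borel" and fin: "(\<integral>\<^sup>+y. G y \<partial>lborel) < \<infinity>"
    and \<mu>: "\<mu> > 0"
    and E: "\<And>x. x \<in> E \<Longrightarrow> \<exists>R>0. ennreal \<mu> * emeasure lborel (cball x R)
               \<le> (\<integral>\<^sup>+y. G y * indicator (cball x R) y \<partial>lborel)"
  shows "outer_le E (ennreal (5 ^ DIM('a) / \<mu>) * (\<integral>\<^sup>+y. G y \<partial>lborel))"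
proof -
  define v where "v = unit_ball_vol (real DIM('a))"
  have v: "v > 0" by (simp add: v_def)
  define I where "I = enn2real (\<integral>\<^sup>+y. G y \<partial>lborel)"
  have I: "(\<integral>\<^sup>+y. G y \<partial>lborel) = ennreal I" "I \<ge> 0" using fin by (auto simp: I_def)
  define K where "K = {(x, R). R > 0 \<and> ennreal \<mu> * emeasure lborel (cball x R)
               \<le> (\<integral>\<^sup>+y. G y * indicator (cball x R) y \<partial>lborel)}"
  have cb: "emeasure lborel (cball x R) = ennreal (v * R ^ DIM('a))" if "R > 0" for x :: 'a and R
    using that by (simp add: emeasure_cball v_def)
  \<comment> \<open>An admissible ball has volume at most \<open>I / \<mu>\<close>; a radius above 1
    is at most its own d-th power.\<close>
  have radius: "0 < snd i \<and> snd i \<le> max 1 (I / (\<mu> * v))" if iK: "i \<in> K" for i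
  proof -
    obtain x R where i: "i = (x, R)" by force
    have R: "R > 0" and le: "ennreal \<mu> * emeasure lborel (cball x R)
               \<le> (\<integral>\<^sup>+y. G y * indicator (cball x R) y \<partial>lborel)"
      using iK by (auto simp: K_def i)
    have "ennreal (\<mu> * (v * R ^ DIM('a))) = ennreal \<mu> * emeasure lborel (cball x R)"
      using \<mu> v R by (simp add: cb ennreal_mult)
    also note le
    also have "(\<integral>\<^sup>+y. G y * indicator (cball x R) y \<partial>lborel) \<le> (\<integral>\<^sup>+y. G y \<partial>lborel)"
      by (intro nn_integral_mono) (auto simp: indicator_def)
    finally have "\<mu> * (v * R ^ DIM('a)) \<le> I" using I by simp
    then have *: "R ^ DIM('a) \<le> I / (\<mu> * v)" using \<mu> v by (simp add: field_simps)
    have "R \<le> max 1 (I / (\<mu> * v))"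
    proof (cases "R \<le> 1")
      case False
      then have "R ^ 1 \<le> R ^ DIM('a)" by (intro power_increasing) (auto simp: DIM_positive Suc_leI)
      with * show ?thesis by simp
    qed simp
    with R show ?thesis by (simp add: i)
  qed
  have "E \<subseteq> (\<Union>i\<in>K. cball (fst i) (snd i))"
  proof
    fix x assume "x \<in> E"
    from E[OF this] obtain R where "(x, R) \<in> K" "R > 0" by (auto simp: K_def)
    then show "x \<in> (\<Union>i\<in>K. cball (fst i) (snd i))" by force
  qed
  then obtain C where C: "countable C" "C \<subseteq> K"
     "pairwise (\<lambda>i j. disjnt (cball (fst i) (snd i)) (cball (fst j) (snd j))) C"
     "E \<subseteq> (\<Union>i\<in>C. cball (fst i) (5 * snd i))"
    using radius by (rule Vitali_covering_lemma_cballs)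
  let ?B = "\<lambda>i. cball (fst i) (snd i)"
  have U: "(\<Union>i\<in>C. cball (fst i) (5 * snd i)) \<in> sets lborel"
    using C(1) by (intro sets.countable_UN'') auto
  \<comment> \<open>Sums over the chosen balls are written as integrals over
    \<open>count_space C\<close>, so that they can be exchanged with Lebesgue integrals.\<close>
  let ?S = "\<Union>i\<in>C. cball (fst i) (5 * snd i)"
  have "emeasure lborel ?S = (\<integral>\<^sup>+x. indicator ?S x \<partial>lborel)"
    using U by simp
  also have "\<dots> \<le> (\<integral>\<^sup>+x. \<integral>\<^sup>+i. indicator (cball (fst i) (5 * snd i)) x \<partial>count_space C \<partial>lborel)"
  proof (intro nn_integral_mono)
    fix x :: 'a
    show "indicator (\<Union>i\<in>C. cball (fst i) (5 * snd i)) x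
        \<le> (\<integral>\<^sup>+i. indicator (cball (fst i) (5 * snd i)) x \<partial>count_space C)"
    proof (cases "x \<in> (\<Union>i\<in>C. cball (fst i) (5 * snd i))")
      case True
      then obtain i0 where i0: "i0 \<in> C" "x \<in> cball (fst i0) (5 * snd i0)" by blast
      have "1 = (\<integral>\<^sup>+i. indicator {i0} i \<partial>count_space C)" using i0 by simp
      also have "\<dots> \<le> (\<integral>\<^sup>+i. indicator (cball (fst i) (5 * snd i)) x \<partial>count_space C)"
        using i0 by (intro nn_integral_mono) (auto simp: indicator_def)
      finally show ?thesis using True by simp
    qed simp
  qed
  also have "\<dots> = (\<integral>\<^sup>+i. \<integral>\<^sup>+x. indicator (cball (fst i) (5 * snd i)) x \<partial>lborel \<partial>count_space C)"
    using C(1) by (intro nn_integral_count_space_nn_integral borel_measurable_indicator) auto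
  also have "\<dots> = (\<integral>\<^sup>+i. 5 ^ DIM('a) * emeasure lborel (?B i) \<partial>count_space C)"
  proof (intro nn_integral_cong)
    fix i assume "i \<in> space (count_space C)"
    then have "snd i > 0" using C(2) radius[of i] by auto
    then show "(\<integral>\<^sup>+x. indicator (cball (fst i) (5 * snd i)) x \<partial>lborel) = 5 ^ DIM('a) * emeasure lborel (?B i)"
      using v by (simp add: cb power_mult_distrib ennreal_mult ennreal_power[symmetric] mult.left_commute)
  qed
  finally have le: "emeasure lborel ?S \<le> (\<integral>\<^sup>+i. 5 ^ DIM('a) * emeasure lborel (?B i) \<partial>count_space C)" .
  have "ennreal \<mu> * emeasure lborel ?S \<le> ennreal \<mu> * (\<integral>\<^sup>+i. 5 ^ DIM('a) * emeasure lborel (?B i) \<partial>count_space C)"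
    by (rule mult_left_mono[OF le]) simp
  also have "\<dots> = (\<integral>\<^sup>+i. 5 ^ DIM('a) * (ennreal \<mu> * emeasure lborel (?B i)) \<partial>count_space C)"
    by (subst nn_integral_cmult[symmetric]) (auto simp: mult_ac)
  also have "\<dots> \<le> (\<integral>\<^sup>+i. 5 ^ DIM('a) * (\<integral>\<^sup>+y. G y * indicator (?B i) y \<partial>lborel) \<partial>count_space C)"
    using C(2) by (intro nn_integral_mono mult_left_mono) (auto simp: K_def)
  also have "\<dots> = 5 ^ DIM('a) * (\<integral>\<^sup>+i. (\<integral>\<^sup>+y. G y * indicator (?B i) y \<partial>lborel) \<partial>count_space C)"
    by (subst nn_integral_cmult) auto
  also have "(\<integral>\<^sup>+i. (\<integral>\<^sup>+y. G y * indicator (?B i) y \<partial>lborel) \<partial>count_space C)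
     = (\<integral>\<^sup>+y. \<integral>\<^sup>+i. G y * indicator (?B i) y \<partial>count_space C \<partial>lborel)"
    using C(1) by (intro nn_integral_count_space_nn_integral[symmetric] borel_measurable_times_ennreal borel_measurable_indicator) auto
  also have "\<dots> \<le> (\<integral>\<^sup>+y. G y \<partial>lborel)"
  proof (intro nn_integral_mono)
    \<comment> \<open>By disjointness y lies in at most one of the balls, so the overlap function is
      at most 1.\<close>
    fix y :: 'a
    have "(\<integral>\<^sup>+i. indicator (?B i) y \<partial>count_space C) \<le> (1 :: ennreal)"
    proof (cases "\<exists>i0\<in>C. y \<in> ?B i0")
      case True
      then obtain i0 where i0: "i0 \<in> C" "y \<in> ?B i0" by blast
      have "(\<integral>\<^sup>+i. indicator (?B i) y \<partial>count_space C) \<le> (\<integral>\<^sup>+i. indicator {i0} i \<partial>count_space C :: ennreal)"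
      proof (intro nn_integral_mono)
        fix i assume i: "i \<in> space (count_space C)"
        show "indicator (?B i) y \<le> (indicator {i0} i :: ennreal)"
        proof (cases "i = i0")
          case False
          then have "disjnt (?B i) (?B i0)" using C(3) i i0 by (auto simp: pairwise_def)
          then have "y \<notin> ?B i" using i0 by (auto simp only: disjnt_iff)
          then show ?thesis by simp
        qed (simp add: indicator_def)
      qed
      also have "\<dots> = 1" using i0 by simp
      finally show ?thesis .
    next
      case False
      then have "(\<integral>\<^sup>+i. indicator (?B i) y \<partial>count_space C) = (\<integral>\<^sup>+i. 0 \<partial>count_space C :: ennreal)"
        by (intro nn_integral_cong) auto
      then show ?thesis by simp
    qed
    then have "G y * (\<integral>\<^sup>+i. indicator (?B i) y \<partial>count_space C) \<le> G y * 1"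
      by (rule mult_left_mono) simp
    then show "(\<integral>\<^sup>+i. G y * indicator (?B i) y \<partial>count_space C) \<le> G y"
      by (subst nn_integral_cmult) auto
  qed
  finally have fin: "ennreal \<mu> * emeasure lborel ?S \<le> 5 ^ DIM('a) * (\<integral>\<^sup>+y. G y \<partial>lborel)"
    by (simp add: mult_left_mono)
  have "emeasure lborel ?S = ennreal (1 / \<mu>) * (ennreal \<mu> * emeasure lborel ?S)"
    using \<mu> by (simp add: mult.assoc[symmetric] ennreal_mult[symmetric])
  also have "\<dots> \<le> ennreal (1 / \<mu>) * (5 ^ DIM('a) * (\<integral>\<^sup>+y. G y \<partial>lborel))"
    by (rule mult_left_mono[OF fin]) simp
  also have "\<dots> = ennreal (5 ^ DIM('a) / \<mu>) * (\<integral>\<^sup>+y. G y \<partial>lborel)"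
  proof -
    have "(5 :: ennreal) ^ DIM('a) = ennreal (5 ^ DIM('a))"
      by (simp add: ennreal_power flip: ennreal_numeral)
    then have "ennreal (5 ^ DIM('a) / \<mu>) = ennreal (1 / \<mu>) * 5 ^ DIM('a)"
      using \<mu> by (simp add: ennreal_mult[symmetric])
    then show ?thesis by (simp only: mult.assoc)
  qed
  finally show ?thesis
    using C(4) U unfolding outer_le_def by (intro bexI[of _ ?S]) auto
qed

text \<open>The means over intervals of length k h are all compared with one integral over a window
  of fixed length N. This costs 1 / h, but lets the density bound \<open>cone_density\<close> apply
  with constants independent of h.\<close>

lemma abs_smooth_avg_le:
  assumes F: "continuous_on UNIV F" "\<And>x. F x \<ge> 0" and h: "0 < h" "h \<le> 1"
  shows "\<bar>smooth_avg N h F a\<bar> \<le> 2 ^ N / h * integral {a..a + real N} F"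
proof -
  have i: "F integrable_on {x..y}" for x y
    by (intro integrable_continuous_real continuous_on_subset[OF F(1)]) auto
  have I0: "integral {a..a + real N} F \<ge> 0" by (intro integral_nonneg i F)
  have "\<bar>smooth_avg N h F a\<bar> \<le> (\<Sum>k=1..N. \<bar>(- 1) ^ k * real (N choose k) * (integral {a..a + real k * h} F / (real k * h))\<bar>)"
    unfolding smooth_avg_def abs_minus_cancel by (rule sum_abs)
  also have "\<dots> \<le> (\<Sum>k=1..N. real (N choose k) * (integral {a..a + real N} F / h))"
  proof (intro sum_mono)
    fix k assume k: "k \<in> {1..N}"
    have "real k * h \<le> real N * 1" using k h by (intro mult_mono) auto
    then have "integral {a..a + real k * h} F \<le> integral {a..a + real N} F"
      by (intro integral_subset_le i) (auto intro: F)
    moreover have "integral {a..a + real k * h} F \<ge> 0" by (intro integral_nonneg i F)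
    ultimately have "integral {a..a + real k * h} F / (real k * h) \<le> integral {a..a + real N} F / h"
      using k h by (intro frac_le) auto
    from mult_left_mono[OF this, of "real (N choose k)"]
    show "\<bar>(- 1) ^ k * real (N choose k) * (integral {a..a + real k * h} F / (real k * h))\<bar>
        \<le> real (N choose k) * (integral {a..a + real N} F / h)"
      using h \<open>integral {a..a + real k * h} F \<ge> 0\<close> by (simp add: abs_mult power_abs)
  qed
  also have "\<dots> \<le> (\<Sum>k\<le>N. real (N choose k) * (integral {a..a + real N} F / h))"
    using I0 h by (intro sum_mono2) auto
  also have "\<dots> = 2 ^ N * (integral {a..a + real N} F / h)"
    by (simp only: sum_distrib_right[symmetric] of_nat_sum[symmetric] choose_row_sum) simp
  finally show ?thesis by simp
qed

text \<open>Each summand is a genuine mean, so the supremum bound carries no factor 1 / h.\<close>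

lemma abs_smooth_avg_le_sup:
  assumes F: "continuous_on UNIV F" "\<And>x. 0 \<le> F x" "\<And>x. F x \<le> B" and h: "0 < h" "h \<le> 1"
  shows "\<bar>smooth_avg N h F a\<bar> \<le> 2 ^ N * B"
proof -
  have B0: "B \<ge> 0" using F(2,3) order_trans by blast
  have i: "F integrable_on {x..y}" for x y
    by (intro integrable_continuous_real continuous_on_subset[OF F(1)]) auto
  have "\<bar>smooth_avg N h F a\<bar> \<le> (\<Sum>k=1..N. \<bar>(- 1) ^ k * real (N choose k) * (integral {a..a + real k * h} F / (real k * h))\<bar>)"
    unfolding smooth_avg_def abs_minus_cancel by (rule sum_abs)
  also have "\<dots> \<le> (\<Sum>k=1..N. real (N choose k) * B)"
  proof (intro sum_mono)
    fix k assume k: "k \<in> {1..N}"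
    have kh: "real k * h > 0" using k h by simp
    have I0: "integral {a..a + real k * h} F \<ge> 0" by (intro integral_nonneg i F)
    have "integral {a..a + real k * h} F \<le> integral {a..a + real k * h} (\<lambda>_. B)"
      by (intro integral_le i F) auto
    also have "\<dots> = real k * h * B" using kh by simp
    finally have "integral {a..a + real k * h} F / (real k * h) \<le> B"
      using kh by (simp add: divide_le_eq mult.commute)
    from mult_left_mono[OF this, of "real (N choose k)"]
    show "\<bar>(- 1) ^ k * real (N choose k) * (integral {a..a + real k * h} F / (real k * h))\<bar> \<le> real (N choose k) * B"
      using h I0 by (simp add: abs_mult power_abs)
  qed
  also have "\<dots> \<le> (\<Sum>k\<le>N. real (N choose k) * B)"
    using B0 by (intro sum_mono2) auto
  also have "\<dots> = 2 ^ N * B"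
    by (simp only: sum_distrib_right[symmetric] of_nat_sum[symmetric] choose_row_sum) simp
  finally show ?thesis .
qed

context sphere_measure
begin

subsection \<open>Weak type bounds\<close>

abbreviation near :: "real \<Rightarrow> 'a \<Rightarrow> 'a \<Rightarrow> ennreal" where
  "near \<epsilon> y z \<equiv> (if dist y z < \<epsilon> then 1 else 0)"

text \<open>The measure of \<open>ball y \<epsilon>\<close> under the image of \<open>ds \<otimes> \<sigma>\<close> by \<open>(s, u) \<mapsto> exp s u\<close>; it is invariant under
  rotations and dilations.\<close>
definition cone_ball :: "'a \<Rightarrow> real \<Rightarrow> ennreal" where
  "cone_ball y \<epsilon> = (\<integral>\<^sup>+s. \<integral>\<^sup>+u. near \<epsilon> y (exp s *\<^sub>R u) \<partial>\<sigma> \<partial>lborel)"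

text \<open>A rotation takes the pole to the direction of y, and a translation of s by ln (norm y)
  undoes the remaining dilation.\<close>

lemma cone_ball_eq:
  assumes y: "y \<noteq> 0"
  shows "cone_ball y \<epsilon> = cone_ball pole (\<epsilon> / norm y)"
proof -
  have "norm pole = norm (y /\<^sub>R norm y)" using y pole_Basis by simp
  then obtain T where T: "orthogonal_transformation T" "T pole = y /\<^sub>R norm y"
    by (rule orthogonal_transformation_exists_euclidean)
  have lin: "linear T" using T(1) by (rule orthogonal_transformation_linear)
  have ny: "norm y > 0" using y by simp
  have eq: "near \<epsilon> y (exp s *\<^sub>R T u) = near (\<epsilon> / norm y) pole (exp (s - ln (norm y)) *\<^sub>R u)" for s u
  proof -
    have "y = T (norm y *\<^sub>R pole)" using T(2) ny by (simp add: linear_scale[OF lin])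
    then have "dist y (exp s *\<^sub>R T u) = norm (T (norm y *\<^sub>R pole - exp s *\<^sub>R u))"
      by (metis dist_norm lin linear_diff linear_scale)
    also have "\<dots> = norm (norm y *\<^sub>R pole - exp s *\<^sub>R u)" using T(1) by (rule orthogonal_transformation_norm)
    also have "norm y *\<^sub>R pole - exp s *\<^sub>R u = norm y *\<^sub>R (pole - exp (s - ln (norm y)) *\<^sub>R u)"
      using ny by (simp add: exp_diff scaleR_diff_right)
    also have "norm \<dots> = norm y * dist pole (exp (s - ln (norm y)) *\<^sub>R u)" by (simp add: dist_norm)
    finally show ?thesis using ny by (simp add: indicator_def field_simps)
  qed
  have "cone_ball y \<epsilon> = (\<integral>\<^sup>+s. \<integral>\<^sup>+u. near \<epsilon> y (exp s *\<^sub>R T u) \<partial>\<sigma> \<partial>lborel)"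
    unfolding cone_ball_def
    by (rule nn_integral_cong, rule nn_integral_invariant[OF T(1), symmetric]) measurable
  also have "\<dots> = (\<integral>\<^sup>+s. \<integral>\<^sup>+u. near (\<epsilon> / norm y) pole (exp (s - ln (norm y)) *\<^sub>R u) \<partial>\<sigma> \<partial>lborel)"
    by (simp only: eq)
  also have "\<dots> = cone_ball pole (\<epsilon> / norm y)"
    unfolding cone_ball_def
    by (subst (2) nn_integral_real_affine[where c=1 and t="- ln (norm y)"]) (auto simp: algebra_simps)
  finally show ?thesis .
qed

lemma cone_ball_mono: "\<epsilon> \<le> \<delta> \<Longrightarrow> cone_ball y \<epsilon> \<le> cone_ball y \<delta>"
  unfolding cone_ball_def by (intro nn_integral_mono) auto

text \<open>The bridge between \<open>cone_ball\<close> and averages of k over small balls centred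
  at the points \<open>exp s *\<^sub>R u\<close>.\<close>

lemma cone_ball_Fubini:
  assumes [measurable]: "k \<in> borel_measurable borel"
  shows "(\<integral>\<^sup>+y. k y * cone_ball y \<epsilon> \<partial>lborel)
       = (\<integral>\<^sup>+s. \<integral>\<^sup>+u. \<integral>\<^sup>+y. k y * indicator (ball (exp s *\<^sub>R u) \<epsilon>) y \<partial>lborel \<partial>\<sigma> \<partial>lborel)"
proof -
  interpret B: pair_sigma_finite \<sigma> "lborel :: 'a measure" ..
  have "(\<integral>\<^sup>+y. k y * cone_ball y \<epsilon> \<partial>lborel)
      = (\<integral>\<^sup>+y. \<integral>\<^sup>+s. \<integral>\<^sup>+u. k y * near \<epsilon> y (exp s *\<^sub>R u) \<partial>\<sigma> \<partial>lborel \<partial>lborel)"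
  proof (rule nn_integral_cong)
    fix y
    have "k y * cone_ball y \<epsilon> = (\<integral>\<^sup>+s. k y * (\<integral>\<^sup>+u. near \<epsilon> y (exp s *\<^sub>R u) \<partial>\<sigma>) \<partial>lborel)"
      unfolding cone_ball_def by (rule nn_integral_cmult[symmetric]) measurable
    also have "\<dots> = (\<integral>\<^sup>+s. \<integral>\<^sup>+u. k y * near \<epsilon> y (exp s *\<^sub>R u) \<partial>\<sigma> \<partial>lborel)"
      by (rule nn_integral_cong, rule nn_integral_cmult[symmetric]) measurable
    finally show "k y * cone_ball y \<epsilon> = (\<integral>\<^sup>+s. \<integral>\<^sup>+u. k y * near \<epsilon> y (exp s *\<^sub>R u) \<partial>\<sigma> \<partial>lborel)" .
  qed
  also have "\<dots> = (\<integral>\<^sup>+s. \<integral>\<^sup>+y. \<integral>\<^sup>+u. k y * near \<epsilon> y (exp s *\<^sub>R u) \<partial>\<sigma> \<partial>lborel \<partial>lborel)"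
    by (rule lborel_pair.Fubini') measurable
  also have "\<dots> = (\<integral>\<^sup>+s. \<integral>\<^sup>+u. \<integral>\<^sup>+y. k y * near \<epsilon> y (exp s *\<^sub>R u) \<partial>lborel \<partial>\<sigma> \<partial>lborel)"
    by (rule nn_integral_cong, rule B.Fubini') measurable
  also have "\<dots> = (\<integral>\<^sup>+s. \<integral>\<^sup>+u. \<integral>\<^sup>+y. k y * indicator (ball (exp s *\<^sub>R u) \<epsilon>) y \<partial>lborel \<partial>\<sigma> \<partial>lborel)"
    by (simp add: indicator_def dist_commute of_bool_def)
  finally show ?thesis .
qed

text \<open>Spherical caps are not measured; the value at the pole is compared with an average over
  Q. There scaling bounds it by \<open>cone_ball y (2 * \<epsilon>)\<close>, and by Fubini the
  integral of the latter is at most the volume of a ball of radius 2 \<epsilon> times the mass of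
  the pairs (s, u) that come near Q. Division by the volume of Q leaves the power of
  \<epsilon>.\<close>

lemma cone_ball_pole_le:
  assumes \<epsilon>: "0 < \<epsilon>" "\<epsilon> \<le> 1 / 4"
  shows "cone_ball pole \<epsilon> \<le> ennreal (2 * (4 * \<epsilon>) ^ DIM('a))"
proof -
  define v where "v = unit_ball_vol (real DIM('a))"
  have v: "v > 0" by (simp add: v_def)
  have bl: "emeasure lborel (ball x r) = ennreal (v * r ^ DIM('a))" if "r > 0" for x :: 'a and r
    using that by (simp add: emeasure_ball v_def)
  \<comment> \<open>A ball on which norms lie between 1 and 2, so that
    \<open>\<epsilon> \<le> 2 * \<epsilon> / norm y\<close>.\<close>
  define Q where "Q = ball ((3 / 2) *\<^sub>R pole) (1 / 2 :: real)"
  have [measurable]: "Q \<in> sets borel" by (simp add: Q_def)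
  have Q: "1 \<le> norm y" "norm y \<le> 2" if "y \<in> Q" for y
  proof -
    have *: "norm ((3 / 2) *\<^sub>R pole - y) < 1 / 2" using that by (simp add: Q_def dist_norm)
    have p: "norm ((3 / 2) *\<^sub>R pole) = 3 / 2" using pole_Basis by simp
    show "1 \<le> norm y" "norm y \<le> 2"
      using norm_triangle_ineq2[of "(3 / 2) *\<^sub>R pole" y] norm_triangle_ineq3[of "(3 / 2) *\<^sub>R pole" y] * p by linarith+
  qed
  have "cone_ball pole \<epsilon> * emeasure lborel Q = (\<integral>\<^sup>+y. indicator Q y * cone_ball pole \<epsilon> \<partial>lborel)"
    by (subst nn_integral_multc) (auto simp: mult.commute)
  also have "\<dots> \<le> (\<integral>\<^sup>+y. indicator Q y * cone_ball y (2 * \<epsilon>) \<partial>lborel)"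
  proof (intro nn_integral_mono)
    fix y :: 'a
    show "indicator Q y * cone_ball pole \<epsilon> \<le> indicator Q y * cone_ball y (2 * \<epsilon>)"
    proof (cases "y \<in> Q")
      case True
      have y0: "norm y > 0" using Q(1)[OF True] by linarith
      then have "\<epsilon> \<le> 2 * \<epsilon> / norm y" using Q(2)[OF True] \<epsilon> by (simp add: pos_le_divide_eq)
      then have "cone_ball pole \<epsilon> \<le> cone_ball y (2 * \<epsilon>)"
        using y0 by (subst cone_ball_eq) (auto intro: cone_ball_mono)
      then show ?thesis by (rule mult_left_mono) simp
    qed simp
  qed
  also have "\<dots> = (\<integral>\<^sup>+s. \<integral>\<^sup>+u. \<integral>\<^sup>+y. indicator Q y * indicator (ball (exp s *\<^sub>R u) (2 * \<epsilon>)) y \<partial>lborel \<partial>\<sigma> \<partial>lborel)"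
    by (rule cone_ball_Fubini) measurable
  also have "\<dots> \<le> (\<integral>\<^sup>+s. \<integral>\<^sup>+u. indicator {-1..1::real} s * ennreal (v * (2 * \<epsilon>) ^ DIM('a)) \<partial>\<sigma> \<partial>lborel)"
  proof -
    have AE: "AE u in \<sigma>. (\<integral>\<^sup>+y. indicator Q y * indicator (ball (exp s *\<^sub>R u) (2 * \<epsilon>)) y \<partial>lborel)
       \<le> indicator {-1..1::real} s * ennreal (v * (2 * \<epsilon>) ^ DIM('a))" for s :: real
      using unit
    proof eventually_elim
      case (elim u)
      show ?case
      proof (cases "s \<in> {-1..1}")
        case True
        have "(\<integral>\<^sup>+y. indicator Q y * indicator (ball (exp s *\<^sub>R u) (2 * \<epsilon>)) y \<partial>lborel)
           \<le> (\<integral>\<^sup>+y. indicator (ball (exp s *\<^sub>R u) (2 * \<epsilon>)) y \<partial>lborel)"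
          by (intro nn_integral_mono) (auto simp: indicator_def)
        also have "\<dots> = ennreal (v * (2 * \<epsilon>) ^ DIM('a))" using \<epsilon> by (simp add: bl)
        finally show ?thesis using True by simp
      next
        case False
        have z: "indicator Q y * indicator (ball (exp s *\<^sub>R u) (2 * \<epsilon>)) y = (0 :: ennreal)" for y
        proof (rule ccontr)
          assume "\<not> ?thesis"
          then have y: "y \<in> Q" "norm (exp s *\<^sub>R u - y) < 2 * \<epsilon>"
            by (auto simp: indicator_def dist_norm split: if_splits)
          have nu: "norm (exp s *\<^sub>R u) = exp s" using elim by simp
          \<comment> \<open>As 2 \<epsilon> \<le> 1/2, coming near Q forces exp s to lie between 1/2
            and 5/2 \<le> e, so |s| < 1, contrary to the case assumption.\<close>
          have "exp s < 5 / 2" "exp s > 1 / 2"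
            using norm_triangle_ineq2[of "exp s *\<^sub>R u" y] norm_triangle_ineq3[of "exp s *\<^sub>R u" y] y(2) nu Q[OF y(1)] \<epsilon>
            by linarith+
          moreover have e: "5 / 2 \<le> exp (1 :: real)"
            using exp_lower_Taylor_quadratic[of "1 :: real"] by simp
          moreover have "exp (- s) < 2"
            using \<open>exp s > 1 / 2\<close> by (simp add: exp_minus field_simps)
          ultimately have "exp s < exp 1" "exp (- s) < exp 1" by linarith+
          then show False using False by auto
        qed
        show ?thesis by (simp only: z nn_integral_const mult_zero_left zero_le)
      qed
    qed
    show ?thesis by (rule nn_integral_mono) (rule nn_integral_mono_AE[OF AE])
  qed
  also have "\<dots> = (\<integral>\<^sup>+s. indicator {-1..1::real} s * (ennreal (v * (2 * \<epsilon>) ^ DIM('a)) * emeasure \<sigma> UNIV) \<partial>lborel)"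
    by (simp add: mult_ac)
  also have "\<dots> \<le> (\<integral>\<^sup>+s. indicator {-1..1::real} s * (ennreal (v * (2 * \<epsilon>) ^ DIM('a)) * 1) \<partial>lborel)"
    by (intro nn_integral_mono mult_left_mono mass) auto
  also have "\<dots> = ennreal 2 * ennreal (v * (2 * \<epsilon>) ^ DIM('a))"
    by (subst nn_integral_multc) auto
  also have "\<dots> = ennreal (2 * (4 * \<epsilon>) ^ DIM('a)) * ennreal (v * (1 / 2) ^ DIM('a))"
  proof -
    have "(4 * \<epsilon>) ^ DIM('a) * (1 / 2) ^ DIM('a) = (4 * \<epsilon> * (1 / 2)) ^ DIM('a)"
      by (rule power_mult_distrib[symmetric])
    also have "4 * \<epsilon> * (1 / 2) = 2 * \<epsilon>" by simp
    finally have eq: "(4 * \<epsilon>) ^ DIM('a) * (1 / 2) ^ DIM('a) = (2 * \<epsilon>) ^ DIM('a)" .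
    have "2 * (v * (2 * \<epsilon>) ^ DIM('a)) = 2 * (4 * \<epsilon>) ^ DIM('a) * (v * (1 / 2) ^ DIM('a))"
      unfolding eq[symmetric] by (simp only: mult_ac)
    then have "ennreal (2 * (v * (2 * \<epsilon>) ^ DIM('a))) = ennreal (2 * (4 * \<epsilon>) ^ DIM('a) * (v * (1 / 2) ^ DIM('a)))"
      by (simp only:)
    then show ?thesis using v \<epsilon> by (subst (1 2) ennreal_mult[symmetric]) auto
  qed
  also have "ennreal (v * (1 / 2) ^ DIM('a)) = emeasure lborel Q" by (simp add: Q_def bl)
  finally have *: "cone_ball pole \<epsilon> * emeasure lborel Q \<le> ennreal (2 * (4 * \<epsilon>) ^ DIM('a)) * emeasure lborel Q" .
  then have "emeasure lborel Q * cone_ball pole \<epsilon> \<le> emeasure lborel Q * ennreal (2 * (4 * \<epsilon>) ^ DIM('a))"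
    by (simp only: mult.commute)
  moreover have "emeasure lborel Q \<noteq> 0" "emeasure lborel Q \<noteq> top" using v by (auto simp: Q_def bl)
  ultimately show ?thesis by (simp only: ennreal_mult_le_mult_iff not_False_eq_True)
qed

text \<open>Averages over shrinking balls recover a continuous function, so the bound on \<open>cone_ball\<close> says that
  the image of \<open>ds \<otimes> \<sigma>\<close> has bounded density on annuli.\<close>
lemma cone_density:
  obtains C R where "C > 0" "R > 0"
    "\<And>\<phi> :: 'a \<Rightarrow> real. continuous_on UNIV \<phi> \<Longrightarrow> (\<And>y. \<phi> y \<ge> 0) \<Longrightarrow>
      (\<integral>\<^sup>+s. indicator {0..real N} s * (\<integral>\<^sup>+u. ennreal (\<phi> (exp s *\<^sub>R u)) \<partial>\<sigma>) \<partial>lborel)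
        \<le> ennreal C * (\<integral>\<^sup>+y. ennreal (\<phi> y) * indicator (cball 0 R) y \<partial>lborel)"
proof -
  define v where "v = unit_ball_vol (real DIM('a))"
  have v: "v > 0" by (simp add: v_def)
  have bl: "emeasure lborel (ball x r) = ennreal (v * r ^ DIM('a))" if "r > 0" for x :: 'a and r
    using that by (simp add: emeasure_ball v_def)
  \<comment> \<open>The points exp s u with s in \<open>[0, N]\<close> have norm at most exp N; the
    1 leaves room for the small balls around them.\<close>
  define R where "R = exp (real N) + 1"
  have R: "R > 0" by (simp add: R_def add_pos_pos)
  \<comment> \<open>For |y| \<ge> 1/2, \<open>cone_ball y \<epsilon>\<close> is at most
    \<open>cone_ball pole (2 * \<epsilon>)\<close>, hence at most 2 (8 \<epsilon>)^d; division by
    the volume v \<epsilon>^d of a ball leaves C.\<close>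
  define C where "C = 2 * 8 ^ DIM('a) / v"
  have C: "C > 0" using v by (simp add: C_def)
  show thesis
  proof (rule that[OF C R])
    fix \<phi> :: "'a \<Rightarrow> real"
    assume cont: "continuous_on UNIV \<phi>" and pos: "\<And>y. \<phi> y \<ge> 0"
    have [measurable]: "\<phi> \<in> borel_measurable borel" using cont by (rule borel_measurable_continuous_onI)
    let ?L = "\<integral>\<^sup>+s. indicator {0..real N} s * (\<integral>\<^sup>+u. ennreal (\<phi> (exp s *\<^sub>R u)) \<partial>\<sigma>) \<partial>lborel"
    let ?I = "\<integral>\<^sup>+y. ennreal (\<phi> y) * indicator (cball 0 R) y \<partial>lborel"
    have vR: "emeasure lborel (cball (0 :: 'a) R) = ennreal (v * R ^ DIM('a))"
      using R by (simp add: emeasure_cball v_def)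
    have step: "?L \<le> ennreal C * ?I + ennreal (C * (v * R ^ DIM('a)) * \<eta>)" if \<eta>: "\<eta> > 0" for \<eta>
    proof -
      have "uniformly_continuous_on (cball 0 R) \<phi>"
        by (intro compact_uniformly_continuous continuous_on_subset[OF cont]) auto
      then obtain \<delta> where \<delta>: "\<delta> > 0" "\<And>x y. x \<in> cball 0 R \<Longrightarrow> y \<in> cball 0 R \<Longrightarrow> dist y x < \<delta> \<Longrightarrow> dist (\<phi> y) (\<phi> x) < \<eta>"
        unfolding uniformly_continuous_on_def using \<eta> by meson
      define \<epsilon> where "\<epsilon> = min \<delta> (1 / 8)"
      have \<epsilon>: "0 < \<epsilon>" "\<epsilon> \<le> 1 / 8" "\<epsilon> \<le> \<delta>" using \<delta>(1) by (auto simp: \<epsilon>_def)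
      define S where "S = {y :: 'a. 1 / 2 \<le> norm y \<and> norm y \<le> R}"
      have [measurable]: "S \<in> sets borel" unfolding S_def by measurable
      define k where "k y = indicator S y * ennreal (\<phi> y + \<eta>)" for y
      have [measurable]: "k \<in> borel_measurable borel" unfolding k_def[abs_def] by measurable
      have "ennreal (v * \<epsilon> ^ DIM('a)) * ?L
          = (\<integral>\<^sup>+s. \<integral>\<^sup>+u. indicator {0..real N} s * (ennreal (v * \<epsilon> ^ DIM('a)) * ennreal (\<phi> (exp s *\<^sub>R u))) \<partial>\<sigma> \<partial>lborel)"
        by (simp add: nn_integral_cmult mult_ac flip: nn_integral_cmult)
      also have "\<dots> \<le> (\<integral>\<^sup>+s. \<integral>\<^sup>+u. \<integral>\<^sup>+y. k y * indicator (ball (exp s *\<^sub>R u) \<epsilon>) y \<partial>lborel \<partial>\<sigma> \<partial>lborel)"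
      proof (rule nn_integral_mono, rule nn_integral_mono_AE)
        fix s :: real
        show "AE u in \<sigma>. indicator {0..real N} s * (ennreal (v * \<epsilon> ^ DIM('a)) * ennreal (\<phi> (exp s *\<^sub>R u)))
          \<le> (\<integral>\<^sup>+y. k y * indicator (ball (exp s *\<^sub>R u) \<epsilon>) y \<partial>lborel)"
          using unit
        proof eventually_elim
          case (elim u)
          show ?case
          proof (cases "s \<in> {0..real N}")
            case True
            let ?z = "exp s *\<^sub>R u"
            have z: "1 \<le> norm ?z" "norm ?z \<le> exp (real N)" using True elim by auto
            have in_ball: "y \<in> S \<and> \<phi> ?z \<le> \<phi> y + \<eta>" if y: "y \<in> ball ?z \<epsilon>" for y
            proof -
              have d: "norm (?z - y) < \<epsilon>" using y by (simp add: dist_norm)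
              have n: "1 / 2 \<le> norm y" "norm y \<le> R"
                using norm_triangle_ineq2[of ?z y] norm_triangle_ineq3[of ?z y] d z \<epsilon> unfolding R_def by linarith+
              have "dist (\<phi> ?z) (\<phi> y) < \<eta>"
                using n z d \<epsilon> by (intro \<delta>(2)) (auto simp: R_def dist_norm)
              then show ?thesis using n by (auto simp: S_def dist_real_def)
            qed
            have "ennreal (v * \<epsilon> ^ DIM('a)) * ennreal (\<phi> ?z) = (\<integral>\<^sup>+y. ennreal (\<phi> ?z) * indicator (ball ?z \<epsilon>) y \<partial>lborel)"
              using \<epsilon> by (simp add: nn_integral_cmult_indicator bl mult.commute)
            also have "\<dots> \<le> (\<integral>\<^sup>+y. k y * indicator (ball ?z \<epsilon>) y \<partial>lborel)"
            proof (intro nn_integral_mono)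
              fix y
              show "ennreal (\<phi> ?z) * indicator (ball ?z \<epsilon>) y \<le> k y * indicator (ball ?z \<epsilon>) y"
                using in_ball[of y] by (cases "y \<in> ball ?z \<epsilon>") (auto simp: k_def intro: ennreal_leI)
            qed
            finally show ?thesis using True by simp
          qed simp
        qed
      qed
      also have "\<dots> = (\<integral>\<^sup>+y. k y * cone_ball y \<epsilon> \<partial>lborel)"
        by (rule cone_ball_Fubini[symmetric]) measurable
      also have "\<dots> \<le> (\<integral>\<^sup>+y. ennreal (2 * (8 * \<epsilon>) ^ DIM('a)) * ((ennreal (\<phi> y) + ennreal \<eta>) * indicator (cball 0 R) y) \<partial>lborel)"
      proof (intro nn_integral_mono)
        fix y :: 'a
        show "k y * cone_ball y \<epsilon> \<le> ennreal (2 * (8 * \<epsilon>) ^ DIM('a)) * ((ennreal (\<phi> y) + ennreal \<eta>) * indicator (cball 0 R) y)"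
        proof (cases "y \<in> S")
          case True
          then have y: "norm y \<ge> 1 / 2" "norm y \<le> R" by (auto simp: S_def)
          have y0: "norm y > 0" using y by linarith
          then have "y \<noteq> 0" by auto
          then have "cone_ball y \<epsilon> = cone_ball pole (\<epsilon> / norm y)" by (rule cone_ball_eq)
          also have "\<dots> \<le> cone_ball pole (2 * \<epsilon>)"
          proof (rule cone_ball_mono)
            have "\<epsilon> * 1 \<le> \<epsilon> * (2 * norm y)" using y \<epsilon> by (intro mult_left_mono) auto
            then show "\<epsilon> / norm y \<le> 2 * \<epsilon>" using y0 by (simp add: pos_divide_le_eq mult_ac)
          qed
          also have "\<dots> \<le> ennreal (2 * (4 * (2 * \<epsilon>)) ^ DIM('a))" using \<epsilon> by (intro cone_ball_pole_le) auto
          finally have "cone_ball y \<epsilon> \<le> ennreal (2 * (8 * \<epsilon>) ^ DIM('a))" by simp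
          then have "ennreal (\<phi> y + \<eta>) * cone_ball y \<epsilon> \<le> ennreal (\<phi> y + \<eta>) * ennreal (2 * (8 * \<epsilon>) ^ DIM('a))"
            by (rule mult_left_mono) simp
          then show ?thesis using True y pos[of y] \<eta> by (simp add: k_def ennreal_plus mult.commute)
        qed (simp add: k_def)
      qed
      also have "\<dots> = ennreal (2 * (8 * \<epsilon>) ^ DIM('a)) * (?I + ennreal \<eta> * emeasure lborel (cball (0 :: 'a) R))"
        by (simp add: nn_integral_cmult nn_integral_add distrib_right nn_integral_cmult_indicator)
      also have "\<dots> = ennreal (v * \<epsilon> ^ DIM('a)) * (ennreal C * (?I + ennreal \<eta> * ennreal (v * R ^ DIM('a))))"
      proof -
        have "2 * (8 * \<epsilon>) ^ DIM('a) = v * \<epsilon> ^ DIM('a) * C" using v by (simp add: C_def power_mult_distrib)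
        then have "ennreal (2 * (8 * \<epsilon>) ^ DIM('a)) = ennreal (v * \<epsilon> ^ DIM('a)) * ennreal C"
          using v \<epsilon> C by (simp only: ennreal_mult[symmetric] mult_nonneg_nonneg less_imp_le zero_le_power)
        then show ?thesis by (simp only: vR mult.assoc)
      qed
      finally have "ennreal (v * \<epsilon> ^ DIM('a)) * ?L \<le> ennreal (v * \<epsilon> ^ DIM('a)) * (ennreal C * (?I + ennreal \<eta> * ennreal (v * R ^ DIM('a))))" .
      then have "?L \<le> ennreal C * (?I + ennreal \<eta> * ennreal (v * R ^ DIM('a)))"
        using v \<epsilon> by (subst (asm) ennreal_mult_le_mult_iff) auto
      also have "\<dots> = ennreal C * ?I + ennreal (C * (v * R ^ DIM('a)) * \<eta>)"
        using v C \<eta> R by (simp add: distrib_left ennreal_mult mult_ac)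
      finally show ?thesis .
    qed
    show "?L \<le> ennreal C * ?I"
    proof (rule ennreal_le_epsilon)
      fix e :: real assume e: "e > 0"
      define K where "K = C * (v * R ^ DIM('a))"
      have K: "K > 0" using C v R by (simp add: K_def)
      from step[of "e / K"] show "?L \<le> ennreal C * ?I + ennreal e"
        using e K unfolding K_def[symmetric] by simp
    qed
  qed
qed

text \<open>A mean over a window of fixed length in \<open>a\<close> thickens the sphere to an
  annulus, so by \<open>cone_density\<close> it is dominated by the ordinary mean over the ball of
  radius \<open>exp a * R\<close>. The Hardy-Littlewood bound then covers all radii at once.\<close>

lemma smooth_avg_weak_L1:
  obtains C where "C > 0"
    "\<And>g h \<mu>. tame g \<Longrightarrow> (\<And>x. g x \<ge> 0) \<Longrightarrow> 0 < h \<Longrightarrow> h \<le> 1 \<Longrightarrow> \<mu> > 0 \<Longrightarrow>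
      outer_le {x. \<exists>a. \<bar>smooth_avg N h (log_mean g x) a\<bar> > \<mu>} (ennreal (C / (h * \<mu>)) * (\<integral>\<^sup>+x. ennreal (g x) \<partial>lborel))"
proof -
  obtain C0 R where C0: "C0 > 0" and R: "R > 0" and dens:
    "\<And>\<phi> :: 'a \<Rightarrow> real. continuous_on UNIV \<phi> \<Longrightarrow> (\<And>y. \<phi> y \<ge> 0) \<Longrightarrow>
      (\<integral>\<^sup>+s. indicator {0..real N} s * (\<integral>\<^sup>+u. ennreal (\<phi> (exp s *\<^sub>R u)) \<partial>\<sigma>) \<partial>lborel)
        \<le> ennreal C0 * (\<integral>\<^sup>+y. ennreal (\<phi> y) * indicator (cball 0 R) y \<partial>lborel)"
    using cone_density[of N] by blast
  define v where "v = unit_ball_vol (real DIM('a))"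
  have v: "v > 0" by (simp add: v_def)
  define C1 where "C1 = 2 ^ N * C0 * v * R ^ DIM('a)"
  have C1: "C1 > 0" using v C0 R by (simp add: C1_def)
  show thesis
  proof (rule that[of "5 ^ DIM('a) * C1"])
    show "5 ^ DIM('a) * C1 > 0" using C1 by simp
    fix g :: "'a \<Rightarrow> real" and h \<mu> :: real
    assume g: "tame g" and g0: "\<And>x. g x \<ge> 0" and h: "0 < h" "h \<le> 1" and \<mu>: "\<mu> > 0"
    note [measurable] = tame_measurable[OF g]
    have bound: "ennreal \<bar>smooth_avg N h (log_mean g x) a\<bar>
        \<le> ennreal (2 ^ N * C0 / h) * (ennreal (exp (- a) ^ DIM('a)) * (\<integral>\<^sup>+y. ennreal (g y) * indicator (cball x (exp a * R)) y \<partial>lborel))" for x a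
    proof -
      have c: "continuous_on UNIV (log_mean g x)" by (rule continuous_log_mean_snd[OF g])
      have p: "log_mean g x s \<ge> 0" for s by (rule log_mean_nonneg[OF g0])
      have [measurable]: "log_mean g x \<in> borel_measurable borel" by (rule borel_measurable_continuous_onI[OF c])
      have i: "log_mean g x integrable_on {a..a + real N}"
        by (intro integrable_continuous_real continuous_on_subset[OF c]) auto
      have "ennreal (integral {a..a + real N} (log_mean g x)) = (\<integral>\<^sup>+s. ennreal (log_mean g x s) * indicator {a..a + real N} s \<partial>lborel)"
        by (rule nn_integral_has_integral_lebesgue'[symmetric]) (use p i in auto)
      also have "\<dots> = (\<integral>\<^sup>+s. ennreal (log_mean g x (a + 1 * s)) * indicator {a..a + real N} (a + 1 * s) \<partial>lborel)"
        by (subst nn_integral_real_affine[where c=1 and t=a]) auto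
      also have "\<dots> = (\<integral>\<^sup>+s. indicator {0..real N} s * (\<integral>\<^sup>+u. ennreal (g (x - exp a *\<^sub>R (exp s *\<^sub>R u))) \<partial>\<sigma>) \<partial>lborel)"
      proof (rule nn_integral_cong)
        fix s :: real
        have "ennreal (log_mean g x (a + s)) = (\<integral>\<^sup>+u. ennreal (g (x - exp (a + s) *\<^sub>R u)) \<partial>\<sigma>)"
          unfolding log_mean_def
          by (rule nn_integral_eq_integral[symmetric]) (use integrable_translate[OF g] g0 in auto)
        then show "ennreal (log_mean g x (a + 1 * s)) * indicator {a..a + real N} (a + 1 * s)
           = indicator {0..real N} s * (\<integral>\<^sup>+u. ennreal (g (x - exp a *\<^sub>R (exp s *\<^sub>R u))) \<partial>\<sigma>)"
          by (simp add: exp_add indicator_def)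
      qed
      also have "\<dots> \<le> ennreal C0 * (\<integral>\<^sup>+y. ennreal (g (x - exp a *\<^sub>R y)) * indicator (cball 0 R) y \<partial>lborel)"
        by (rule dens) (auto intro!: continuous_on_compose2[OF tameD_continuous[OF g]] continuous_intros g0)
      also have "(\<integral>\<^sup>+y. ennreal (g (x - exp a *\<^sub>R y)) * indicator (cball 0 R) y \<partial>lborel)
         = ennreal (exp (- a) ^ DIM('a)) * (\<integral>\<^sup>+y. ennreal (g y) * indicator (cball x (exp a * R)) y \<partial>lborel)"
      proof -
        have af: "(\<integral>\<^sup>+y. ennreal (g y) * indicator (cball x (exp a * R)) y \<partial>lborel)
           = ennreal (\<bar>- exp a\<bar> ^ DIM('a)) * (\<integral>\<^sup>+y. ennreal (g (x + - exp a *\<^sub>R y)) * indicator (cball x (exp a * R)) (x + - exp a *\<^sub>R y) \<partial>lborel)"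
          by (rule nn_integral_affine_euclidean) auto
        have ind: "indicator (cball x (exp a * R)) (x + - exp a *\<^sub>R y) = (indicator (cball 0 R) y :: ennreal)" for y
          by (simp add: indicator_def dist_norm)
        have "ennreal (exp (- a) ^ DIM('a)) * (\<integral>\<^sup>+y. ennreal (g y) * indicator (cball x (exp a * R)) y \<partial>lborel)
           = (ennreal (exp (- a) ^ DIM('a)) * ennreal (exp a ^ DIM('a))) * (\<integral>\<^sup>+y. ennreal (g (x - exp a *\<^sub>R y)) * indicator (cball 0 R) y \<partial>lborel)"
          unfolding af ind by (simp add: mult.assoc)
        moreover have "ennreal (exp (- a) ^ DIM('a)) * ennreal (exp a ^ DIM('a)) = 1"
          by (simp add: ennreal_mult[symmetric] power_mult_distrib[symmetric] exp_add[symmetric])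
        ultimately show ?thesis by simp
      qed
      finally have I: "ennreal (integral {a..a + real N} (log_mean g x))
         \<le> ennreal C0 * (ennreal (exp (- a) ^ DIM('a)) * (\<integral>\<^sup>+y. ennreal (g y) * indicator (cball x (exp a * R)) y \<partial>lborel))" .
      have "ennreal \<bar>smooth_avg N h (log_mean g x) a\<bar> \<le> ennreal (2 ^ N / h * integral {a..a + real N} (log_mean g x))"
        by (intro ennreal_leI abs_smooth_avg_le c p h)
      also have "\<dots> = ennreal (2 ^ N / h) * ennreal (integral {a..a + real N} (log_mean g x))"
        using h by (intro ennreal_mult') auto
      also have "\<dots> \<le> ennreal (2 ^ N / h) * (ennreal C0 * (ennreal (exp (- a) ^ DIM('a)) * (\<integral>\<^sup>+y. ennreal (g y) * indicator (cball x (exp a * R)) y \<partial>lborel)))"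
        by (intro mult_left_mono I) simp
      also have "\<dots> = ennreal (2 ^ N * C0 / h) * (ennreal (exp (- a) ^ DIM('a)) * (\<integral>\<^sup>+y. ennreal (g y) * indicator (cball x (exp a * R)) y \<partial>lborel))"
      proof -
        have "ennreal (2 ^ N * C0 / h) = ennreal (2 ^ N / h) * ennreal C0"
          using h C0 by (simp add: ennreal_mult[symmetric])
        then show ?thesis by (simp only: mult.assoc)
      qed
      finally show ?thesis .
    qed
    define E where "E = {x. \<exists>a. \<bar>smooth_avg N h (log_mean g x) a\<bar> > \<mu>}"
    have gfin: "(\<integral>\<^sup>+x. ennreal (g x) \<partial>lborel) < \<infinity>"
      using tameD_integrable[OF g] g0 by (simp add: integrable_iff_bounded)
    have "outer_le E (ennreal (5 ^ DIM('a) / (h * \<mu> / C1)) * (\<integral>\<^sup>+x. ennreal (g x) \<partial>lborel))"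
    proof (rule hardy_littlewood_outer)
      show "h * \<mu> / C1 > 0" using h \<mu> C1 by simp
      fix x assume "x \<in> E"
      then obtain a where a: "\<bar>smooth_avg N h (log_mean g x) a\<bar> > \<mu>" by (auto simp: E_def)
      let ?I = "\<integral>\<^sup>+y. ennreal (g y) * indicator (cball x (exp a * R)) y \<partial>lborel"
      have "ennreal \<mu> \<le> ennreal \<bar>smooth_avg N h (log_mean g x) a\<bar>" using a by (intro ennreal_leI) simp
      also note bound
      finally have le: "ennreal \<mu> \<le> ennreal (2 ^ N * C0 / h) * (ennreal (exp (- a) ^ DIM('a)) * ?I)" .
      have "ennreal (h * \<mu> / C1) * emeasure lborel (cball x (exp a * R))
          = ennreal (h / (2 ^ N * C0) * exp a ^ DIM('a)) * ennreal \<mu>"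
      proof -
        have "emeasure lborel (cball x (exp a * R)) = ennreal (v * (exp a * R) ^ DIM('a))"
          using R by (simp add: emeasure_cball v_def)
        moreover have "h * \<mu> / C1 * (v * (exp a * R) ^ DIM('a)) = h / (2 ^ N * C0) * exp a ^ DIM('a) * \<mu>"
          using v R C0 by (simp add: C1_def power_mult_distrib)
        ultimately show ?thesis using h \<mu> C1 v R C0 by (simp only: ennreal_mult[symmetric]) (simp add: ennreal_mult[symmetric])
      qed
      also have "\<dots> \<le> ennreal (h / (2 ^ N * C0) * exp a ^ DIM('a)) * (ennreal (2 ^ N * C0 / h) * (ennreal (exp (- a) ^ DIM('a)) * ?I))"
        by (intro mult_left_mono le) simp
      also have "\<dots> = ennreal (h / (2 ^ N * C0) * exp a ^ DIM('a) * (2 ^ N * C0 / h) * exp (- a) ^ DIM('a)) * ?I"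
      proof -
        have "ennreal A * (ennreal B * (ennreal K * J)) = ennreal (A * B * K) * J"
          if "A \<ge> 0" "B \<ge> 0" "K \<ge> 0" for A B K :: real and J
          using that by (simp add: ennreal_mult mult.assoc)
        then show ?thesis using h C0 by simp
      qed
      also have "h / (2 ^ N * C0) * exp a ^ DIM('a) * (2 ^ N * C0 / h) * exp (- a) ^ DIM('a) = 1"
        using h C0 by (simp add: exp_minus power_inverse)
      finally show "\<exists>R>0. ennreal (h * \<mu> / C1) * emeasure lborel (cball x R) \<le> (\<integral>\<^sup>+y. ennreal (g y) * indicator (cball x R) y \<partial>lborel)"
        using R by (intro exI[of _ "exp a * R"]) simp
    qed (use gfin in auto)
    then show "outer_le {x. \<exists>a. \<bar>smooth_avg N h (log_mean g x) a\<bar> > \<mu>} (ennreal (5 ^ DIM('a) * C1 / (h * \<mu>)) * (\<integral>\<^sup>+x. ennreal (g x) \<partial>lborel))"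
      unfolding E_def using C1 by simp
  qed
qed

lemma measurable_log_mean_comp:
  assumes g: "tame g" and [measurable]: "p \<in> M \<rightarrow>\<^sub>M borel" "q \<in> M \<rightarrow>\<^sub>M borel"
  shows "(\<lambda>z. log_mean g (p z) (q z)) \<in> borel_measurable M"
proof -
  have "(\<lambda>z. (p z, q z)) \<in> M \<rightarrow>\<^sub>M borel \<Otimes>\<^sub>M borel" by measurable
  from measurable_compose[OF this measurable_log_mean[OF g]] show ?thesis by simp
qed

text \<open>Fubini moves b outermost; for each fixed step \<open>h * b\<close> the N-th difference
  is a shift combination with coefficients of sum 0, to which \<open>shift_sum_L2\<close> applies
  with the bound of \<open>multiplier_L2\<close>.\<close>

lemma remainder_L2:
  obtains C where "C > 0"
    "\<And>g h. tame g \<Longrightarrow> 0 < h \<Longrightarrow> h \<le> 1 \<Longrightarrow>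
      (\<integral>\<^sup>+x. \<integral>\<^sup>+a. \<integral>\<^sup>+b. ennreal ((fdiff DIM('a) (h * b) (log_mean g x) a)\<^sup>2) * indicator {0..1} b \<partial>lborel \<partial>lborel \<partial>lborel)
      \<le> ennreal (C * h ^ (DIM('a) - 1)) * (\<integral>\<^sup>+x. ennreal ((g x)\<^sup>2) \<partial>lborel)"
proof -
  obtain C where C: "C > 0"
    "\<And>b. 0 \<le> b \<Longrightarrow> b \<le> 1 \<Longrightarrow>
      (\<integral>\<^sup>+a. ennreal ((fdiff DIM('a) b log_multiplier a)\<^sup>2) \<partial>lborel) \<le> ennreal (C * b ^ (DIM('a) - 1))"
    using multiplier_L2 by metis
  show thesis
  proof (rule that[OF C(1)])
    fix g :: "'a \<Rightarrow> real" and h :: real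
    assume g: "tame g" and h: "0 < h" "h \<le> 1"
    let ?N = "DIM('a)"
    let ?f = "\<lambda>x a b. ennreal ((fdiff ?N (h * b) (log_mean g x) a)\<^sup>2) * indicator {0..1} b"
    note [measurable (raw)] = measurable_log_mean_comp[OF g]
    let ?I = "\<integral>\<^sup>+x. ennreal ((g x)\<^sup>2) \<partial>lborel"
    have "(\<integral>\<^sup>+x. \<integral>\<^sup>+a. \<integral>\<^sup>+b. ?f x a b \<partial>lborel \<partial>lborel \<partial>lborel) = (\<integral>\<^sup>+x. \<integral>\<^sup>+b. \<integral>\<^sup>+a. ?f x a b \<partial>lborel \<partial>lborel \<partial>lborel)"
      by (rule nn_integral_cong, rule lborel_pair.Fubini'[symmetric]) (unfold fdiff_def, measurable)
    also have "\<dots> = (\<integral>\<^sup>+b. \<integral>\<^sup>+x. \<integral>\<^sup>+a. ?f x a b \<partial>lborel \<partial>lborel \<partial>lborel)"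
      by (rule lborel_pair.Fubini'[symmetric]) (unfold fdiff_def, measurable)
    also have "\<dots> \<le> (\<integral>\<^sup>+b. ennreal (C * h ^ (?N - 1)) * ?I * indicator {0..1::real} b \<partial>lborel)"
    proof (rule nn_integral_mono)
      fix b :: real
      show "(\<integral>\<^sup>+x. \<integral>\<^sup>+a. ?f x a b \<partial>lborel \<partial>lborel) \<le> ennreal (C * h ^ (?N - 1)) * ?I * indicator {0..1::real} b"
      proof (cases "b \<in> {0..1}")
        case True
        have hb: "0 \<le> h * b" "h * b \<le> h" using True h by (auto simp: mult_left_le)
        have hb1: "h * b \<le> 1" using hb(2) h(2) by (rule order_trans)
        have ex: "fdiff ?N (h * b) F a = (\<Sum>i\<le>?N. ((- 1) ^ i * real (?N choose i)) * F (a + real i * (h * b)))" for F a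
          by (simp add: fdiff_def)
        have "(\<integral>\<^sup>+x. \<integral>\<^sup>+a. ennreal ((fdiff ?N (h * b) (log_mean g x) a)\<^sup>2) \<partial>lborel \<partial>lborel) \<le> ennreal (C * (h * b) ^ (?N - 1)) * ?I"
          unfolding ex
        proof (rule shift_sum_L2[OF g])
          show "(\<Sum>i\<le>?N. (- 1) ^ i * real (?N choose i)) = 0"
            using choose_alternating_sum[of ?N, where 'a=real] DIM_positive[where 'a='a] by simp
          show "(\<integral>\<^sup>+a. ennreal ((\<Sum>i\<le>?N. (- 1) ^ i * real (?N choose i) * log_multiplier (a + real i * (h * b)))\<^sup>2) \<partial>lborel)
            \<le> ennreal (C * (h * b) ^ (?N - 1))"
            unfolding ex[symmetric] by (rule C(2)[OF hb(1) hb1])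
        qed simp
        also have "\<dots> \<le> ennreal (C * h ^ (?N - 1)) * ?I"
          using hb C(1) by (intro mult_right_mono ennreal_leI mult_left_mono power_mono) auto
        finally show ?thesis using True by simp
      qed simp
    qed
    also have "\<dots> = ennreal (C * h ^ (?N - 1)) * ?I"
      by (subst nn_integral_cmult_indicator) auto
    finally show "(\<integral>\<^sup>+x. \<integral>\<^sup>+a. \<integral>\<^sup>+b. ?f x a b \<partial>lborel \<partial>lborel \<partial>lborel) \<le> ennreal (C * h ^ (?N - 1)) * ?I" .
  qed
qed

lemma derivative_L2:
  obtains C where "C > 0"
    "\<And>g h. tame g \<Longrightarrow> 0 < h \<Longrightarrow> h \<le> 1 \<Longrightarrow>
      (\<integral>\<^sup>+x. \<integral>\<^sup>+a. ennreal ((smooth_deriv DIM('a) (h / 2) (log_mean g x) a - smooth_deriv DIM('a) h (log_mean g x) a)\<^sup>2) \<partial>lborel \<partial>lborel)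
      \<le> ennreal (C * h ^ (DIM('a) - 3)) * (\<integral>\<^sup>+x. ennreal ((g x)\<^sup>2) \<partial>lborel)"
proof -
  obtain C where C: "C > 0"
    "\<And>h. 0 < h \<Longrightarrow> h \<le> 1 \<Longrightarrow>
      (\<integral>\<^sup>+a. ennreal ((smooth_deriv DIM('a) (h / 2) log_multiplier a - smooth_deriv DIM('a) h log_multiplier a)\<^sup>2) \<partial>lborel)
        \<le> ennreal (C * h ^ (DIM('a) - 3))"
    using multiplier_L2 by metis
  show thesis
  proof (rule that[OF C(1)])
    fix g :: "'a \<Rightarrow> real" and h :: real
    assume g: "tame g" and h: "0 < h" "h \<le> 1"
    let ?N = "DIM('a)"
    \<comment> \<open>In the index (k, \<beta>, \<gamma>), \<beta> tells the shifted value from the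
      value at \<open>a\<close>, and \<gamma> tells the step h / 2 from h. The coefficients for the
      two values of \<beta> are opposite, so the total is 0.\<close>
    define I where "I = {1..?N} \<times> (UNIV :: bool set) \<times> (UNIV :: bool set)"
    define e where "e k t = - ((- 1) ^ k * real (?N choose k) / (real k * t))" for k :: nat and t :: real
    define c where "c = (\<lambda>(k, \<beta>, \<gamma>). (if \<gamma> then e k (h / 2) else - e k h) * (if \<beta> then 1 else - 1))"
    define s where "s = (\<lambda>(k, \<beta>, \<gamma>). if \<beta> then real k * (if \<gamma> then h / 2 else h) else 0)"
    have I: "finite I" by (simp add: I_def)
    have sI: "(\<Sum>i\<in>I. F i) = (\<Sum>k=1..?N. F (k, True, True) + F (k, True, False) + (F (k, False, True) + F (k, False, False)))" for F :: "nat \<times> bool \<times> bool \<Rightarrow> real"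
      unfolding I_def sum.cartesian_product' UNIV_bool by (simp add: add_ac)
    have c0: "(\<Sum>i\<in>I. c i) = 0" unfolding sI by (simp add: c_def)
    have eq: "smooth_deriv ?N (h / 2) F a - smooth_deriv ?N h F a = (\<Sum>i\<in>I. c i * F (a + s i))" for F a
    proof -
      have sd: "smooth_deriv ?N t F a = (\<Sum>k=1..?N. e k t * (F (a + real k * t) - F a))" for t
        unfolding smooth_deriv_def e_def by (simp add: sum_negf)
      show ?thesis unfolding sI sd by (simp add: sum_subtractf[symmetric] c_def s_def algebra_simps)
    qed
    show "(\<integral>\<^sup>+x. \<integral>\<^sup>+a. ennreal ((smooth_deriv ?N (h / 2) (log_mean g x) a - smooth_deriv ?N h (log_mean g x) a)\<^sup>2) \<partial>lborel \<partial>lborel)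
      \<le> ennreal (C * h ^ (?N - 3)) * (\<integral>\<^sup>+x. ennreal ((g x)\<^sup>2) \<partial>lborel)"
      unfolding eq by (rule shift_sum_L2[OF g I c0]) (use C(2)[OF h] in \<open>simp only: eq\<close>)
  qed
qed

text \<open>\<open>sq_le_sobolev\<close> with \<rho> = 1 / h balances h^(d-1) for the difference
  against h^(d-3) for its derivative: both terms become h^(d-2). Chebyshev's inequality
  concludes.\<close>

lemma difference_weak_L2:
  obtains C where "C > 0"
    "\<And>g h \<mu>. tame g \<Longrightarrow> 0 < h \<Longrightarrow> h \<le> 1 \<Longrightarrow> \<mu> > 0 \<Longrightarrow>
      outer_le {x. \<exists>a. \<bar>smooth_avg DIM('a) (h / 2) (log_mean g x) a - smooth_avg DIM('a) h (log_mean g x) a\<bar> > \<mu>}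
        (ennreal (C * h ^ (DIM('a) - 2) / \<mu>\<^sup>2) * (\<integral>\<^sup>+x. ennreal ((g x)\<^sup>2) \<partial>lborel))"
proof -
  let ?N = "DIM('a)"
  obtain C1 where C1: "C1 > 0" "\<And>g h. tame g \<Longrightarrow> 0 < h \<Longrightarrow> h \<le> 1 \<Longrightarrow>
      (\<integral>\<^sup>+x. \<integral>\<^sup>+a. \<integral>\<^sup>+b. ennreal ((fdiff ?N (h * b) (log_mean g x) a)\<^sup>2) * indicator {0..1} b \<partial>lborel \<partial>lborel \<partial>lborel)
      \<le> ennreal (C1 * h ^ (?N - 1)) * (\<integral>\<^sup>+x. ennreal ((g x)\<^sup>2) \<partial>lborel)"
    using remainder_L2 by blast
  obtain C2 where C2: "C2 > 0" "\<And>g h. tame g \<Longrightarrow> 0 < h \<Longrightarrow> h \<le> 1 \<Longrightarrow>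
      (\<integral>\<^sup>+x. \<integral>\<^sup>+a. ennreal ((smooth_deriv ?N (h / 2) (log_mean g x) a - smooth_deriv ?N h (log_mean g x) a)\<^sup>2) \<partial>lborel \<partial>lborel)
      \<le> ennreal (C2 * h ^ (?N - 3)) * (\<integral>\<^sup>+x. ennreal ((g x)\<^sup>2) \<partial>lborel)"
    using derivative_L2 by blast
  obtain j where "DIM('a) = 3 + j" using le_Suc_ex[OF dim] by blast
  then have j: "?N - 1 = Suc (Suc j)" "?N - 2 = Suc j" "?N - 3 = j" by simp_all
  show thesis
  proof (rule that[of "4 * C1 + C2"])
    show "4 * C1 + C2 > 0" using C1 C2 by simp
    fix g :: "'a \<Rightarrow> real" and h \<mu> :: real
    assume g: "tame g" and h: "0 < h" "h \<le> 1" and \<mu>: "\<mu> > 0"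
    note [measurable (raw)] = measurable_log_mean_comp[OF g]
    let ?I = "\<integral>\<^sup>+x. ennreal ((g x)\<^sup>2) \<partial>lborel"
    define w where "w x a = smooth_avg ?N (h / 2) (log_mean g x) a - smooth_avg ?N h (log_mean g x) a" for x a
    define w' where "w' x a = smooth_deriv ?N (h / 2) (log_mean g x) a - smooth_deriv ?N h (log_mean g x) a" for x a
    define Q where "Q t x a = (\<integral>\<^sup>+b. ennreal ((fdiff ?N (t * b) (log_mean g x) a)\<^sup>2) * indicator {0..1} b \<partial>lborel)" for t x a
    have cont: "continuous_on UNIV (log_mean g x)" for x by (rule continuous_log_mean_snd[OF g])
    have [measurable]: "(\<lambda>(x, a). Q t x a) \<in> borel_measurable (borel \<Otimes>\<^sub>M borel)" for t
      unfolding Q_def fdiff_def by measurable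
    have [measurable]: "(\<lambda>(x, a). Q t x a) \<in> borel_measurable (borel \<Otimes>\<^sub>M lborel)" for t
      unfolding Q_def fdiff_def by measurable
    have [measurable]: "Q t x \<in> borel_measurable borel" for t x
      unfolding Q_def[abs_def] fdiff_def by measurable
    have [measurable]: "(\<lambda>(x, a). w' x a) \<in> borel_measurable (borel \<Otimes>\<^sub>M borel)"
      unfolding w'_def smooth_deriv_def by measurable
    have [measurable]: "(\<lambda>(x, a). w' x a) \<in> borel_measurable (borel \<Otimes>\<^sub>M lborel)"
      unfolding w'_def smooth_deriv_def by measurable
    \<comment> \<open>The mean itself cancels: w is the difference of the remainders at the scales h
      and h / 2, each an average of N-th differences.\<close>
    have wQ: "ennreal ((w x a)\<^sup>2) \<le> 2 * Q h x a + 2 * Q (h / 2) x a" for x a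
    proof -
      let ?A = "log_mean g x a - smooth_avg ?N h (log_mean g x) a"
      let ?B = "log_mean g x a - smooth_avg ?N (h / 2) (log_mean g x) a"
      have "w x a = ?A - ?B" by (simp add: w_def)
      then have "(w x a)\<^sup>2 = 2 * ?A\<^sup>2 + 2 * ?B\<^sup>2 - (?A + ?B)\<^sup>2"
        by (simp only: power2_eq_square) (simp add: algebra_simps)
      then have "(w x a)\<^sup>2 \<le> 2 * ?A\<^sup>2 + 2 * ?B\<^sup>2" by simp
      then have "ennreal ((w x a)\<^sup>2) \<le> ennreal (2 * ?A\<^sup>2 + 2 * ?B\<^sup>2)" by (rule ennreal_leI)
      also have "\<dots> = 2 * ennreal (?A\<^sup>2) + 2 * ennreal (?B\<^sup>2)" by (simp add: ennreal_mult)
      also have "\<dots> \<le> 2 * Q h x a + 2 * Q (h / 2) x a"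
        unfolding Q_def using h by (intro add_mono mult_left_mono smooth_avg_remainder_sq cont) auto
      finally show ?thesis .
    qed
    \<comment> \<open>A majorant of w^2 that is uniform in \<open>a\<close> and measurable in x; its
      level set contains the exceptional set.\<close>
    define \<Phi> where "\<Phi> x = ennreal (1 / h) * (\<integral>\<^sup>+a. 2 * Q h x a + 2 * Q (h / 2) x a \<partial>lborel)
        + ennreal h * (\<integral>\<^sup>+a. ennreal ((w' x a)\<^sup>2) \<partial>lborel)" for x
    have [measurable]: "\<Phi> \<in> borel_measurable borel" unfolding \<Phi>_def[abs_def] by measurable
    have w\<Phi>: "ennreal ((w x a)\<^sup>2) \<le> \<Phi> x" for x a
    proof -
      have "ennreal ((w x a)\<^sup>2) \<le> ennreal (1 / h) * (\<integral>\<^sup>+s. ennreal ((w x s)\<^sup>2) \<partial>lborel)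
        + ennreal (1 / (1 / h)) * (\<integral>\<^sup>+s. ennreal ((w' x s)\<^sup>2) \<partial>lborel)"
      proof (rule sq_le_sobolev)
        show "(w x has_real_derivative w' x s) (at s)" for s
          unfolding w_def[abs_def] w'_def using h by (intro DERIV_diff DERIV_smooth_avg cont) auto
        show "continuous_on UNIV (w' x)"
          unfolding w'_def[abs_def] smooth_deriv_def using h
          by (intro continuous_intros continuous_on_compose2[OF cont]) auto
      qed (use h in auto)
      also have "\<dots> \<le> \<Phi> x"
        unfolding \<Phi>_def using wQ by (intro add_mono mult_left_mono nn_integral_mono) auto
      finally show ?thesis .
    qed
    have "(\<integral>\<^sup>+x. \<Phi> x \<partial>lborel)
       = ennreal (1 / h) * (2 * (\<integral>\<^sup>+x. \<integral>\<^sup>+a. Q h x a \<partial>lborel \<partial>lborel) + 2 * (\<integral>\<^sup>+x. \<integral>\<^sup>+a. Q (h / 2) x a \<partial>lborel \<partial>lborel))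
        + ennreal h * (\<integral>\<^sup>+x. \<integral>\<^sup>+a. ennreal ((w' x a)\<^sup>2) \<partial>lborel \<partial>lborel)"
      unfolding \<Phi>_def by (simp add: nn_integral_add nn_integral_cmult)
    also have "\<dots> \<le> ennreal (1 / h) * (2 * (ennreal (C1 * h ^ (?N - 1)) * ?I) + 2 * (ennreal (C1 * h ^ (?N - 1)) * ?I))
        + ennreal h * (ennreal (C2 * h ^ (?N - 3)) * ?I)"
    proof (intro add_mono mult_left_mono)
      show "(\<integral>\<^sup>+x. \<integral>\<^sup>+a. Q h x a \<partial>lborel \<partial>lborel) \<le> ennreal (C1 * h ^ (?N - 1)) * ?I"
        unfolding Q_def by (rule C1(2)[OF g h])
      have "(\<integral>\<^sup>+x. \<integral>\<^sup>+a. Q (h / 2) x a \<partial>lborel \<partial>lborel) \<le> ennreal (C1 * (h / 2) ^ (?N - 1)) * ?I"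
        unfolding Q_def by (rule C1(2)[OF g]) (use h in auto)
      also have "\<dots> \<le> ennreal (C1 * h ^ (?N - 1)) * ?I"
        using C1(1) h by (intro mult_right_mono ennreal_leI mult_left_mono power_mono) auto
      finally show "(\<integral>\<^sup>+x. \<integral>\<^sup>+a. Q (h / 2) x a \<partial>lborel \<partial>lborel) \<le> ennreal (C1 * h ^ (?N - 1)) * ?I" .
      show "(\<integral>\<^sup>+x. \<integral>\<^sup>+a. ennreal ((w' x a)\<^sup>2) \<partial>lborel \<partial>lborel) \<le> ennreal (C2 * h ^ (?N - 3)) * ?I"
        unfolding w'_def by (rule C2(2)[OF g h])
    qed auto
    also have "\<dots> = ennreal ((4 * C1 + C2) * h ^ (?N - 2)) * ?I"
    proof -
      have 4: "2 * X + 2 * X = ennreal 4 * X" for X :: ennreal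
        by (simp add: distrib_right[symmetric])
      have "ennreal (1 / h) * (ennreal 4 * (ennreal (C1 * h ^ Suc (Suc j)) * ?I)) = ennreal (4 * C1 * h ^ Suc j) * ?I"
      proof -
        have "4 * C1 * h ^ Suc j = 1 / h * (4 * (C1 * h ^ Suc (Suc j)))" using h by simp
        moreover have "ennreal A * (ennreal 4 * (ennreal B * J)) = ennreal (A * (4 * B)) * J"
          if "A \<ge> 0" "B \<ge> 0" for A B :: real and J
          using that by (simp add: ennreal_mult mult.assoc)
        ultimately show ?thesis using h C1(1) by (simp add: mult.assoc)
      qed
      moreover have "ennreal h * (ennreal (C2 * h ^ j) * ?I) = ennreal (C2 * h ^ Suc j) * ?I"
      proof -
        have "C2 * h ^ Suc j = h * (C2 * h ^ j)" by simp
        then show ?thesis using h C2 by (simp only: ennreal_mult'[OF less_imp_le[OF h(1)]] mult.assoc)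
      qed
      ultimately show ?thesis unfolding j 4
        using h C1 C2 by (simp add: distrib_right ennreal_plus)
    qed
    finally have \<Phi>I: "(\<integral>\<^sup>+x. \<Phi> x \<partial>lborel) \<le> ennreal ((4 * C1 + C2) * h ^ (?N - 2)) * ?I" .
    define S where "S = {x. ennreal (\<mu>\<^sup>2) \<le> \<Phi> x}"
    have S: "S \<in> sets borel" unfolding S_def by measurable
    have "ennreal (\<mu>\<^sup>2) * emeasure lborel S = (\<integral>\<^sup>+x. ennreal (\<mu>\<^sup>2) * indicator S x \<partial>lborel)"
      using S by (simp add: nn_integral_cmult_indicator)
    also have "\<dots> \<le> (\<integral>\<^sup>+x. \<Phi> x \<partial>lborel)"
      by (intro nn_integral_mono) (auto simp: S_def indicator_def)
    also note \<Phi>I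
    finally have le: "ennreal (\<mu>\<^sup>2) * emeasure lborel S \<le> ennreal ((4 * C1 + C2) * h ^ (?N - 2)) * ?I" .
    have "emeasure lborel S = ennreal (1 / \<mu>\<^sup>2) * (ennreal (\<mu>\<^sup>2) * emeasure lborel S)"
      using \<mu> by (simp add: mult.assoc[symmetric] ennreal_mult[symmetric])
    also have "\<dots> \<le> ennreal (1 / \<mu>\<^sup>2) * (ennreal ((4 * C1 + C2) * h ^ (?N - 2)) * ?I)"
      by (rule mult_left_mono[OF le]) simp
    also have "\<dots> = ennreal ((4 * C1 + C2) * h ^ (?N - 2) / \<mu>\<^sup>2) * ?I"
      using C1 C2 h by (simp add: mult.assoc[symmetric] ennreal_mult[symmetric])
    finally have "emeasure lborel S \<le> ennreal ((4 * C1 + C2) * h ^ (?N - 2) / \<mu>\<^sup>2) * ?I" .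
    moreover have "{x. \<exists>a. \<bar>w x a\<bar> > \<mu>} \<subseteq> S"
    proof clarify
      fix x a assume "\<bar>w x a\<bar> > \<mu>"
      then have "\<mu>\<^sup>2 \<le> \<bar>w x a\<bar>\<^sup>2" using \<mu> by (intro power_mono) auto
      then have "ennreal (\<mu>\<^sup>2) \<le> ennreal ((w x a)\<^sup>2)" by (intro ennreal_leI) simp
      then show "x \<in> S" unfolding S_def using w\<Phi> order_trans by blast
    qed
    ultimately show "outer_le {x. \<exists>a. \<bar>smooth_avg ?N (h / 2) (log_mean g x) a - smooth_avg ?N h (log_mean g x) a\<bar> > \<mu>}
        (ennreal ((4 * C1 + C2) * h ^ (?N - 2) / \<mu>\<^sup>2) * ?I)"
      using S unfolding outer_le_def w_def by blast
  qed
qed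

end

section \<open>Truncation at a height and recovery of the mean from its smoothings\<close>

lemma tame_min:
  assumes g: "tame g" "\<And>x. g x \<ge> 0" and c: "c \<ge> 0" shows "tame (\<lambda>x. min (g x) c)"
proof (rule tame_dominated[OF g(1), where C=1])
  show "continuous_on UNIV (\<lambda>x. min (g x) c)" by (intro continuous_intros tameD_continuous g)
  show "\<bar>min (g x) c\<bar> \<le> 1 * \<bar>g x\<bar>" for x using g(2)[of x] c by (simp add: min_def)
qed

lemma tame_excess:
  assumes g: "tame g" "\<And>x. g x \<ge> 0" and c: "c \<ge> 0" shows "tame (\<lambda>x. max (g x - c) 0)"
proof (rule tame_dominated[OF g(1), where C=1])
  show "continuous_on UNIV (\<lambda>x. max (g x - c) 0)" by (intro continuous_intros tameD_continuous g)
  show "\<bar>max (g x - c) 0\<bar> \<le> 1 * \<bar>g x\<bar>" for x using g(2)[of x] c by (simp add: max_def)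
qed

lemma ennreal_mult_mult: "a \<ge> 0 \<Longrightarrow> ennreal a * (ennreal b * x) = ennreal (a * b) * x"
  by (simp add: ennreal_mult' mult.assoc)

lemma smooth_avg_add:
  assumes F: "continuous_on UNIV F" and G: "continuous_on UNIV G"
  shows "smooth_avg N h (\<lambda>x. F x + G x) a = smooth_avg N h F a + smooth_avg N h G a"
proof -
  have "integral {x..y} (\<lambda>x. F x + G x) = integral {x..y} F + integral {x..y} G" for x y
    by (intro Henstock_Kurzweil_Integration.integral_add integrable_continuous_real continuous_on_subset[OF F] continuous_on_subset[OF G]) auto
  then show ?thesis
    by (simp add: smooth_avg_def add_divide_distrib distrib_left sum.distrib)
qed

text \<open>Each term is a difference quotient of an antiderivative and tends to \<open>F a\<close>;
  the coefficients sum to 1 because the full alternating binomial sum vanishes.\<close>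

lemma smooth_avg_tendsto:
  assumes F: "continuous_on UNIV F" and N: "N \<ge> 1"
  shows "(\<lambda>j. smooth_avg N (1 / 2 ^ j) F a) \<longlonglongrightarrow> F a"
proof -
  obtain P where P: "\<And>x. (P has_real_derivative F x) (at x)"
    using continuous_antiderivative[OF F] by blast
  have "(\<lambda>j. integral {a..a + real k * (1 / 2 ^ j)} F / (real k * (1 / 2 ^ j))) \<longlonglongrightarrow> F a" if k: "k \<in> {1..N}" for k
  proof -
    have "(\<lambda>h. (P (a + h) - P a) / h) \<midarrow>0\<rightarrow> F a"
      using P[of a] by (simp add: DERIV_def)
    moreover have "filterlim (\<lambda>j. real k * (1 / 2 ^ j)) (at 0) sequentially"
      unfolding filterlim_at
    proof
      have "(\<lambda>j. real k * (1 / 2) ^ j) \<longlonglongrightarrow> real k * 0"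
        by (intro tendsto_intros LIMSEQ_realpow_zero; simp)
      then show "((\<lambda>j. real k * (1 / 2 ^ j)) \<longlongrightarrow> 0) sequentially" by (simp add: power_one_over)
    qed (use k in auto)
    ultimately have "(\<lambda>j. (P (a + real k * (1 / 2 ^ j)) - P a) / (real k * (1 / 2 ^ j))) \<longlonglongrightarrow> F a"
      by (rule filterlim_compose)
    then show ?thesis by (simp add: integral_antiderivative[OF P])
  qed
  then have "(\<lambda>j. smooth_avg N (1 / 2 ^ j) F a) \<longlonglongrightarrow> - (\<Sum>k=1..N. (- 1) ^ k * real (N choose k) * F a)"
    unfolding smooth_avg_def by (intro tendsto_minus tendsto_sum tendsto_mult_left)
  also have "(\<Sum>k=1..N. (- 1) ^ k * real (N choose k) * F a) = - F a"
  proof -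
    have "(\<Sum>k\<le>N. (- 1) ^ k * real (N choose k)) = 0"
      using choose_alternating_sum[of N, where 'a=real] N by simp
    then have "(\<Sum>k=1..N. (- 1) ^ k * real (N choose k)) = - 1"
      by (simp add: atMost_atLeast0 sum.atLeast_Suc_atMost)
    then show ?thesis by (simp only: sum_distrib_right[symmetric])
  qed
  finally show ?thesis by simp
qed

text \<open>Where the excess is nonzero, g > c, and the negative power 1 - q is largest at c. This
  and \<open>min_sq_le_powr\<close> exchange powers of g for powers of the height, so that one
  integral of \<open>g powr q\<close> controls both halves.\<close>

lemma excess_le_powr:
  assumes "c > 0" "q > 1" "g \<ge> (0 :: real)"
  shows "max (g - c) 0 \<le> c powr (1 - q) * g powr q"
proof (cases "g > c")
  case True
  have "g = g powr (1 - q) * g powr q" using True assms by (simp add: powr_add[symmetric])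
  also have "\<dots> \<le> c powr (1 - q) * g powr q"
    using True assms by (intro mult_right_mono powr_mono2') auto
  finally show ?thesis using assms by simp
qed simp

lemma min_sq_le_powr:
  assumes "c > 0" "0 \<le> q" "q \<le> 2" "g \<ge> (0 :: real)"
  shows "(min g c)\<^sup>2 \<le> c powr (2 - q) * g powr q"
proof (cases "g = 0")
  case False
  then have m: "min g c > 0" using assms by simp
  have "(min g c)\<^sup>2 = min g c powr 2" using m by (simp add: powr_numeral)
  also have "\<dots> = min g c powr (2 - q) * min g c powr q" using m by (simp add: powr_add[symmetric])
  also have "\<dots> \<le> c powr (2 - q) * g powr q"
    using m assms by (intro mult_mono powr_mono2) auto
  finally show ?thesis .
qed (use assms in simp)

lemma nn_integral_excess_le:
  assumes [measurable]: "g \<in> borel_measurable M" and "c > 0" "q > 1" "\<And>x. g x \<ge> (0 :: real)"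
  shows "(\<integral>\<^sup>+x. ennreal (max (g x - c) 0) \<partial>M) \<le> ennreal (c powr (1 - q)) * (\<integral>\<^sup>+x. ennreal (g x powr q) \<partial>M)"
proof -
  have "(\<integral>\<^sup>+x. ennreal (max (g x - c) 0) \<partial>M) \<le> (\<integral>\<^sup>+x. ennreal (c powr (1 - q) * g x powr q) \<partial>M)"
    by (intro nn_integral_mono ennreal_leI excess_le_powr assms)
  also have "\<dots> = (\<integral>\<^sup>+x. ennreal (c powr (1 - q)) * ennreal (g x powr q) \<partial>M)"
    by (simp add: ennreal_mult)
  also have "\<dots> = ennreal (c powr (1 - q)) * (\<integral>\<^sup>+x. ennreal (g x powr q) \<partial>M)"
    by (rule nn_integral_cmult) measurable
  finally show ?thesis .
qed

lemma nn_integral_min_sq_le: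
  assumes [measurable]: "g \<in> borel_measurable M" and "c > 0" "0 \<le> q" "q \<le> 2" "\<And>x. g x \<ge> (0 :: real)"
  shows "(\<integral>\<^sup>+x. ennreal ((min (g x) c)\<^sup>2) \<partial>M) \<le> ennreal (c powr (2 - q)) * (\<integral>\<^sup>+x. ennreal (g x powr q) \<partial>M)"
proof -
  have "(\<integral>\<^sup>+x. ennreal ((min (g x) c)\<^sup>2) \<partial>M) \<le> (\<integral>\<^sup>+x. ennreal (c powr (2 - q) * g x powr q) \<partial>M)"
    by (intro nn_integral_mono ennreal_leI min_sq_le_powr assms)
  also have "\<dots> = (\<integral>\<^sup>+x. ennreal (c powr (2 - q)) * ennreal (g x powr q) \<partial>M)"
    by (simp add: ennreal_mult)
  also have "\<dots> = ennreal (c powr (2 - q)) * (\<integral>\<^sup>+x. ennreal (g x powr q) \<partial>M)"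
    by (rule nn_integral_cmult) measurable
  finally show ?thesis .
qed

context sphere_measure
begin

lemma log_mean_split:
  assumes g: "tame g" "\<And>x. g x \<ge> 0" and c: "c \<ge> 0"
  shows "log_mean g x a = log_mean (\<lambda>x. min (g x) c) x a + log_mean (\<lambda>x. max (g x - c) 0) x a"
proof -
  have "g = (\<lambda>x. min (g x) c + max (g x - c) 0)" by (auto simp: fun_eq_iff min_def max_def)
  then show ?thesis
    using log_mean_add[OF tame_min[OF g c] tame_excess[OF g c]] by metis
qed

lemma smooth_avg_log_mean_split:
  assumes g: "tame g" "\<And>x. g x \<ge> 0" and c: "c \<ge> 0"
  shows "smooth_avg N h (log_mean g x) a
    = smooth_avg N h (log_mean (\<lambda>x. min (g x) c) x) a + smooth_avg N h (log_mean (\<lambda>x. max (g x - c) 0) x) a"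
proof -
  have "log_mean g x = (\<lambda>a. log_mean (\<lambda>x. min (g x) c) x a + log_mean (\<lambda>x. max (g x - c) 0) x a)"
    by (intro ext log_mean_split g c)
  then show ?thesis
    by (simp add: smooth_avg_add continuous_log_mean_snd tame_min tame_excess g c)
qed

text \<open>The function is cut at height \<open>c\<close>: the lower part is treated in \<open>L\<^sup>2\<close>, the upper part in \<open>L\<^sup>1\<close>.\<close>
lemma difference_weak_type:
  assumes q: "1 < q" "q < 2"
  obtains C where "C > 0"
    "\<And>g h \<mu> c. tame g \<Longrightarrow> (\<And>x. g x \<ge> 0) \<Longrightarrow> 0 < h \<Longrightarrow> h \<le> 1 \<Longrightarrow> \<mu> > 0 \<Longrightarrow> c > 0 \<Longrightarrow>
      outer_le {x. \<exists>a. \<bar>smooth_avg DIM('a) (h / 2) (log_mean g x) a - smooth_avg DIM('a) h (log_mean g x) a\<bar> > \<mu>}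
        (ennreal (C * (h ^ (DIM('a) - 2) / \<mu>\<^sup>2 * c powr (2 - q) + c powr (1 - q) / (h * \<mu>)))
          * (\<integral>\<^sup>+x. ennreal (g x powr q) \<partial>lborel))"
proof -
  let ?N = "DIM('a)"
  obtain C1 where C1: "C1 > 0"
    "\<And>g h \<mu>. tame g \<Longrightarrow> (\<And>x. g x \<ge> 0) \<Longrightarrow> 0 < h \<Longrightarrow> h \<le> 1 \<Longrightarrow> \<mu> > 0 \<Longrightarrow>
      outer_le {x. \<exists>a. \<bar>smooth_avg ?N h (log_mean g x) a\<bar> > \<mu>} (ennreal (C1 / (h * \<mu>)) * (\<integral>\<^sup>+x. ennreal (g x) \<partial>lborel))"
    using smooth_avg_weak_L1 by blast
  obtain C2 where C2: "C2 > 0"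
    "\<And>g h \<mu>. tame g \<Longrightarrow> 0 < h \<Longrightarrow> h \<le> 1 \<Longrightarrow> \<mu> > 0 \<Longrightarrow>
      outer_le {x. \<exists>a. \<bar>smooth_avg ?N (h / 2) (log_mean g x) a - smooth_avg ?N h (log_mean g x) a\<bar> > \<mu>}
        (ennreal (C2 * h ^ (?N - 2) / \<mu>\<^sup>2) * (\<integral>\<^sup>+x. ennreal ((g x)\<^sup>2) \<partial>lborel))"
    using difference_weak_L2 by blast
  show thesis
  proof (rule that[of "9 * C1 + 9 * C2"])
    show "9 * C1 + 9 * C2 > 0" using C1 C2 by simp
    fix g :: "'a \<Rightarrow> real" and h \<mu> c :: real
    assume g: "tame g" "\<And>x. g x \<ge> 0" and h: "0 < h" "h \<le> 1" and \<mu>: "\<mu> > 0" and c: "c > 0"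
    note [measurable] = tame_measurable[OF g(1)]
    let ?I = "\<integral>\<^sup>+x. ennreal (g x powr q) \<partial>lborel"
    define g1 where "g1 x = min (g x) c" for x
    define g2 where "g2 x = max (g x - c) 0" for x
    have t1: "tame g1" and t2: "tame g2" and p2: "\<And>x. g2 x \<ge> 0"
      using tame_min[OF g, of c] tame_excess[OF g, of c] c by (simp_all add: g1_def[abs_def] g2_def[abs_def])
    let ?d = "\<lambda>f x a. smooth_avg ?N (h / 2) (log_mean f x) a - smooth_avg ?N h (log_mean f x) a"
    \<comment> \<open>The level is split in three. In the upper part the two smoothings are
      estimated separately, since in L^1 only their individual size is controlled.\<close>
    define E1 where "E1 = {x. \<exists>a. \<bar>?d g1 x a\<bar> > \<mu> / 3}"
    define E2 where "E2 = {x. \<exists>a. \<bar>smooth_avg ?N (h / 2) (log_mean g2 x) a\<bar> > \<mu> / 3}"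
    define E3 where "E3 = {x. \<exists>a. \<bar>smooth_avg ?N h (log_mean g2 x) a\<bar> > \<mu> / 3}"
    have sub: "{x. \<exists>a. \<bar>?d g x a\<bar> > \<mu>} \<subseteq> E1 \<union> (E2 \<union> E3)"
    proof (rule subsetI, rule ccontr)
      fix x assume x: "x \<in> {x. \<exists>a. \<bar>?d g x a\<bar> > \<mu>}" "x \<notin> E1 \<union> (E2 \<union> E3)"
      then obtain a where a: "\<bar>?d g x a\<bar> > \<mu>" by blast
      have "?d g x a = ?d g1 x a + smooth_avg ?N (h / 2) (log_mean g2 x) a - smooth_avg ?N h (log_mean g2 x) a"
        unfolding g1_def[abs_def] g2_def[abs_def] using c by (subst (1 2) smooth_avg_log_mean_split[OF g, of c]) auto
      moreover have "\<bar>smooth_avg ?N (h / 2) (log_mean g2 x) a\<bar> \<le> \<mu> / 3" "\<bar>smooth_avg ?N h (log_mean g2 x) a\<bar> \<le> \<mu> / 3"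
        using x(2) by (auto simp: E2_def E3_def not_less)
      ultimately have "\<bar>?d g1 x a\<bar> > \<mu> / 3" using a by linarith
      then show False using x(2) by (auto simp: E1_def)
    qed
    have I2: "(\<integral>\<^sup>+x. ennreal (g2 x) \<partial>lborel) \<le> ennreal (c powr (1 - q)) * ?I"
      unfolding g2_def by (rule nn_integral_excess_le) (use g c q in auto)
    have I1: "(\<integral>\<^sup>+x. ennreal ((g1 x)\<^sup>2) \<partial>lborel) \<le> ennreal (c powr (2 - q)) * ?I"
      unfolding g1_def by (rule nn_integral_min_sq_le) (use g c q in auto)
    have mul: "ennreal A * X \<le> ennreal (A * B) * ?I" if "X \<le> ennreal B * ?I" "A \<ge> 0" for A B X
    proof -
      have "ennreal A * X \<le> ennreal A * (ennreal B * ?I)" using that(1) by (rule mult_left_mono) simp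
      then show ?thesis using that(2) by (simp add: ennreal_mult' mult.assoc)
    qed
    let ?A = "h ^ (?N - 2) / \<mu>\<^sup>2 * c powr (2 - q)" and ?B = "c powr (1 - q) / (h * \<mu>)"
    have AB: "?A \<ge> 0" "?B \<ge> 0" using h \<mu> by auto
    have o1: "outer_le E1 (ennreal (9 * C2 * ?A) * ?I)"
    proof (rule outer_le_mono[OF _ order_refl])
      show "outer_le E1 (ennreal (C2 * h ^ (?N - 2) / (\<mu> / 3)\<^sup>2) * (\<integral>\<^sup>+x. ennreal ((g1 x)\<^sup>2) \<partial>lborel))"
        unfolding E1_def by (rule C2(2)[OF t1 h]) (use \<mu> in simp)
      have eq: "C2 * h ^ (?N - 2) / (\<mu> / 3)\<^sup>2 * c powr (2 - q) = 9 * C2 * ?A" by (simp add: power_divide)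
      show "ennreal (C2 * h ^ (?N - 2) / (\<mu> / 3)\<^sup>2) * (\<integral>\<^sup>+x. ennreal ((g1 x)\<^sup>2) \<partial>lborel) \<le> ennreal (9 * C2 * ?A) * ?I"
        unfolding eq[symmetric] by (rule mul[OF I1]) (use C2(1) h \<mu> in auto)
    qed
    have o2: "outer_le E2 (ennreal (6 * C1 * ?B) * ?I)"
    proof (rule outer_le_mono[OF _ order_refl])
      show "outer_le E2 (ennreal (C1 / (h / 2 * (\<mu> / 3))) * (\<integral>\<^sup>+x. ennreal (g2 x) \<partial>lborel))"
        unfolding E2_def by (rule C1(2)[OF t2 p2]) (use \<mu> h in auto)
      have eq: "C1 / (h / 2 * (\<mu> / 3)) * c powr (1 - q) = 6 * C1 * ?B" by simp
      show "ennreal (C1 / (h / 2 * (\<mu> / 3))) * (\<integral>\<^sup>+x. ennreal (g2 x) \<partial>lborel) \<le> ennreal (6 * C1 * ?B) * ?I"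
        unfolding eq[symmetric] by (rule mul[OF I2]) (use C1(1) h \<mu> in auto)
    qed
    have o3: "outer_le E3 (ennreal (3 * C1 * ?B) * ?I)"
    proof (rule outer_le_mono[OF _ order_refl])
      show "outer_le E3 (ennreal (C1 / (h * (\<mu> / 3))) * (\<integral>\<^sup>+x. ennreal (g2 x) \<partial>lborel))"
        unfolding E3_def by (rule C1(2)[OF t2 p2]) (use \<mu> h in auto)
      have eq: "C1 / (h * (\<mu> / 3)) * c powr (1 - q) = 3 * C1 * ?B" by simp
      show "ennreal (C1 / (h * (\<mu> / 3))) * (\<integral>\<^sup>+x. ennreal (g2 x) \<partial>lborel) \<le> ennreal (3 * C1 * ?B) * ?I"
        unfolding eq[symmetric] by (rule mul[OF I2]) (use C1(1) h \<mu> in auto)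
    qed
    have sum: "ennreal (9 * C2 * A) * J + (ennreal (6 * C1 * B) * J + ennreal (3 * C1 * B) * J)
        \<le> ennreal ((9 * C1 + 9 * C2) * (A + B)) * J" if "A \<ge> 0" "B \<ge> 0" for A B :: real and J
    proof -
      have nn: "0 \<le> C1 * A" "0 \<le> C2 * A" "0 \<le> C1 * B" "0 \<le> C2 * B" using that C1(1) C2(1) by simp_all
      have nn': "0 \<le> 9 * C2 * A" "0 \<le> 6 * C1 * B" "0 \<le> 3 * C1 * B" using nn by (simp_all add: mult.assoc)
      have "ennreal (9 * C2 * A) * J + (ennreal (6 * C1 * B) * J + ennreal (3 * C1 * B) * J)
         = (ennreal (9 * C2 * A) + (ennreal (6 * C1 * B) + ennreal (3 * C1 * B))) * J"
        by (simp only: distrib_right)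
      also have "ennreal (9 * C2 * A) + (ennreal (6 * C1 * B) + ennreal (3 * C1 * B))
         = ennreal (9 * C2 * A + (6 * C1 * B + 3 * C1 * B))"
      proof -
        have "ennreal (6 * C1 * B) + ennreal (3 * C1 * B) = ennreal (6 * C1 * B + 3 * C1 * B)"
          by (rule ennreal_plus[symmetric]) (intro nn' add_nonneg_nonneg)+
        moreover have "ennreal (9 * C2 * A) + ennreal (6 * C1 * B + 3 * C1 * B) = ennreal (9 * C2 * A + (6 * C1 * B + 3 * C1 * B))"
          by (rule ennreal_plus[symmetric]) (intro nn' add_nonneg_nonneg)+
        ultimately show ?thesis by (simp only:)
      qed
      also have "\<dots> * J \<le> ennreal ((9 * C1 + 9 * C2) * (A + B)) * J"
      proof (intro mult_right_mono ennreal_leI)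
        show "9 * C2 * A + (6 * C1 * B + 3 * C1 * B) \<le> (9 * C1 + 9 * C2) * (A + B)"
          using nn by (simp add: algebra_simps)
      qed simp
      finally show ?thesis .
    qed
    show "outer_le {x. \<exists>a. \<bar>?d g x a\<bar> > \<mu>} (ennreal ((9 * C1 + 9 * C2) * (?A + ?B)) * ?I)"
      by (rule outer_le_mono[OF outer_le_Un[OF o1 outer_le_Un[OF o2 o3]] sub sum[OF AB]])
  qed
qed

text \<open>The smoothing at scale 1 starts the telescoping sum. A cut at a height proportional to
  \<mu> makes the lower part contribute at most \<mu> / 2, so the weak type (1, 1) bound for the
  excess is enough.\<close>

lemma initial_weak_type:
  assumes q: "1 < q"
  obtains C where "C > 0"
    "\<And>g \<mu>. tame g \<Longrightarrow> (\<And>x. g x \<ge> 0) \<Longrightarrow> \<mu> > 0 \<Longrightarrow>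
      outer_le {x. \<exists>a. \<bar>smooth_avg N 1 (log_mean g x) a\<bar> > \<mu>}
        (ennreal (C * \<mu> powr (- q)) * (\<integral>\<^sup>+x. ennreal (g x powr q) \<partial>lborel))"
proof -
  obtain C1 where C1: "C1 > 0"
    "\<And>g h \<mu>. tame g \<Longrightarrow> (\<And>x. g x \<ge> 0) \<Longrightarrow> 0 < h \<Longrightarrow> h \<le> 1 \<Longrightarrow> \<mu> > 0 \<Longrightarrow>
      outer_le {x. \<exists>a. \<bar>smooth_avg N h (log_mean g x) a\<bar> > \<mu>} (ennreal (C1 / (h * \<mu>)) * (\<integral>\<^sup>+x. ennreal (g x) \<partial>lborel))"
    using smooth_avg_weak_L1 by blast
  \<comment> \<open>Chosen so that the supremum bound \<open>2 ^ N * c\<close> for the lower part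
    equals \<mu> / 2.\<close>
  define k where "k = 1 / (2 * 2 ^ N :: real)"
  have k: "k > 0" "2 ^ N * k = 1 / 2" by (simp_all add: k_def)
  show thesis
  proof (rule that[of "2 * C1 * k powr (1 - q)"])
    show "2 * C1 * k powr (1 - q) > 0" using C1 k by simp
    fix g :: "'a \<Rightarrow> real" and \<mu> :: real
    assume g: "tame g" "\<And>x. g x \<ge> 0" and \<mu>: "\<mu> > 0"
    note [measurable] = tame_measurable[OF g(1)]
    let ?I = "\<integral>\<^sup>+x. ennreal (g x powr q) \<partial>lborel"
    define c where "c = k * \<mu>"
    have c: "c > 0" using k \<mu> by (simp add: c_def)
    define g1 where "g1 x = min (g x) c" for x
    define g2 where "g2 x = max (g x - c) 0" for x
    have t1: "tame g1" and t2: "tame g2" and p1: "\<And>x. g1 x \<ge> 0" and p2: "\<And>x. g2 x \<ge> 0"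
      using tame_min[OF g, of c] tame_excess[OF g, of c] c g(2) by (simp_all add: g1_def[abs_def] g2_def[abs_def])
    have "{x. \<exists>a. \<bar>smooth_avg N 1 (log_mean g x) a\<bar> > \<mu>} \<subseteq> {x. \<exists>a. \<bar>smooth_avg N 1 (log_mean g2 x) a\<bar> > \<mu> / 2}"
    proof clarify
      fix x a assume a: "\<bar>smooth_avg N 1 (log_mean g x) a\<bar> > \<mu>"
      have "smooth_avg N 1 (log_mean g x) a = smooth_avg N 1 (log_mean g1 x) a + smooth_avg N 1 (log_mean g2 x) a"
        unfolding g1_def[abs_def] g2_def[abs_def] using c by (intro smooth_avg_log_mean_split[OF g]) simp
      moreover have "\<bar>smooth_avg N 1 (log_mean g1 x) a\<bar> \<le> 2 ^ N * c"
      proof (rule abs_smooth_avg_le_sup)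
        show "continuous_on UNIV (log_mean g1 x)" by (rule continuous_log_mean_snd[OF t1])
        show "0 \<le> log_mean g1 x s" for s by (rule log_mean_nonneg[OF p1])
        have "\<bar>log_mean g1 x s\<bar> \<le> c" for s
          by (rule abs_log_mean_le[OF t1]) (use p1 c in \<open>simp add: g1_def\<close>)
        then show "log_mean g1 x s \<le> c" for s by (rule order_trans[OF abs_ge_self])
      qed auto
      moreover have "2 ^ N * c = \<mu> / 2" using k by (simp add: c_def mult.assoc[symmetric])
      ultimately have "\<bar>smooth_avg N 1 (log_mean g2 x) a\<bar> > \<mu> / 2" using a by linarith
      then show "\<exists>a. \<bar>smooth_avg N 1 (log_mean g2 x) a\<bar> > \<mu> / 2" by blast
    qed
    moreover have "outer_le {x. \<exists>a. \<bar>smooth_avg N 1 (log_mean g2 x) a\<bar> > \<mu> / 2} (ennreal (C1 / (1 * (\<mu> / 2))) * (\<integral>\<^sup>+x. ennreal (g2 x) \<partial>lborel))"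
      by (rule C1(2)[OF t2 p2]) (use \<mu> in auto)
    moreover have "ennreal (C1 / (1 * (\<mu> / 2))) * (\<integral>\<^sup>+x. ennreal (g2 x) \<partial>lborel) \<le> ennreal (2 * C1 * k powr (1 - q) * \<mu> powr (- q)) * ?I"
    proof -
      have "(\<integral>\<^sup>+x. ennreal (g2 x) \<partial>lborel) \<le> ennreal (c powr (1 - q)) * ?I"
        unfolding g2_def by (rule nn_integral_excess_le) (use g c q in auto)
      then have "ennreal (C1 / (1 * (\<mu> / 2))) * (\<integral>\<^sup>+x. ennreal (g2 x) \<partial>lborel) \<le> ennreal (C1 / (1 * (\<mu> / 2))) * (ennreal (c powr (1 - q)) * ?I)"
        by (rule mult_left_mono) simp
      also have "\<dots> = ennreal (C1 / (1 * (\<mu> / 2)) * c powr (1 - q)) * ?I"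
        by (rule ennreal_mult_mult) (use C1 \<mu> in simp)
      also have "C1 / (1 * (\<mu> / 2)) * c powr (1 - q) = 2 * C1 * k powr (1 - q) * \<mu> powr (- q)"
      proof -
        have "\<mu> powr (1 - q) = \<mu> * \<mu> powr (- q)" using \<mu> by (simp add: powr_diff powr_minus divide_inverse)
        then show ?thesis using k \<mu> by (simp add: c_def powr_mult)
      qed
      finally show ?thesis .
    qed
    ultimately show "outer_le {x. \<exists>a. \<bar>smooth_avg N 1 (log_mean g x) a\<bar> > \<mu>}
        (ennreal (2 * C1 * k powr (1 - q) * \<mu> powr (- q)) * ?I)"
      using outer_le_mono by blast
  qed
qed

text \<open>With \<open>h = 2\<^bsup>-j\<^esup>\<close>, the cut at height \<open>2\<^bsup>j (d - 1)\<^esup> \<lambda>\<close> balances the two terms of the preceding bound, and the sum over \<open>j\<close> converges because \<open>(d - 1) q > d\<close>.\<close>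
lemma maximal_weak_type:
  assumes q: "real DIM('a) / (real DIM('a) - 1) < q" "q < 2"
  obtains C where "C > 0"
    "\<And>g \<mu>. tame g \<Longrightarrow> (\<And>x. g x \<ge> 0) \<Longrightarrow> \<mu> > 0 \<Longrightarrow>
      outer_le {x. \<exists>a. log_mean g x a > \<mu>} (ennreal (C * \<mu> powr (- q)) * (\<integral>\<^sup>+x. ennreal (g x powr q) \<partial>lborel))"
proof -
  let ?N = "DIM('a)"
  define n where "n = real ?N - 1"
  have "3 \<le> real ?N" using of_nat_mono[OF dim, where 'a=real] by simp
  then have n: "n \<ge> 2" "real ?N = n + 1" by (simp_all add: n_def)
  define \<delta> where "\<delta> = n * q - real ?N"
  have "real ?N / n < q" using q(1) by (simp only: n_def)
  then have "real ?N < q * n" using n(1) by (subst (asm) pos_divide_less_eq) auto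
  then have \<delta>: "\<delta> > 0" by (simp add: \<delta>_def mult.commute)
  have q1: "1 < q"
  proof (rule ccontr)
    assume "\<not> 1 < q"
    then have "n * q \<le> n * 1" using n by (intro mult_left_mono) auto
    then show False using \<delta> n(2) unfolding \<delta>_def by linarith
  qed
  \<comment> \<open>\<delta> is the gain per dyadic scale. The level is distributed as \<epsilon> j
    \<mu>, of total \<mu> / 2, with \<epsilon> j proportional to 2^(- \<kappa> j). With \<kappa> =
    \<delta> / 4, the factor 1 / \<epsilon>^2 of the weak type (2, 2) term uses up half of the gain,
    and the ratio \<theta> = 2^(- \<delta> / 2) remains.\<close>
  define \<kappa> where "\<kappa> = \<delta> / 4"
  have \<kappa>: "\<kappa> > 0" using \<delta> by (simp add: \<kappa>_def)
  define \<rho> where "\<rho> = 2 powr (- \<kappa>)"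
  have \<rho>: "0 < \<rho>" "\<rho> < 1" using \<kappa> by (simp_all add: \<rho>_def powr_less_one)
  define \<theta> where "\<theta> = 2 powr (- (\<delta> / 2))"
  have \<theta>: "0 < \<theta>" "\<theta> < 1" using \<delta> by (simp_all add: \<theta>_def powr_less_one)
  have \<theta>_pow: "2 powr (- (\<delta> / 2) * real j) = \<theta> ^ j" for j
    unfolding powr_realpow[OF \<theta>(1), symmetric] by (simp only: \<theta>_def powr_powr)
  define \<epsilon> where "\<epsilon> j = (1 - \<rho>) / 2 * \<rho> ^ j" for j :: nat
  have \<epsilon>: "\<epsilon> j > 0" for j using \<rho> by (simp add: \<epsilon>_def)
  obtain C0 where C0: "C0 > 0"
    "\<And>g \<mu>. tame g \<Longrightarrow> (\<And>x. g x \<ge> 0) \<Longrightarrow> \<mu> > 0 \<Longrightarrow>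
      outer_le {x. \<exists>a. \<bar>smooth_avg ?N 1 (log_mean g x) a\<bar> > \<mu>}
        (ennreal (C0 * \<mu> powr (- q)) * (\<integral>\<^sup>+x. ennreal (g x powr q) \<partial>lborel))"
    using initial_weak_type[OF q1] by blast
  obtain C1 where C1: "C1 > 0"
    "\<And>g h \<mu> c. tame g \<Longrightarrow> (\<And>x. g x \<ge> 0) \<Longrightarrow> 0 < h \<Longrightarrow> h \<le> 1 \<Longrightarrow> \<mu> > 0 \<Longrightarrow> c > 0 \<Longrightarrow>
      outer_le {x. \<exists>a. \<bar>smooth_avg ?N (h / 2) (log_mean g x) a - smooth_avg ?N h (log_mean g x) a\<bar> > \<mu>}
        (ennreal (C1 * (h ^ (?N - 2) / \<mu>\<^sup>2 * c powr (2 - q) + c powr (1 - q) / (h * \<mu>)))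
          * (\<integral>\<^sup>+x. ennreal (g x powr q) \<partial>lborel))"
    using difference_weak_type[OF q1 q(2)] by blast
  define b where "b = 2 / (1 - \<rho>)"
  have b: "b > 0" using \<rho> by (simp add: b_def)
  define K where "K = C1 * (b\<^sup>2 + b)"
  have K: "K > 0" unfolding K_def using C1(1) b by (intro mult_pos_pos add_pos_pos) auto
  show thesis
  proof (rule that[of "C0 * 2 powr q + K / (1 - \<theta>)"])
    show "C0 * 2 powr q + K / (1 - \<theta>) > 0" using C0 K \<theta> by (simp add: add_pos_pos)
    fix g :: "'a \<Rightarrow> real" and \<mu> :: real
    assume g: "tame g" "\<And>x. g x \<ge> 0" and \<mu>: "\<mu> > 0"
    let ?I = "\<integral>\<^sup>+x. ennreal (g x powr q) \<partial>lborel"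
    define S where "S j x a = smooth_avg ?N (1 / 2 ^ j) (log_mean g x) a" for j :: nat and x a
    define E where "E j = {x. \<exists>a. \<bar>S (Suc j) x a - S j x a\<bar> > \<epsilon> j * \<mu>}" for j
    define E0 where "E0 = {x. \<exists>a. \<bar>S 0 x a\<bar> > \<mu> / 2}"
    have sub: "{x. \<exists>a. log_mean g x a > \<mu>} \<subseteq> E0 \<union> (\<Union>j. E j)"
    proof (rule subsetI, rule ccontr)
      fix x assume x: "x \<in> {x. \<exists>a. log_mean g x a > \<mu>}" "x \<notin> E0 \<union> (\<Union>j. E j)"
      then obtain a where a: "log_mean g x a > \<mu>" by blast
      have s0: "\<bar>S 0 x a\<bar> \<le> \<mu> / 2" using x(2) by (auto simp: E0_def not_less)
      have sj: "\<bar>S (Suc j) x a - S j x a\<bar> \<le> \<epsilon> j * \<mu>" for j using x(2) by (auto simp: E_def not_less)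
      \<comment> \<open>The first j increments add up to at most \<mu> / 2 (1 - \<rho>^j), which is
        added to \<mu> / 2 for the initial smoothing.\<close>
      have "S j x a \<le> \<mu> - \<mu> / 2 * \<rho> ^ j" for j
      proof (induction j)
        case 0 then show ?case using s0 by simp
      next
        case (Suc j)
        have "S (Suc j) x a \<le> (\<mu> - \<mu> / 2 * \<rho> ^ j) + \<epsilon> j * \<mu>" using Suc sj[of j] by linarith
        also have "\<dots> = \<mu> - \<mu> / 2 * \<rho> ^ Suc j" by (simp add: \<epsilon>_def field_simps)
        finally show ?case .
      qed
      moreover have "\<mu> - \<mu> / 2 * \<rho> ^ j \<le> \<mu>" for j using \<mu> \<rho> by simp
      ultimately have le: "S j x a \<le> \<mu>" for j by (meson order_trans)
      have "(\<lambda>j. S j x a) \<longlonglongrightarrow> log_mean g x a"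
        unfolding S_def using dim by (intro smooth_avg_tendsto continuous_log_mean_snd g(1)) simp
      then have "log_mean g x a \<le> \<mu>" by (rule LIMSEQ_le_const2) (use le in auto)
      then show False using a by simp
    qed
    have o0: "outer_le E0 (ennreal (C0 * 2 powr q * \<mu> powr (- q)) * ?I)"
    proof -
      have "(\<mu> / 2) powr (- q) = 2 powr q * \<mu> powr (- q)"
        using \<mu> by (simp add: powr_divide powr_minus field_simps)
      then show ?thesis
        using C0(2)[OF g, of "\<mu> / 2"] \<mu> unfolding E0_def S_def by (simp add: mult.assoc)
    qed
    have oj: "outer_le (E j) (ennreal (K * \<mu> powr (- q) * \<theta> ^ j) * ?I)" for j
    proof (rule outer_le_mono[OF _ order_refl])
      define h where "h = (1 / 2 ^ j :: real)"
      define c where "c = 2 powr (real j * n) * \<mu>"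
      have h: "0 < h" "h \<le> 1" by (simp_all add: h_def)
      have c: "c > 0" using \<mu> by (simp add: c_def)
      have hp: "h = 2 powr (- real j)" by (simp add: h_def powr_minus powr_realpow divide_inverse)
      show "outer_le (E j) (ennreal (C1 * (h ^ (?N - 2) / (\<epsilon> j * \<mu>)\<^sup>2 * c powr (2 - q) + c powr (1 - q) / (h * (\<epsilon> j * \<mu>)))) * ?I)"
        using C1(2)[OF g h, of "\<epsilon> j * \<mu>" c] \<mu> \<epsilon>[of j] c unfolding E_def S_def h_def by (simp add: mult.commute)
      have ej: "1 / \<epsilon> j = b * 2 powr (real j * \<kappa>)"
        using \<rho> by (simp add: \<epsilon>_def b_def \<rho>_def powr_powr[symmetric] powr_minus powr_realpow field_simps flip: powr_realpow)
      have hN: "h ^ (?N - 2) = 2 powr (- real j * (n - 1))"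
      proof -
        have "h ^ (?N - 2) = h powr real (?N - 2)" using h by (simp add: powr_realpow)
        also have "real (?N - 2) = n - 1" using dim by (simp add: n_def of_nat_diff)
        finally show ?thesis by (simp add: hp powr_powr)
      qed
      have t1: "h ^ (?N - 2) / (\<epsilon> j * \<mu>)\<^sup>2 * c powr (2 - q) = b\<^sup>2 * \<mu> powr (- q) * \<theta> ^ j"
      proof -
        have "c powr (2 - q) = 2 powr (real j * n * (2 - q)) * \<mu> powr (2 - q)"
          using \<mu> by (simp add: c_def powr_mult powr_powr)
        also have "\<mu> powr (2 - q) = \<mu>\<^sup>2 * \<mu> powr (- q)"
          using \<mu> by (simp add: powr_diff powr_minus divide_inverse powr_numeral)
        finally have cc: "c powr (2 - q) = 2 powr (real j * n * (2 - q)) * (\<mu>\<^sup>2 * \<mu> powr (- q))" .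
        have "h ^ (?N - 2) / (\<epsilon> j * \<mu>)\<^sup>2 * c powr (2 - q) = h ^ (?N - 2) * (1 / \<epsilon> j)\<^sup>2 * (c powr (2 - q) / \<mu>\<^sup>2)"
          by (simp add: power_mult_distrib power_divide)
        also have "\<dots> = 2 powr (- real j * (n - 1)) * (b * 2 powr (real j * \<kappa>))\<^sup>2 * (2 powr (real j * n * (2 - q)) * \<mu> powr (- q))"
          unfolding cc ej hN using \<mu> by simp
        also have "\<dots> = b\<^sup>2 * \<mu> powr (- q) * (2 powr (- real j * (n - 1)) * 2 powr (real j * \<kappa> * 2) * 2 powr (real j * n * (2 - q)))"
          by (simp add: power_mult_distrib powr_power mult_ac)
        also have "2 powr (- real j * (n - 1)) * 2 powr (real j * \<kappa> * 2) * 2 powr (real j * n * (2 - q)) = (2 :: real) powr (- (\<delta> / 2) * real j)"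
        proof -
          have "- real j * (n - 1) + real j * \<kappa> * 2 + real j * n * (2 - q) = - (\<delta> / 2) * real j"
            unfolding \<kappa>_def \<delta>_def n(2) by (simp add: field_simps)
          then show ?thesis by (simp only: powr_add[symmetric])
        qed
        also have "\<dots> = \<theta> ^ j" by (rule \<theta>_pow)
        finally show ?thesis .
      qed
      have t2: "c powr (1 - q) / (h * (\<epsilon> j * \<mu>)) \<le> b * \<mu> powr (- q) * \<theta> ^ j"
      proof -
        have "c powr (1 - q) = 2 powr (real j * n * (1 - q)) * \<mu> powr (1 - q)"
          using \<mu> by (simp add: c_def powr_mult powr_powr)
        also have "\<mu> powr (1 - q) = \<mu> * \<mu> powr (- q)"
          using \<mu> by (simp add: powr_diff powr_minus divide_inverse)
        finally have cc: "c powr (1 - q) = 2 powr (real j * n * (1 - q)) * (\<mu> * \<mu> powr (- q))" .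
        have h1: "1 / h = 2 powr real j" by (simp add: h_def powr_realpow)
        have "c powr (1 - q) / (h * (\<epsilon> j * \<mu>)) = (1 / h) * (1 / \<epsilon> j) * (c powr (1 - q) / \<mu>)" by simp
        also have "\<dots> = 2 powr real j * (b * 2 powr (real j * \<kappa>)) * (2 powr (real j * n * (1 - q)) * \<mu> powr (- q))"
          unfolding cc ej h1 using \<mu> by simp
        also have "\<dots> = b * \<mu> powr (- q) * (2 powr real j * 2 powr (real j * \<kappa>) * 2 powr (real j * n * (1 - q)))"
          by (simp add: mult_ac)
        also have "2 powr real j * 2 powr (real j * \<kappa>) * 2 powr (real j * n * (1 - q)) = (2 :: real) powr (- (3 * \<delta> / 4) * real j)"
        proof -
          have "real j + real j * \<kappa> + real j * n * (1 - q) = - (3 * \<delta> / 4) * real j"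
            unfolding \<kappa>_def \<delta>_def n(2) by (simp add: field_simps)
          then show ?thesis by (simp only: powr_add[symmetric])
        qed
        also have "b * \<mu> powr (- q) * \<dots> \<le> b * \<mu> powr (- q) * 2 powr (- (\<delta> / 2) * real j)"
          using b \<delta> by (intro mult_left_mono powr_mono mult_right_mono) auto
        also have "2 powr (- (\<delta> / 2) * real j) = \<theta> ^ j" by (rule \<theta>_pow)
        finally show ?thesis .
      qed
      show "ennreal (C1 * (h ^ (?N - 2) / (\<epsilon> j * \<mu>)\<^sup>2 * c powr (2 - q) + c powr (1 - q) / (h * (\<epsilon> j * \<mu>)))) * ?I
          \<le> ennreal (K * \<mu> powr (- q) * \<theta> ^ j) * ?I"
      proof (intro mult_right_mono ennreal_leI)
        have "C1 * (h ^ (?N - 2) / (\<epsilon> j * \<mu>)\<^sup>2 * c powr (2 - q) + c powr (1 - q) / (h * (\<epsilon> j * \<mu>)))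
           \<le> C1 * (b\<^sup>2 * \<mu> powr (- q) * \<theta> ^ j + b * \<mu> powr (- q) * \<theta> ^ j)"
          using C1(1) by (intro mult_left_mono add_mono t2) (simp_all only: t1 order_refl less_imp_le)
        also have "\<dots> = K * \<mu> powr (- q) * \<theta> ^ j" by (simp add: K_def algebra_simps)
        finally show "C1 * (h ^ (?N - 2) / (\<epsilon> j * \<mu>)\<^sup>2 * c powr (2 - q) + c powr (1 - q) / (h * (\<epsilon> j * \<mu>)))
          \<le> K * \<mu> powr (- q) * \<theta> ^ j" .
      qed simp
    qed
    have sm: "(\<Sum>j. ennreal (K * \<mu> powr (- q) * \<theta> ^ j) * ?I) = ennreal (K / (1 - \<theta>) * \<mu> powr (- q)) * ?I"
    proof -
      have "(\<Sum>j. ennreal (K * \<mu> powr (- q) * \<theta> ^ j)) = ennreal (\<Sum>j. K * \<mu> powr (- q) * \<theta> ^ j)"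
        using K \<theta> by (intro suminf_ennreal2) (auto intro!: summable_mult summable_geometric)
      also have "(\<Sum>j. K * \<mu> powr (- q) * \<theta> ^ j) = K / (1 - \<theta>) * \<mu> powr (- q)"
        using \<theta> by (subst suminf_mult) (auto intro!: summable_geometric simp: suminf_geometric)
      finally show ?thesis by (simp only: ennreal_suminf_multc)
    qed
    have "ennreal (C0 * 2 powr q * \<mu> powr (- q)) * ?I + ennreal (K / (1 - \<theta>) * \<mu> powr (- q)) * ?I
        = ennreal ((C0 * 2 powr q + K / (1 - \<theta>)) * \<mu> powr (- q)) * ?I"
      unfolding distrib_right[of _ _ "\<mu> powr (- q)"]
      using C0(1) K \<theta> by (subst ennreal_plus) (auto simp: distrib_right)
    then show "outer_le {x. \<exists>a. log_mean g x a > \<mu>} (ennreal ((C0 * 2 powr q + K / (1 - \<theta>)) * \<mu> powr (- q)) * ?I)"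
      using outer_le_mono[OF outer_le_Un[OF o0 outer_le_UN[OF oj]] sub order_refl] unfolding sm by simp
  qed
qed

subsection \<open>The spherical maximal function\<close>

text \<open>A supremum of reals, meaningful when the means are bounded above, as
  \<open>bdd_above_log_mean\<close> shows for tame g; real values allow \<open>powr\<close> to be
  applied directly.\<close>

definition maximal_mean :: "('a \<Rightarrow> real) \<Rightarrow> 'a \<Rightarrow> real" where
  "maximal_mean g x = (SUP a. log_mean g x a)"

lemma bdd_above_log_mean: "tame g \<Longrightarrow> bdd_above (range (log_mean g x))"
proof -
  assume g: "tame g"
  obtain B where B: "\<And>x. \<bar>g x\<bar> \<le> B" using tame_bound[OF g] by metis
  have "log_mean g x a \<le> B" for a using abs_log_mean_le[OF g B, of x a] by linarith
  then show ?thesis by (auto simp: bdd_above_def)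
qed

lemma log_mean_le_maximal: "tame g \<Longrightarrow> log_mean g x a \<le> maximal_mean g x"
  unfolding maximal_mean_def by (rule cSUP_upper) (auto intro: bdd_above_log_mean)

lemma maximal_mean_nonneg:
  assumes "tame g" "\<And>x. g x \<ge> 0" shows "maximal_mean g x \<ge> 0"
proof -
  have "log_mean g x 0 \<ge> 0" by (rule log_mean_nonneg) (rule assms(2))
  then show ?thesis using log_mean_le_maximal[OF assms(1), where x=x and a=0] by linarith
qed

lemma less_maximal_mean_iff:
  assumes g: "tame g" shows "\<mu> < maximal_mean g x \<longleftrightarrow> (\<exists>a. \<mu> < log_mean g x a)"
  unfolding maximal_mean_def using less_cSUP_iff[OF UNIV_not_empty bdd_above_log_mean[OF g]] by auto

text \<open>The supremum runs over uncountably many radii; measurability comes from lower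
  semicontinuity, superlevel sets being unions of open sets.\<close>

lemma measurable_maximal_mean:
  assumes g: "tame g" shows "maximal_mean g \<in> borel_measurable borel"
proof (rule borel_measurableI_greater)
  fix \<mu>
  have "{x \<in> space borel. \<mu> < maximal_mean g x} = (\<Union>a. {x. \<mu> < log_mean g x a})"
    by (auto simp: less_maximal_mean_iff[OF g])
  moreover have "open (\<Union>a. {x. \<mu> < log_mean g x a})"
    by (intro open_UN ballI open_Collect_less continuous_on_const continuous_log_mean_fst g)
  ultimately show "{x \<in> space borel. \<mu> < maximal_mean g x} \<in> sets borel" by simp
qed

text \<open>Marcinkiewicz interpolation between the weak type \<open>(q, q)\<close> and the trivial \<open>L\<^sup>\<infinity>\<close> bound.\<close>
theorem maximal_mean_strong_type:
  assumes r: "real DIM('a) / (real DIM('a) - 1) < r"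
  obtains C where "C > 0"
    "\<And>g. tame g \<Longrightarrow> (\<And>x. g x \<ge> 0) \<Longrightarrow>
      (\<integral>\<^sup>+x. ennreal (maximal_mean g x powr r) \<partial>lborel) \<le> ennreal C * (\<integral>\<^sup>+x. ennreal (g x powr r) \<partial>lborel)"
proof -
  have "real DIM('a) / (real DIM('a) - 1) < 2" using dim by (simp add: divide_less_eq)
  \<comment> \<open>Below 2, so that the weak type bound is available, and below r, so that \<mu>^(r
    - 1 - q) is integrable at 0.\<close>
  then obtain q where q: "real DIM('a) / (real DIM('a) - 1) < q" "q < min 2 r"
    using dense[of "real DIM('a) / (real DIM('a) - 1)" "min 2 r"] r by auto
  have "1 \<le> real DIM('a) / (real DIM('a) - 1)" using dim by (simp add: le_divide_eq)
  then have q1: "1 < q" "q < r" using q by linarith+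
  then have r1: "1 < r" by linarith
  obtain C where C: "C > 0"
    "\<And>g \<mu>. tame g \<Longrightarrow> (\<And>x. g x \<ge> 0) \<Longrightarrow> \<mu> > 0 \<Longrightarrow>
      outer_le {x. \<exists>a. log_mean g x a > \<mu>} (ennreal (C * \<mu> powr (- q)) * (\<integral>\<^sup>+x. ennreal (g x powr q) \<partial>lborel))"
    using maximal_weak_type[OF q(1)] q(2) by auto
  define K where "K = C * r * 4 powr q * (4 powr (r - q) / (r - q))"
  show thesis
  proof (rule that[of K])
    show "K > 0" using C(1) q1 by (simp add: K_def)
    fix g :: "'a \<Rightarrow> real" assume g: "tame g" "\<And>x. g x \<ge> 0"
    note [measurable] = tame_measurable[OF g(1)] measurable_maximal_mean[OF g(1)]
    let ?M = "maximal_mean g"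
    have M0: "?M x \<ge> 0" for x by (rule maximal_mean_nonneg[OF g])
    have level: "emeasure lborel {x. \<mu> \<le> ?M x} \<le> ennreal (C * 4 powr q * \<mu> powr (- q)) * (\<integral>\<^sup>+x. ennreal (g x powr q) * indicator {x. \<mu> \<le> 4 * g x} x \<partial>lborel)"
      if \<mu>: "\<mu> > 0" for \<mu>
    proof -
      define g1 where "g1 x = min (g x) (\<mu> / 4)" for x
      define g2 where "g2 x = max (g x - \<mu> / 4) 0" for x
      have t1: "tame g1" and t2: "tame g2" and p1: "\<And>x. g1 x \<ge> 0" and p2: "\<And>x. g2 x \<ge> 0"
        using tame_min[OF g, of "\<mu> / 4"] tame_excess[OF g, of "\<mu> / 4"] \<mu> g(2) by (simp_all add: g1_def[abs_def] g2_def[abs_def])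
      have "{x. \<mu> \<le> ?M x} \<subseteq> {x. \<exists>a. log_mean g2 x a > \<mu> / 4}"
      proof
        fix x assume "x \<in> {x. \<mu> \<le> ?M x}"
        \<comment> \<open>The supremum may not be attained, so a mean above \<mu> / 2 is what can be
          extracted; the part of g below \<mu> / 4 then leaves \<mu> / 4 for the excess.\<close>
        then have "\<mu> / 2 < ?M x" using \<mu> by simp
        then obtain a where a: "\<mu> / 2 < log_mean g x a" using less_maximal_mean_iff[OF g(1)] by blast
        have "log_mean g x a = log_mean g1 x a + log_mean g2 x a"
          unfolding g1_def[abs_def] g2_def[abs_def] using \<mu> by (intro log_mean_split[OF g]) simp
        moreover have "\<bar>log_mean g1 x a\<bar> \<le> \<mu> / 4"
          by (rule abs_log_mean_le[OF t1]) (use p1 \<mu> in \<open>simp add: g1_def\<close>)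
        ultimately have "log_mean g2 x a > \<mu> / 4" using a by linarith
        then show "x \<in> {x. \<exists>a. log_mean g2 x a > \<mu> / 4}" by blast
      qed
      moreover obtain S where S: "S \<in> sets borel" "{x. \<exists>a. log_mean g2 x a > \<mu> / 4} \<subseteq> S"
        "emeasure lborel S \<le> ennreal (C * (\<mu> / 4) powr (- q)) * (\<integral>\<^sup>+x. ennreal (g2 x powr q) \<partial>lborel)"
        using C(2)[OF t2 p2, of "\<mu> / 4"] \<mu> unfolding outer_le_def by auto
      ultimately have "emeasure lborel {x. \<mu> \<le> ?M x} \<le> emeasure lborel S"
        by (intro emeasure_mono) auto
      also note S(3)
      also have "(\<mu> / 4) powr (- q) = 4 powr q * \<mu> powr (- q)"
        using \<mu> by (simp add: powr_divide powr_minus field_simps)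
      also have "C * (4 powr q * \<mu> powr (- q)) = C * 4 powr q * \<mu> powr (- q)" by simp
      also have "ennreal (C * 4 powr q * \<mu> powr (- q)) * (\<integral>\<^sup>+x. ennreal (g2 x powr q) \<partial>lborel)
         \<le> ennreal (C * 4 powr q * \<mu> powr (- q)) * (\<integral>\<^sup>+x. ennreal (g x powr q) * indicator {x. \<mu> \<le> 4 * g x} x \<partial>lborel)"
      proof (intro mult_left_mono nn_integral_mono)
        fix x
        show "ennreal (g2 x powr q) \<le> ennreal (g x powr q) * indicator {x. \<mu> \<le> 4 * g x} x"
        proof (cases "\<mu> \<le> 4 * g x")
          case True
          then have "g2 x powr q \<le> g x powr q"
            using p2[of x] \<mu> q1 by (intro powr_mono2) (auto simp: g2_def)
          then show ?thesis using True by (simp add: ennreal_leI)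
        qed (simp add: g2_def)
      qed simp
      finally show ?thesis .
    qed
    \<comment> \<open>The layer cake formula, with an indicator in place of the integration limit so
      that x and \<mu> can be exchanged.\<close>
    have cake: "ennreal (y powr r) = (\<integral>\<^sup>+\<mu>. ennreal (r * \<mu> powr (r - 1)) * indicator {0..y} \<mu> \<partial>lborel)" if "y \<ge> 0" for y
    proof -
      have "((\<lambda>\<mu>. r * \<mu> powr (r - 1)) has_integral r * (y powr (r - 1 + 1) / (r - 1 + 1))) {0..y}"
        by (intro has_integral_mult_right has_integral_powr_from_0) (use r1 that in auto)
      then have "((\<lambda>\<mu>. r * \<mu> powr (r - 1)) has_integral y powr r) {0..y}" using r1 by simp
      then show ?thesis by (intro nn_integral_has_integral_lebesgue'[symmetric]) (use r1 in auto)
    qed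
    have "(\<integral>\<^sup>+x. ennreal (?M x powr r) \<partial>lborel) = (\<integral>\<^sup>+x. \<integral>\<^sup>+\<mu>. ennreal (r * \<mu> powr (r - 1)) * indicator {0..?M x} \<mu> \<partial>lborel \<partial>lborel)"
      by (simp only: cake[OF M0])
    also have "\<dots> = (\<integral>\<^sup>+\<mu>. \<integral>\<^sup>+x. ennreal (r * \<mu> powr (r - 1)) * indicator {0..?M x} \<mu> \<partial>lborel \<partial>lborel)"
      by (rule lborel_pair.Fubini') (unfold indicator_def atLeastAtMost_iff, measurable)
    also have "\<dots> \<le> (\<integral>\<^sup>+\<mu>. \<integral>\<^sup>+x. ennreal (g x powr q) * (ennreal (C * r * 4 powr q * \<mu> powr (r - 1 - q)) * indicator {0..4 * g x} \<mu>) \<partial>lborel \<partial>lborel)"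
    proof (rule nn_integral_mono)
      fix \<mu> :: real
      show "(\<integral>\<^sup>+x. ennreal (r * \<mu> powr (r - 1)) * indicator {0..?M x} \<mu> \<partial>lborel)
        \<le> (\<integral>\<^sup>+x. ennreal (g x powr q) * (ennreal (C * r * 4 powr q * \<mu> powr (r - 1 - q)) * indicator {0..4 * g x} \<mu>) \<partial>lborel)"
      proof (cases "\<mu> > 0")
        case True
        have "(\<integral>\<^sup>+x. ennreal (r * \<mu> powr (r - 1)) * indicator {0..?M x} \<mu> \<partial>lborel)
           = (\<integral>\<^sup>+x. ennreal (r * \<mu> powr (r - 1)) * indicator {x. \<mu> \<le> ?M x} x \<partial>lborel)"
          using True by (intro nn_integral_cong) (simp add: indicator_def)
        also have "\<dots> = ennreal (r * \<mu> powr (r - 1)) * emeasure lborel {x. \<mu> \<le> ?M x}"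
          by (rule nn_integral_cmult_indicator) measurable
        also have "\<dots> \<le> ennreal (r * \<mu> powr (r - 1)) * (ennreal (C * 4 powr q * \<mu> powr (- q)) * (\<integral>\<^sup>+x. ennreal (g x powr q) * indicator {x. \<mu> \<le> 4 * g x} x \<partial>lborel))"
          by (intro mult_left_mono level True) simp
        also have "\<dots> = ennreal (r * \<mu> powr (r - 1) * (C * 4 powr q * \<mu> powr (- q))) * (\<integral>\<^sup>+x. ennreal (g x powr q) * indicator {x. \<mu> \<le> 4 * g x} x \<partial>lborel)"
          by (rule ennreal_mult_mult) (use r1 in simp)
        also have "r * \<mu> powr (r - 1) * (C * 4 powr q * \<mu> powr (- q)) = C * r * 4 powr q * \<mu> powr (r - 1 - q)"
        proof -
          have "\<mu> powr (r - 1) * \<mu> powr (- q) = \<mu> powr (r - 1 - q)" by (simp add: powr_add[symmetric])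
          then show ?thesis by (simp add: mult_ac)
        qed
        also have "ennreal (C * r * 4 powr q * \<mu> powr (r - 1 - q)) * (\<integral>\<^sup>+x. ennreal (g x powr q) * indicator {x. \<mu> \<le> 4 * g x} x \<partial>lborel)
          = (\<integral>\<^sup>+x. ennreal (C * r * 4 powr q * \<mu> powr (r - 1 - q)) * (ennreal (g x powr q) * indicator {x. \<mu> \<le> 4 * g x} x) \<partial>lborel)"
          by (rule nn_integral_cmult[symmetric]) measurable
        also have "\<dots> = (\<integral>\<^sup>+x. ennreal (g x powr q) * (ennreal (C * r * 4 powr q * \<mu> powr (r - 1 - q)) * indicator {0..4 * g x} \<mu>) \<partial>lborel)"
          using True by (intro nn_integral_cong) (simp add: indicator_def mult_ac)
        finally show ?thesis .
      next
        case False
        \<comment> \<open>At \<mu> = 0 the density vanishes because \<open>0 powr (r - 1)\<close> is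
          0; negative \<mu> lie outside the interval.\<close>
        have z: "ennreal (r * \<mu> powr (r - 1)) * indicator {0..?M x} \<mu> = 0" for x
          using False by (cases "\<mu> = 0") auto
        show ?thesis by (simp only: z nn_integral_const mult_zero_left zero_le)
      qed
    qed
    also have "\<dots> = (\<integral>\<^sup>+x. \<integral>\<^sup>+\<mu>. ennreal (g x powr q) * (ennreal (C * r * 4 powr q * \<mu> powr (r - 1 - q)) * indicator {0..4 * g x} \<mu>) \<partial>lborel \<partial>lborel)"
      by (rule lborel_pair.Fubini'[symmetric]) (unfold indicator_def atLeastAtMost_iff, measurable)
    also have "\<dots> = (\<integral>\<^sup>+x. ennreal K * ennreal (g x powr r) \<partial>lborel)"
    proof (rule nn_integral_cong)
      fix x
      have "((\<lambda>\<mu>. C * r * 4 powr q * \<mu> powr (r - 1 - q)) has_integral C * r * 4 powr q * ((4 * g x) powr (r - 1 - q + 1) / (r - 1 - q + 1))) {0..4 * g x}"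
        by (intro has_integral_mult_right has_integral_powr_from_0) (use q1 g(2)[of x] in auto)
      then have "(\<integral>\<^sup>+\<mu>. ennreal (C * r * 4 powr q * \<mu> powr (r - 1 - q)) * indicator {0..4 * g x} \<mu> \<partial>lborel)
         = ennreal (C * r * 4 powr q * ((4 * g x) powr (r - 1 - q + 1) / (r - 1 - q + 1)))"
        by (intro nn_integral_has_integral_lebesgue') (use C(1) r1 in auto)
      also have "C * r * 4 powr q * ((4 * g x) powr (r - 1 - q + 1) / (r - 1 - q + 1)) = K * g x powr (r - q)"
        using g(2)[of x] by (simp add: K_def powr_mult)
      finally have I: "(\<integral>\<^sup>+\<mu>. ennreal (C * r * 4 powr q * \<mu> powr (r - 1 - q)) * indicator {0..4 * g x} \<mu> \<partial>lborel) = ennreal (K * g x powr (r - q))" .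
      have "(\<integral>\<^sup>+\<mu>. ennreal (g x powr q) * (ennreal (C * r * 4 powr q * \<mu> powr (r - 1 - q)) * indicator {0..4 * g x} \<mu>) \<partial>lborel)
         = ennreal (g x powr q) * ennreal (K * g x powr (r - q))"
        unfolding I[symmetric] by (rule nn_integral_cmult) measurable
      also have "\<dots> = ennreal (g x powr q * (K * g x powr (r - q)))" by (rule ennreal_mult'[symmetric]) simp
      also have "g x powr q * (K * g x powr (r - q)) = K * g x powr r"
      proof -
        have "g x powr q * g x powr (r - q) = g x powr r" by (simp add: powr_add[symmetric])
        then show ?thesis by (simp add: mult_ac)
      qed
      also have "ennreal (K * g x powr r) = ennreal K * ennreal (g x powr r)" using \<open>K > 0\<close> by (intro ennreal_mult') simp
      finally show "(\<integral>\<^sup>+\<mu>. ennreal (g x powr q) * (ennreal (C * r * 4 powr q * \<mu> powr (r - 1 - q)) * indicator {0..4 * g x} \<mu>) \<partial>lborel)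
         = ennreal K * ennreal (g x powr r)" .
    qed
    also have "\<dots> = ennreal K * (\<integral>\<^sup>+x. ennreal (g x powr r) \<partial>lborel)"
      by (rule nn_integral_cmult) measurable
    finally show "(\<integral>\<^sup>+x. ennreal (?M x powr r) \<partial>lborel) \<le> ennreal K * (\<integral>\<^sup>+x. ennreal (g x powr r) \<partial>lborel)" .
  qed
qed

end

subsection \<open>Rotation invariance of the triangle measure\<close>

text \<open>A cover is pushed forward: an isometry preserves diameters and emptiness, hence the
  weight of every member. The inverse isometry will give the reverse inequality.\<close>

lemma hausdorff_pre_isometry_le:
  assumes T: "\<And>x y. dist (T x) (T y) = dist x y"
  shows "hausdorff_pre k \<delta> (T ` A) \<le> hausdorff_pre k \<delta> A"
  unfolding hausdorff_pre_def
proof (rule INF_greatest)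
  fix C :: "nat \<Rightarrow> 'a set"
  assume C: "C \<in> {C. A \<subseteq> (\<Union>i. C i) \<and> (\<forall>i. bounded (C i) \<and> diameter (C i) \<le> \<delta>)}"
  have d: "diameter (T ` S) = diameter S" for S :: "'a set"
  proof -
    have "(\<lambda>(x, y). dist x y) ` (T ` S \<times> T ` S) = (\<lambda>(x, y). dist x y) ` (S \<times> S)"
      using T by (force simp: image_iff)
    then show ?thesis by (simp add: diameter_def)
  qed
  have b: "bounded (T ` S)" if "bounded S" for S :: "'a set"
  proof -
    obtain x e where "\<forall>y\<in>S. dist x y \<le> e" using \<open>bounded S\<close> by (auto simp: bounded_def)
    then have "\<forall>y\<in>T ` S. dist (T x) y \<le> e" by (simp add: T)
    then show ?thesis unfolding bounded_def by blast
  qed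
  show "(INF C\<in>{C. T ` A \<subseteq> (\<Union>i. C i) \<and> (\<forall>i. bounded (C i) \<and> diameter (C i) \<le> \<delta>)}.
       \<Sum>i. if C i = {} then 0 else ennreal (unit_ball_vol (real k) / 2 ^ k * diameter (C i) ^ k))
     \<le> (\<Sum>i. if C i = {} then 0 else ennreal (unit_ball_vol (real k) / 2 ^ k * diameter (C i) ^ k))"
  proof (rule INF_lower2[of "\<lambda>i. T ` C i"])
    have "T ` A \<subseteq> (\<Union>i. T ` C i)" using C by blast
    then show "(\<lambda>i. T ` C i) \<in> {C. T ` A \<subseteq> (\<Union>i. C i) \<and> (\<forall>i. bounded (C i) \<and> diameter (C i) \<le> \<delta>)}"
      using C b d by simp
  qed (simp only: d image_is_empty order_refl)
qed

lemma hausdorff_outer_isometry: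
  assumes T: "\<And>x y. dist (T x) (T y) = dist x y" and S: "\<And>x. S (T x) = x" "\<And>x. T (S x) = x"
  shows "hausdorff_outer k (T ` A) = hausdorff_outer k A"
proof -
  have S': "dist (S x) (S y) = dist x y" for x y using T[of "S x" "S y"] by (simp add: S)
  have "hausdorff_pre k \<delta> A \<le> hausdorff_pre k \<delta> (T ` A)" for \<delta>
    using hausdorff_pre_isometry_le[of S k \<delta> "T ` A", OF S'] by (simp add: image_image S)
  then have "hausdorff_pre k \<delta> (T ` A) = hausdorff_pre k \<delta> A" for \<delta>
    by (intro antisym hausdorff_pre_isometry_le T)
  then show ?thesis by (simp add: hausdorff_outer_def)
qed

lemma sets_hausdorff_measure [simp]: "sets (hausdorff_measure k) = sets borel"
  by (simp add: hausdorff_measure_def sets_measure_of_conv sets.sigma_sets_eq[of borel, simplified])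

text \<open>If the side condition of \<open>measure_of\<close> failed, both sides would be 0.\<close>
lemma emeasure_hausdorff_isometry:
  fixes T :: "'a::metric_space \<Rightarrow> 'a"
  assumes T: "\<And>x y. dist (T x) (T y) = dist x y" and S: "\<And>x. S (T x) = x" "\<And>x. T (S x) = x"
    and A: "A \<in> sets borel" and TA: "T ` A \<in> sets borel"
  shows "emeasure (hausdorff_measure k) (T ` A) = emeasure (hausdorff_measure k) A"
  unfolding hausdorff_measure_def emeasure_measure_of_conv
  using A TA hausdorff_outer_isometry[of T S k A, OF T S]
  by (simp add: sets.sigma_sets_eq[of borel, simplified])

lemma closed_triangle_manifold: "closed (triangle_manifold :: ((real ^ 'n) \<times> (real ^ 'n)) set)"
proof -
  have "triangle_manifold = {p :: (real ^ 'n) \<times> (real ^ 'n). norm (fst p) = 1} \<inter> ({p. norm (snd p) = 1} \<inter> {p. norm (fst p - snd p) = 1})"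
    by (auto simp: triangle_manifold_def)
  also have "closed \<dots>"
    by (intro closed_Int closed_Collect_eq continuous_intros)
  finally show ?thesis .
qed

lemma triangle_manifold_borel: "triangle_manifold \<in> sets borel"
  by (rule borel_closed[OF closed_triangle_manifold])

lemma sets_triangle_measure [simp, measurable_cong]:
  "sets (triangle_measure :: ((real ^ 'n) \<times> (real ^ 'n)) measure) = sets borel"
  by (simp add: triangle_measure_def)

lemma space_triangle_measure [simp]: "space triangle_measure = UNIV"
  using sets_eq_imp_space_eq[OF sets_triangle_measure] by simp

lemma emeasure_triangle_measure:
  assumes "A \<in> sets borel"
  shows "emeasure (triangle_measure :: ((real ^ 'n) \<times> (real ^ 'n)) measure) A
    = emeasure (hausdorff_measure (2 * CARD('n) - 3)) (triangle_manifold \<inter> A)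
      / emeasure (hausdorff_measure (2 * CARD('n) - 3)) (triangle_manifold :: ((real ^ 'n) \<times> (real ^ 'n)) set)"
  unfolding triangle_measure_def
  by (rule emeasure_uniform_measure) (use assms triangle_manifold_borel in auto)

text \<open>In \<open>ennreal\<close>, 0 / 0 and \<open>\<top> / \<top>\<close> are both 0. The mass
  bound for \<open>triangle_measure\<close> therefore holds whatever the Hausdorff measure of the
  manifold.\<close>

lemma ennreal_divide_self_le_1: "(x :: ennreal) / x \<le> 1"
proof (cases "x = 0 \<or> x = \<top>")
  case True then show ?thesis by auto
next
  case False
  then show ?thesis by (subst ennreal_divide_self) (auto simp: less_top)
qed

lemma triangle_measure_mass: "emeasure (triangle_measure :: ((real ^ 'n) \<times> (real ^ 'n)) measure) UNIV \<le> 1"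
  by (subst emeasure_triangle_measure) (auto intro: ennreal_divide_self_le_1)

lemma triangle_measure_AE:
  "AE p in triangle_measure. p \<in> (triangle_manifold :: ((real ^ 'n) \<times> (real ^ 'n)) set)"
proof (rule AE_I)
  show "emeasure triangle_measure (- triangle_manifold :: ((real ^ 'n) \<times> (real ^ 'n)) set) = 0"
    by (subst emeasure_triangle_measure[OF borel_comp[OF triangle_manifold_borel]]) simp
qed (use borel_comp[OF triangle_manifold_borel] in auto)

text \<open>The diagonal action of a rotation is an isometry of the product metric and preserves the
  three equations of the manifold, hence also the normalised Hausdorff measure on it.\<close>

lemma triangle_measure_invariant:
  fixes T :: "real ^ 'n \<Rightarrow> real ^ 'n"
  assumes T: "orthogonal_transformation T"
  shows "distr triangle_measure borel (map_prod T T) = (triangle_measure :: ((real ^ 'n) \<times> (real ^ 'n)) measure)"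
proof -
  define S where "S = inv T"
  have S: "orthogonal_transformation S" "\<And>x. S (T x) = x" "\<And>x. T (S x) = x"
    unfolding S_def using orthogonal_transformation_inv[OF T] inv_f_f[OF orthogonal_transformation_inj[OF T]]
      surj_f_inv_f[OF orthogonal_transformation_surj[OF T]] by blast+
  let ?P = "map_prod T T" and ?Q = "map_prod S S"
  have cont: "continuous_on UNIV (map_prod R R)" if "orthogonal_transformation R" for R :: "real ^ 'n \<Rightarrow> real ^ 'n"
  proof -
    have R: "continuous_on UNIV R" using linear_continuous_on[OF linear_conv_bounded_linear[THEN iffD1, OF orthogonal_transformation_linear[OF that]]] .
    have "continuous_on UNIV (\<lambda>p. (R (fst p), R (snd p)))"
      by (rule continuous_on_Pair; rule continuous_on_compose2[OF R]) (auto intro: continuous_intros)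
    moreover have "map_prod R R = (\<lambda>p. (R (fst p), R (snd p)))" by (auto simp: fun_eq_iff)
    ultimately show ?thesis by simp
  qed
  have [measurable]: "?P \<in> borel_measurable borel" "?Q \<in> borel_measurable borel"
    using cont T S(1) by (auto intro: borel_measurable_continuous_onI)
  have QP: "?Q (?P x) = x" "?P (?Q x) = x" for x using S by (auto simp: map_prod_def split: prod.split)
  have isom: "dist (?P x) (?P y) = dist x y" for x y
    using T unfolding orthogonal_transformation_isometry by (cases x; cases y) (simp add: dist_Pair_Pair)
  have nT: "norm (T x) = norm x" for x using T by (simp add: orthogonal_transformation_norm)
  have dT: "norm (T x - T y) = norm (x - y)" for x y
    using T unfolding orthogonal_transformation_isometry by (simp add: dist_norm)
  have man: "?P x \<in> triangle_manifold \<longleftrightarrow> x \<in> triangle_manifold" for x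
    by (cases x) (simp add: triangle_manifold_def nT dT)
  show ?thesis
  proof (rule measure_eqI)
    fix A :: "((real ^ 'n) \<times> (real ^ 'n)) set"
    assume "A \<in> sets (distr triangle_measure borel ?P)"
    then have A: "A \<in> sets borel" by simp
    have V: "?P -` A \<in> sets borel" using measurable_sets[of ?P borel borel A] A by simp
    have im: "triangle_manifold \<inter> A = ?P ` (triangle_manifold \<inter> ?P -` A)"
    proof (intro equalityI subsetI)
      fix x assume "x \<in> triangle_manifold \<inter> A"
      then have "?Q x \<in> triangle_manifold \<inter> ?P -` A" "x = ?P (?Q x)" using man[of "?Q x"] by (auto simp: QP)
      then show "x \<in> ?P ` (triangle_manifold \<inter> ?P -` A)" by blast
    qed (use man in auto)
    have "emeasure (distr triangle_measure borel ?P) A = emeasure triangle_measure (?P -` A)"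
      using A by (subst emeasure_distr) auto
    also have "\<dots> = emeasure triangle_measure A"
    proof -
      have "emeasure (hausdorff_measure (2 * CARD('n) - 3)) (triangle_manifold \<inter> A)
         = emeasure (hausdorff_measure (2 * CARD('n) - 3)) (triangle_manifold \<inter> ?P -` A)"
        unfolding im
      proof (rule emeasure_hausdorff_isometry[of ?P ?Q])
        show "triangle_manifold \<inter> ?P -` A \<in> sets borel" using V triangle_manifold_borel by auto
        show "?P ` (triangle_manifold \<inter> ?P -` A) \<in> sets borel" unfolding im[symmetric] using A triangle_manifold_borel by auto
      qed (use isom QP in auto)
      then show ?thesis using A V by (simp add: emeasure_triangle_measure)
    qed
    finally show "emeasure (distr triangle_measure borel ?P) A = emeasure triangle_measure A" .
  qed simp
qed

subsection \<open>Schwartz functions\<close>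

lemma schwartz_continuous:
  assumes "schwartz f" shows "continuous_on UNIV f"
proof -
  have "iter_partial [] f differentiable (at x)" for x using assms unfolding schwartz_def by blast
  then show ?thesis
    by (auto simp: continuous_on_eq_continuous_at intro: differentiable_imp_continuous_within)
qed

lemma schwartz_decay:
  assumes "schwartz f" obtains B where "\<And>x. norm x ^ N * norm (f x) \<le> B"
proof -
  have "\<exists>B. \<forall>x. norm x ^ N * norm (iter_partial [] f x) \<le> B" using assms unfolding schwartz_def by blast
  then show ?thesis using that by auto
qed

lemma one_plus_power_le:
  fixes y :: real assumes "y \<ge> 0" shows "(1 + y) ^ n \<le> 2 ^ n * (1 + y ^ n)"
proof (cases "y \<le> 1")
  case True
  then have "(1 + y) ^ n \<le> 2 ^ n" using assms by (intro power_mono) auto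
  also have "\<dots> \<le> 2 ^ n * (1 + y ^ n)" using assms by simp
  finally show ?thesis .
next
  case False
  then have "(1 + y) ^ n \<le> (2 * y) ^ n" using assms by (intro power_mono) auto
  also have "\<dots> \<le> 2 ^ n * (1 + y ^ n)" by (simp add: power_mult_distrib)
  finally show ?thesis .
qed

text \<open>A majorant in product form, whose integral reduces to that of 1 / (1 + t^2) on the
  line.\<close>

lemma tame_product_weight: "tame (\<lambda>x::'a::euclidean_space. \<Prod>b\<in>Basis. inverse (1 + (x \<bullet> b)\<^sup>2))"
proof -
  have pos: "1 + (t::real)\<^sup>2 > 0" for t by (simp add: add_pos_nonneg)
  have "integrable lborel (\<lambda>t::real. inverse (1 + t\<^sup>2))"
    using integrable_inverse_1_plus_square by (simp add: einterval_eq_UNIV set_integrable_def)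
  then have "integrable lborel (\<lambda>x::'a. \<Prod>b\<in>Basis. inverse (1 + (x \<bullet> b)\<^sup>2))"
    by (rule integrable_lborel_prod) (use pos in \<open>simp add: less_imp_le\<close>)
  moreover have "\<bar>\<Prod>b\<in>Basis. inverse (1 + (x \<bullet> b)\<^sup>2)\<bar> \<le> 1" for x :: 'a
    unfolding abs_prod by (rule prod_le_1) (use pos in \<open>auto simp: inverse_le_1_iff\<close>)
  moreover have "continuous_on UNIV (\<lambda>x::'a. \<Prod>b\<in>Basis. inverse (1 + (x \<bullet> b)\<^sup>2))"
    by (intro continuous_intros) (use pos in \<open>metis less_irrefl\<close>)
  ultimately show ?thesis unfolding tame_def by blast
qed

lemma tame_schwartz:
  fixes f :: "real ^ 'n \<Rightarrow> complex"
  assumes f: "schwartz f" shows "tame (\<lambda>x. norm (f x))"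
proof -
  let ?d = "DIM(real ^ 'n)"
  let ?w = "\<lambda>x::real ^ 'n. \<Prod>b\<in>Basis. (1 + (x \<bullet> b)\<^sup>2)"
  obtain B0 where B0: "\<And>x. norm x ^ 0 * norm (f x) \<le> B0" using schwartz_decay[OF f] by blast
  \<comment> \<open>Each of the d factors of the inverse weight is at most 1 + |x|^2, hence decay of
    order 2 d.\<close>
  obtain B1 where B1: "\<And>x. norm x ^ (2 * ?d) * norm (f x) \<le> B1" using schwartz_decay[OF f] by blast
  have "norm (f x) \<le> (2 ^ ?d * (B0 + B1)) * \<bar>\<Prod>b\<in>Basis. inverse (1 + (x \<bullet> b)\<^sup>2)\<bar>" for x
  proof -
    have pos: "1 + (t::real)\<^sup>2 > 0" for t by (simp add: add_pos_nonneg)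
    have w: "?w x > 0" by (intro prod_pos) (use pos in auto)
    have "?w x \<le> (\<Prod>b\<in>(Basis :: (real ^ 'n) set). 1 + (norm x)\<^sup>2)"
    proof (rule prod_mono)
      fix b :: "real ^ 'n" assume b: "b \<in> Basis"
      have "(x \<bullet> b)\<^sup>2 \<le> (norm x)\<^sup>2" using Basis_le_norm[OF b, of x] by (metis abs_le_square_iff abs_norm_cancel)
      then show "0 \<le> 1 + (x \<bullet> b)\<^sup>2 \<and> 1 + (x \<bullet> b)\<^sup>2 \<le> 1 + (norm x)\<^sup>2" using pos[of "x \<bullet> b"] by linarith
    qed
    also have "\<dots> = (1 + (norm x)\<^sup>2) ^ ?d" by simp
    also have "\<dots> \<le> 2 ^ ?d * (1 + (norm x)\<^sup>2 ^ ?d)" by (rule one_plus_power_le) simp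
    finally have "norm (f x) * ?w x \<le> norm (f x) * (2 ^ ?d * (1 + (norm x)\<^sup>2 ^ ?d))"
      by (rule mult_left_mono) simp
    also have "\<dots> = 2 ^ ?d * (norm x ^ 0 * norm (f x) + norm x ^ (2 * ?d) * norm (f x))"
      by (simp add: power_mult[symmetric] algebra_simps)
    also have "\<dots> \<le> 2 ^ ?d * (B0 + B1)" by (intro mult_left_mono add_mono B0 B1) simp
    finally have "norm (f x) \<le> 2 ^ ?d * (B0 + B1) / ?w x" using w by (simp add: le_divide_eq)
    moreover have "(\<Prod>b\<in>Basis. inverse (1 + (x \<bullet> b)\<^sup>2)) = inverse (?w x)" by (simp add: prod_inversef[symmetric] o_def)
    ultimately show ?thesis using w by (simp add: divide_inverse)
  qed
  then show ?thesis
    by (intro tame_dominated[OF tame_product_weight] continuous_intros schwartz_continuous[OF f]) simp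
qed

lemma tame_powr:
  assumes g: "tame g" "\<And>x. g x \<ge> 0" and "\<alpha> \<ge> 1" shows "tame (\<lambda>x. g x powr \<alpha>)"
proof -
  obtain B where B: "B > 0" "\<And>x. \<bar>g x\<bar> \<le> B" using tame_bound[OF g(1)] by metis
  have "\<bar>g x powr \<alpha>\<bar> \<le> B powr (\<alpha> - 1) * \<bar>g x\<bar>" for x
  proof -
    have "g x powr \<alpha> = g x powr (\<alpha> - 1) * g x"
      using g(2)[of x] by (cases "g x = 0") (auto simp: powr_mult_base[symmetric] mult.commute powr_diff)
    also have "\<dots> \<le> B powr (\<alpha> - 1) * g x"
      using B(2)[of x] g(2)[of x] \<open>\<alpha> \<ge> 1\<close> by (intro mult_right_mono powr_mono2) auto
    finally show ?thesis using g(2) by simp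
  qed
  moreover have "continuous_on UNIV (\<lambda>x. g x powr \<alpha>)"
    using g(2) \<open>\<alpha> \<ge> 1\<close> by (intro continuous_on_powr' tameD_continuous g(1) continuous_on_const) auto
  ultimately show ?thesis using tame_dominated[OF g(1)] by blast
qed

text \<open>The exceptional set is open, so it is empty as soon as it is null. This turns norms back
  into pointwise information.\<close>

lemma continuous_AE_le:
  fixes h :: "'a::euclidean_space \<Rightarrow> real"
  assumes h: "continuous_on UNIV h" and "AE x in lborel. h x \<le> c" shows "h x \<le> c"
proof (rule ccontr)
  assume "\<not> h x \<le> c"
  have [measurable]: "h \<in> borel_measurable borel" using h by (rule borel_measurable_continuous_onI)
  have "open {y. c < h y}" by (intro open_Collect_less continuous_on_const h)
  then obtain e where e: "e > 0" "ball x e \<subseteq> {y. c < h y}"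
    using \<open>\<not> h x \<le> c\<close> by (auto simp: open_contains_ball not_le)
  have "emeasure lborel {y \<in> space lborel. \<not> h y \<le> c} = 0"
    using assms(2) by (subst (asm) AE_iff_measurable[OF _ refl]) auto
  then have "emeasure lborel {y. c < h y} = 0" by (simp add: not_le)
  then have "emeasure lborel (ball x e) = 0"
    using emeasure_mono[OF e(2), of lborel] by simp
  then show False using content_ball_pos[OF e(1), of x] by (simp add: measure_def)
qed

subsection \<open>Lebesgue norms of Schwartz functions\<close>

lemma ennreal_powr_le:
  assumes "y \<le> ennreal z" "0 \<le> z" "0 \<le> s" shows "ennreal_powr y s \<le> ennreal (z powr s)"
proof -
  have "y \<noteq> \<infinity>" using assms(1) by (auto simp: top_unique)
  moreover have "enn2real y \<le> z" using assms by (simp add: enn2real_leI)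
  ultimately show ?thesis using assms unfolding ennreal_powr_def by (auto intro!: ennreal_leI powr_mono2)
qed

text \<open>The later arguments divide f by its norm, so norm 0 is split off; by continuity f then
  vanishes identically.\<close>

lemma Lp_norm_normalize:
  fixes f :: "real ^ 'n \<Rightarrow> complex"
  assumes f: "schwartz f" and p: "1 \<le> p"
  obtains (zero) "\<And>x. f x = 0"
  | (nonzero) a where "a > 0" "Lp_norm lborel (ennreal p) (\<lambda>x. ennreal (norm (f x))) = ennreal a"
      "(\<integral>\<^sup>+x. ennreal ((norm (f x) / a) powr p) \<partial>lborel) = 1"
proof -
  have tame: "tame (\<lambda>x. norm (f x) powr p)" by (intro tame_powr tame_schwartz f p) simp
  note [measurable] = tame_measurable[OF tame]
  define I where "I = (\<integral>x. norm (f x) powr p \<partial>lborel)"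
  have I: "(\<integral>\<^sup>+x. ennreal (norm (f x) powr p) \<partial>lborel) = ennreal I"
    unfolding I_def by (rule nn_integral_eq_integral) (use tameD_integrable[OF tame] in auto)
  have I0: "I \<ge> 0" unfolding I_def by (rule integral_nonneg_AE) simp
  have N: "Lp_norm lborel (ennreal p) (\<lambda>x. ennreal (norm (f x))) = ennreal (I powr (1 / p))"
    using p I I0 by (simp add: Lp_norm_def ennreal_powr_def)
  show thesis
  proof (cases "I = 0")
    case True
    then have "(\<integral>\<^sup>+x. ennreal (norm (f x) powr p) \<partial>lborel) = 0" using I by simp
    then have "AE x in lborel. ennreal (norm (f x) powr p) = 0" by (subst (asm) nn_integral_0_iff_AE) auto
    then have "AE x in lborel. norm (f x) powr p \<le> 0" by (rule AE_mp) (auto intro!: AE_I2 simp: ennreal_eq_0_iff)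
    from continuous_AE_le[OF tameD_continuous[OF tame] this]
    have "f x = 0" for x by (metis norm_eq_zero norm_ge_zero powr_eq_0_iff powr_ge_zero antisym)
    then show thesis by (rule zero)
  next
    case False
    define a where "a = I powr (1 / p)"
    have a: "a > 0" "a powr p = I" using False I0 p by (auto simp: a_def powr_powr)
    have "(\<integral>\<^sup>+x. ennreal ((norm (f x) / a) powr p) \<partial>lborel)
      = (\<integral>\<^sup>+x. ennreal (inverse I) * ennreal (norm (f x) powr p) \<partial>lborel)"
    proof (rule nn_integral_cong)
      fix x
      have "(norm (f x) / a) powr p = inverse I * norm (f x) powr p"
        using a(1) by (simp add: powr_divide a(2) inverse_eq_divide)
      then show "ennreal ((norm (f x) / a) powr p) = ennreal (inverse I) * ennreal (norm (f x) powr p)"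
        using I0 by (simp add: ennreal_mult)
    qed
    also have "\<dots> = ennreal (inverse I) * ennreal I" by (subst nn_integral_cmult) (auto simp: I)
    also have "\<dots> = 1" using False I0 by (simp add: ennreal_mult[symmetric])
    finally show thesis using nonzero[OF a(1)] N by (simp add: a_def)
  qed
qed

lemma Lp_norm_infinity:
  fixes f :: "real ^ 'n \<Rightarrow> complex"
  assumes f: "schwartz f"
  obtains a where "a \<ge> 0" "Lp_norm lborel \<infinity> (\<lambda>x. ennreal (norm (f x))) = ennreal a" "\<And>x. norm (f x) \<le> a"
proof -
  have tame: "tame (\<lambda>x. norm (f x))" by (rule tame_schwartz[OF f])
  note [measurable] = tame_measurable[OF tame]
  obtain B where B: "\<And>x. \<bar>norm (f x)\<bar> \<le> B" using tame_bound[OF tame] by metis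
  let ?E = "esssup lborel (\<lambda>x. ennreal (norm (f x)))"
  have "?E \<le> ennreal B" by (rule esssup_I) (use B in \<open>auto intro: ennreal_leI\<close>)
  then have "?E < \<top>" using le_less_trans by fastforce
  then obtain a where a: "a \<ge> 0" "?E = ennreal a" by (cases ?E) auto
  have "AE x in lborel. ennreal (norm (f x)) \<le> ennreal a" using esssup_AE[of "\<lambda>x. ennreal (norm (f x))" lborel] a(2) by simp
  then have "AE x in lborel. norm (f x) \<le> a" using a(1) by (simp add: ennreal_le_iff)
  from continuous_AE_le[OF tameD_continuous[OF tame] this] show thesis using that a by (simp add: Lp_norm_def)
qed

subsection \<open>Domination by spherical means\<close>

lemma measurable_triangle_measure: "(h \<in> borel_measurable triangle_measure) = (h \<in> borel_measurable borel)"
  by (simp only: measurable_cong_sets[OF sets_triangle_measure refl])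

text \<open>By \<open>comm\<close> the projection intertwines the diagonal action with the rotation,
  so the invariance of the triangle measure passes to its marginal.\<close>

lemma sphere_measure_marginal:
  fixes \<pi> :: "(real ^ 'n) \<times> (real ^ 'n) \<Rightarrow> real ^ 'n"
  assumes d: "CARD('n) \<ge> 3" and \<pi>: "continuous_on UNIV \<pi>"
    and comm: "\<And>T p. \<pi> (map_prod T T p) = T (\<pi> p)"
    and unit: "\<And>p. p \<in> triangle_manifold \<Longrightarrow> norm (\<pi> p) = 1"
  shows "sphere_measure (distr triangle_measure borel \<pi>)"
proof
  have [measurable]: "\<pi> \<in> borel_measurable borel" using \<pi> by (rule borel_measurable_continuous_onI)
  then have m [measurable]: "\<pi> \<in> borel_measurable triangle_measure" by (simp add: measurable_triangle_measure)
  show "sets (distr triangle_measure borel \<pi>) = sets borel" by simp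
  show "emeasure (distr triangle_measure borel \<pi>) UNIV \<le> 1"
    using triangle_measure_mass by (simp add: emeasure_distr)
  show "distr (distr triangle_measure borel \<pi>) borel T = distr triangle_measure borel \<pi>"
    if T: "orthogonal_transformation T" for T :: "real ^ 'n \<Rightarrow> real ^ 'n"
  proof -
    have c: "continuous_on UNIV T"
      using linear_continuous_on[OF linear_conv_bounded_linear[THEN iffD1, OF orthogonal_transformation_linear[OF T]]] .
    then have [measurable]: "T \<in> borel_measurable borel" by (rule borel_measurable_continuous_onI)
    have "continuous_on UNIV (\<lambda>p. (T (fst p), T (snd p)))"
      by (rule continuous_on_Pair; rule continuous_on_compose2[OF c]) (auto intro: continuous_intros)
    moreover have "map_prod T T = (\<lambda>p. (T (fst p), T (snd p)))" by (auto simp: fun_eq_iff)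
    ultimately have "map_prod T T \<in> borel_measurable borel" by (simp add: borel_measurable_continuous_onI)
    then have [measurable]: "map_prod T T \<in> measurable triangle_measure borel" by (simp add: measurable_triangle_measure)
    have "distr (distr triangle_measure borel \<pi>) borel T = distr triangle_measure borel (\<lambda>p. \<pi> (map_prod T T p))"
      by (simp add: distr_distr comp_def comm)
    also have "\<dots> = distr (distr triangle_measure borel (map_prod T T)) borel \<pi>"
      by (simp add: distr_distr comp_def)
    finally show ?thesis by (simp add: triangle_measure_invariant[OF T])
  qed
  show "AE u in distr triangle_measure borel \<pi>. norm u = 1"
    using triangle_measure_AE by (subst AE_distr_iff) (auto elim!: eventually_mono simp: unit)
  show "DIM(real ^ 'n) \<ge> 3" using d by simp
qed

lemma sphere_measure_fst: "CARD('n) \<ge> 3 \<Longrightarrow> sphere_measure (distr (triangle_measure :: ((real ^ 'n) \<times> (real ^ 'n)) measure) borel fst)"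
  by (rule sphere_measure_marginal) (auto simp: triangle_manifold_def intro: continuous_intros)

lemma sphere_measure_snd: "CARD('n) \<ge> 3 \<Longrightarrow> sphere_measure (distr (triangle_measure :: ((real ^ 'n) \<times> (real ^ 'n)) measure) borel snd)"
  by (rule sphere_measure_marginal) (auto simp: triangle_manifold_def intro: continuous_intros)

text \<open>
  The hypothesis under which Young's inequality transfers \<open>L\<^sup>r\<close> bounds for the two spherical maximal
  functions to \<open>maximal_triangle f g\<close>.
\<close>
definition convexly_dominated ::
    "real \<Rightarrow> (real ^ 'n \<Rightarrow> complex) \<Rightarrow> (real ^ 'n \<Rightarrow> complex) \<Rightarrow> real \<Rightarrow> bool" where
  "convexly_dominated r f g K \<longleftrightarrow> (\<exists>F G \<theta>.
     tame F \<and> tame G \<and> (\<forall>x. F x \<ge> 0) \<and> (\<forall>x. G x \<ge> 0) \<and> 0 \<le> K \<and> 0 \<le> \<theta> \<and> \<theta> \<le> 1 \<and>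
     (\<forall>x y. norm (f x) * norm (g y) \<le> K * (\<theta> * F x + (1 - \<theta>) * G y)) \<and>
     (\<integral>\<^sup>+x. ennreal (F x powr r) \<partial>lborel) \<le> 1 \<and> (\<integral>\<^sup>+x. ennreal (G x powr r) \<partial>lborel) \<le> 1)"

lemma convexly_dominated_zero:
  assumes "\<And>x y. f x = 0 \<or> g y = 0" shows "convexly_dominated r f g 0"
  unfolding convexly_dominated_def
  by (intro exI[of _ "\<lambda>_. 0"] exI[of _ 0], simp add: tame_zero mult_le_0_iff, use assms in blast)

text \<open>After the pointwise domination the integrand separates: F sees only u and G only v, so
  each average is a spherical mean for one marginal, with t = exp a. The strong type bounds then
  apply with constants that depend neither on f and g nor on K.\<close>

lemma maximal_triangle_Lp_bound:
  assumes d: "CARD('n) \<ge> 3" and r: "real CARD('n) / (real CARD('n) - 1) < r"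
  obtains C where "C > 0"
    "\<And>(f :: real ^ 'n \<Rightarrow> complex) g K. convexly_dominated r f g K \<Longrightarrow>
      Lp_norm lborel (ennreal r) (maximal_triangle f g) \<le> ennreal (C * K)"
proof -
  let ?\<tau> = "triangle_measure :: ((real ^ 'n) \<times> (real ^ 'n)) measure"
  interpret A: sphere_measure "distr ?\<tau> borel fst" by (rule sphere_measure_fst[OF d])
  interpret B: sphere_measure "distr ?\<tau> borel snd" by (rule sphere_measure_snd[OF d])
  have r': "real DIM(real ^ 'n) / (real DIM(real ^ 'n) - 1) < r" using r by simp
  obtain C1 where C1: "C1 > 0" "\<And>g. tame g \<Longrightarrow> (\<And>x. g x \<ge> 0) \<Longrightarrow>
      (\<integral>\<^sup>+x. ennreal (A.maximal_mean g x powr r) \<partial>lborel) \<le> ennreal C1 * (\<integral>\<^sup>+x. ennreal (g x powr r) \<partial>lborel)"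
    using A.maximal_mean_strong_type[OF r'] by metis
  obtain C2 where C2: "C2 > 0" "\<And>g. tame g \<Longrightarrow> (\<And>x. g x \<ge> 0) \<Longrightarrow>
      (\<integral>\<^sup>+x. ennreal (B.maximal_mean g x powr r) \<partial>lborel) \<le> ennreal C2 * (\<integral>\<^sup>+x. ennreal (g x powr r) \<partial>lborel)"
    using B.maximal_mean_strong_type[OF r'] by metis
  have "1 \<le> real CARD('n) / (real CARD('n) - 1)" using d by (simp add: le_divide_eq)
  then have r0: "r > 0" using r by linarith
  have [measurable]: "fst \<in> borel_measurable ?\<tau>" "snd \<in> borel_measurable ?\<tau>"
    by (auto simp: measurable_triangle_measure intro!: borel_measurable_continuous_onI continuous_intros)
  show thesis
  proof (rule that[of "(C1 + C2) powr (1 / r)"])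
    show "(C1 + C2) powr (1 / r) > 0" using C1(1) C2(1) by simp
    fix f g :: "real ^ 'n \<Rightarrow> complex" and K :: real
    assume "convexly_dominated r f g K"
    then obtain F G :: "real ^ 'n \<Rightarrow> real" and \<theta> :: real
      where F: "tame F" "\<And>x. F x \<ge> 0" and G: "tame G" "\<And>x. G x \<ge> 0" and K: "0 \<le> K" and \<theta>: "0 \<le> \<theta>" "\<theta> \<le> 1"
        and fg: "\<And>x y. norm (f x) * norm (g y) \<le> K * (\<theta> * F x + (1 - \<theta>) * G y)"
        and I: "(\<integral>\<^sup>+x. ennreal (F x powr r) \<partial>lborel) \<le> 1" "(\<integral>\<^sup>+x. ennreal (G x powr r) \<partial>lborel) \<le> 1"
      unfolding convexly_dominated_def by metis
    note [measurable] = tame_measurable[OF F(1)] tame_measurable[OF G(1)]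
      A.measurable_maximal_mean[OF F(1)] B.measurable_maximal_mean[OF G(1)]
    let ?X = "A.maximal_mean F" and ?Y = "B.maximal_mean G"
    have X: "?X x \<ge> 0" for x by (rule A.maximal_mean_nonneg[OF F])
    have Y: "?Y x \<ge> 0" for x by (rule B.maximal_mean_nonneg[OF G])
    have avg: "norm (\<integral>(u, v). f (x - t *\<^sub>R u) * g (x - t *\<^sub>R v) \<partial>?\<tau>) \<le> K * (\<theta> * ?X x + (1 - \<theta>) * ?Y x)"
      if t: "t > 0" for x t
    proof -
      obtain a where a: "t = exp a" using t by (metis exp_ln)
      let ?h = "\<lambda>p. K * (\<theta> * F (x - t *\<^sub>R fst p) + (1 - \<theta>) * G (x - t *\<^sub>R snd p))"
      have iF: "integrable ?\<tau> (\<lambda>p. F (x - t *\<^sub>R fst p))"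
        using A.integrable_translate[OF F(1), of x t] by (subst (asm) integrable_distr_eq) auto
      have iG: "integrable ?\<tau> (\<lambda>p. G (x - t *\<^sub>R snd p))"
        using B.integrable_translate[OF G(1), of x t] by (subst (asm) integrable_distr_eq) auto
      have "norm (\<integral>(u, v). f (x - t *\<^sub>R u) * g (x - t *\<^sub>R v) \<partial>?\<tau>)
         \<le> (\<integral>p. norm (case p of (u, v) \<Rightarrow> f (x - t *\<^sub>R u) * g (x - t *\<^sub>R v)) \<partial>?\<tau>)"
        by (rule integral_norm_bound)
      also have "\<dots> \<le> (\<integral>p. ?h p \<partial>?\<tau>)"
      proof (rule integral_mono')
        show "integrable ?\<tau> ?h" using iF iG by auto
        show "norm (case p of (u, v) \<Rightarrow> f (x - t *\<^sub>R u) * g (x - t *\<^sub>R v)) \<le> ?h p" for p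
          using fg[of "x - t *\<^sub>R fst p" "x - t *\<^sub>R snd p"] by (cases p) (simp add: norm_mult)
        show "0 \<le> ?h p" for p using K \<theta> F(2) G(2) by simp
      qed
      also have "\<dots> = K * (\<theta> * (\<integral>p. F (x - t *\<^sub>R fst p) \<partial>?\<tau>) + (1 - \<theta>) * (\<integral>p. G (x - t *\<^sub>R snd p) \<partial>?\<tau>))"
        using iF iG by simp
      also have "(\<integral>p. F (x - t *\<^sub>R fst p) \<partial>?\<tau>) = A.log_mean F x a"
        unfolding A.log_mean_def a by (subst integral_distr) auto
      also have "(\<integral>p. G (x - t *\<^sub>R snd p) \<partial>?\<tau>) = B.log_mean G x a"
        unfolding B.log_mean_def a by (subst integral_distr) auto
      also have "K * (\<theta> * A.log_mean F x a + (1 - \<theta>) * B.log_mean G x a) \<le> K * (\<theta> * ?X x + (1 - \<theta>) * ?Y x)"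
        using K \<theta> by (intro mult_left_mono add_mono A.log_mean_le_maximal B.log_mean_le_maximal F(1) G(1)) auto
      finally show ?thesis .
    qed
    have pt: "ennreal_powr (maximal_triangle f g x) r \<le> ennreal (K powr r) * (ennreal (?X x powr r) + ennreal (?Y x powr r))" for x
    proof -
      \<comment> \<open>A convex combination is at most the larger term, whose r-th power is at most
        the sum of the two r-th powers.\<close>
      define Z where "Z = max (?X x) (?Y x)"
      have Z: "?X x \<le> Z" "?Y x \<le> Z" "Z \<ge> 0" using X[of x] by (simp_all add: Z_def)
      have "\<theta> * ?X x + (1 - \<theta>) * ?Y x \<le> \<theta> * Z + (1 - \<theta>) * Z"
        by (intro add_mono mult_left_mono Z) (use \<theta> in auto)
      also have "\<dots> = Z" by (simp add: algebra_simps)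
      finally have KZ: "K * (\<theta> * ?X x + (1 - \<theta>) * ?Y x) \<le> K * Z" using K by (rule mult_left_mono)
      have "maximal_triangle f g x \<le> ennreal (K * Z)"
        unfolding maximal_triangle_def by (intro SUP_least ennreal_leI order_trans[OF avg KZ]) simp
      then have "ennreal_powr (maximal_triangle f g x) r \<le> ennreal ((K * Z) powr r)"
        by (rule ennreal_powr_le) (use K Z(3) r0 in auto)
      also have "(K * Z) powr r = K powr r * Z powr r" using K Z(3) by (simp add: powr_mult)
      also have "Z powr r \<le> ?X x powr r + ?Y x powr r" by (cases "?X x \<le> ?Y x") (simp_all add: Z_def)
      finally show ?thesis by (simp add: ennreal_mult ennreal_leI mult_left_mono)
    qed
    have "(\<integral>\<^sup>+x. ennreal_powr (maximal_triangle f g x) r \<partial>lborel)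
        \<le> (\<integral>\<^sup>+x. ennreal (K powr r) * (ennreal (?X x powr r) + ennreal (?Y x powr r)) \<partial>lborel)"
      by (rule nn_integral_mono) (rule pt)
    also have "\<dots> = ennreal (K powr r) * ((\<integral>\<^sup>+x. ennreal (?X x powr r) \<partial>lborel) + (\<integral>\<^sup>+x. ennreal (?Y x powr r) \<partial>lborel))"
      by (subst nn_integral_cmult, measurable) (subst nn_integral_add, auto)
    also have "\<dots> \<le> ennreal (K powr r) * (ennreal C1 * 1 + ennreal C2 * 1)"
      using I by (intro mult_left_mono add_mono order_trans[OF C1(2)[OF F]] order_trans[OF C2(2)[OF G]]) auto
    also have "\<dots> = ennreal (K powr r * (C1 + C2))"
      using C1(1) C2(1) by (simp add: ennreal_mult)
    finally have "ennreal_powr (\<integral>\<^sup>+x. ennreal_powr (maximal_triangle f g x) r \<partial>lborel) (1 / r)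
        \<le> ennreal ((K powr r * (C1 + C2)) powr (1 / r))"
      by (rule ennreal_powr_le) (use C1(1) C2(1) r0 in auto)
    also have "(K powr r * (C1 + C2)) powr (1 / r) = (C1 + C2) powr (1 / r) * K"
      using C1(1) C2(1) r0 K by (simp add: powr_mult powr_powr mult.commute)
    finally show "Lp_norm lborel (ennreal r) (maximal_triangle f g) \<le> ennreal ((C1 + C2) powr (1 / r) * K)"
      using r0 by (simp add: Lp_norm_def)
  qed
qed

section \<open>The supremum bound and the cases of the theorem\<close>

lemma finite_measure_triangle_measure: "finite_measure (triangle_measure :: ((real ^ 'n) \<times> (real ^ 'n)) measure)"
proof (rule finite_measureI)
  have "emeasure (triangle_measure :: ((real ^ 'n) \<times> (real ^ 'n)) measure) UNIV < \<top>"
    using triangle_measure_mass by (rule le_less_trans) simp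
  then show "emeasure (triangle_measure :: ((real ^ 'n) \<times> (real ^ 'n)) measure) (space triangle_measure) \<noteq> \<infinity>" by simp
qed

text \<open>Dominated convergence with the product of the two suprema as constant majorant. It makes
  the maximal function lower semicontinuous as a supremum over t.\<close>

lemma isCont_triangle_average:
  fixes f g :: "real ^ 'n \<Rightarrow> complex"
  assumes f: "schwartz f" and g: "schwartz g"
  shows "isCont (\<lambda>x. \<integral>(u, v). f (x - t *\<^sub>R u) * g (x - t *\<^sub>R v) \<partial>triangle_measure) x"
  unfolding continuous_at_sequentially comp_def
proof (intro allI impI)
  obtain A where A: "\<And>x. \<bar>norm (f x)\<bar> \<le> A" using tame_bound[OF tame_schwartz[OF f]] by metis
  obtain B where B: "\<And>x. \<bar>norm (g x)\<bar> \<le> B" using tame_bound[OF tame_schwartz[OF g]] by metis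
  interpret finite_measure "triangle_measure :: ((real ^ 'n) \<times> (real ^ 'n)) measure"
    by (rule finite_measure_triangle_measure)
  note [measurable] = borel_measurable_continuous_onI[OF schwartz_continuous[OF f]]
    borel_measurable_continuous_onI[OF schwartz_continuous[OF g]]
  have [measurable]: "fst \<in> borel_measurable (triangle_measure :: ((real ^ 'n) \<times> (real ^ 'n)) measure)"
    "snd \<in> borel_measurable (triangle_measure :: ((real ^ 'n) \<times> (real ^ 'n)) measure)"
    by (auto simp: measurable_triangle_measure intro!: borel_measurable_continuous_onI continuous_intros)
  fix X :: "nat \<Rightarrow> real ^ 'n" assume X: "X \<longlonglongrightarrow> x"
  show "(\<lambda>n. \<integral>(u, v). f (X n - t *\<^sub>R u) * g (X n - t *\<^sub>R v) \<partial>triangle_measure)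
    \<longlonglongrightarrow> (\<integral>(u, v). f (x - t *\<^sub>R u) * g (x - t *\<^sub>R v) \<partial>triangle_measure)"
    unfolding case_prod_beta
  proof (rule integral_dominated_convergence[where w="\<lambda>_. A * B"])
    have lim: "(\<lambda>n. h (X n - t *\<^sub>R u)) \<longlonglongrightarrow> h (x - t *\<^sub>R u)" if "schwartz h" for h :: "real ^ 'n \<Rightarrow> complex" and u
      by (rule isCont_tendsto_compose[of _ h])
        (use schwartz_continuous[OF that] in \<open>auto simp: continuous_on_eq_continuous_at intro!: tendsto_intros X\<close>)
    show "AE p in triangle_measure. (\<lambda>n. f (X n - t *\<^sub>R fst p) * g (X n - t *\<^sub>R snd p))
      \<longlonglongrightarrow> f (x - t *\<^sub>R fst p) * g (x - t *\<^sub>R snd p)"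
      by (intro AE_I2 tendsto_mult lim f g)
    show "AE p in triangle_measure. norm (f (X n - t *\<^sub>R fst p) * g (X n - t *\<^sub>R snd p)) \<le> A * B" for n
      unfolding norm_mult by (intro AE_I2 mult_mono) (use A B order_trans[OF abs_ge_zero A] in auto)
  qed auto
qed

text \<open>Measurability matters here, since \<open>esssup\<close> of a nonmeasurable function is the top element.\<close>
lemma measurable_maximal_triangle:
  assumes f: "schwartz f" and g: "schwartz g"
  shows "maximal_triangle f g \<in> borel_measurable borel"
proof (rule borel_measurableI_greater)
  fix \<mu> :: ennreal
  let ?T = "\<lambda>t x. \<integral>(u, v). f (x - t *\<^sub>R u) * g (x - t *\<^sub>R v) \<partial>triangle_measure"
  have "continuous_on UNIV (\<lambda>x. ennreal (norm (?T t x)))" for t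
    using isCont_triangle_average[OF f g]
    by (intro continuous_on_ennreal continuous_on_norm) (simp add: continuous_on_eq_continuous_at)
  then have "open (\<Union>t\<in>{0<..}. {x. \<mu> < ennreal (norm (?T t x))})"
    by (intro open_UN ballI open_Collect_less continuous_on_const)
  moreover have "{x \<in> space borel. \<mu> < maximal_triangle f g x} = (\<Union>t\<in>{0<..}. {x. \<mu> < ennreal (norm (?T t x))})"
    by (auto simp: maximal_triangle_def less_SUP_iff)
  ultimately show "{x \<in> space borel. \<mu> < maximal_triangle f g x} \<in> sets borel" by simp
qed

lemma maximal_triangle_le_bound:
  fixes f g :: "real ^ 'n \<Rightarrow> complex"
  assumes "\<And>x. norm (f x) \<le> a" "\<And>x. norm (g x) \<le> b"
  shows "maximal_triangle f g x \<le> ennreal (a * b)"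
  unfolding maximal_triangle_def
proof (intro SUP_least ennreal_leI)
  fix t :: real
  let ?\<tau> = "triangle_measure :: ((real ^ 'n) \<times> (real ^ 'n)) measure"
  interpret finite_measure ?\<tau>
    by (rule finite_measure_triangle_measure)
  have ab: "a \<ge> 0" "b \<ge> 0" using assms norm_ge_zero order_trans by blast+
  have m: "measure ?\<tau> UNIV \<le> 1" unfolding measure_def by (rule enn2real_leI) (use triangle_measure_mass in auto)
  have "norm (\<integral>(u, v). f (x - t *\<^sub>R u) * g (x - t *\<^sub>R v) \<partial>?\<tau>)
     \<le> (\<integral>p. norm (case p of (u, v) \<Rightarrow> f (x - t *\<^sub>R u) * g (x - t *\<^sub>R v)) \<partial>?\<tau>)"
    by (rule integral_norm_bound)
  also have "\<dots> \<le> (\<integral>p. a * b \<partial>?\<tau>)"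
    by (rule integral_mono') (use ab assms in \<open>auto simp: norm_mult split: prod.split intro!: mult_mono\<close>)
  also have "\<dots> \<le> a * b" using m ab mult_right_mono[OF m, of "a * b"] by simp
  finally show "norm (\<integral>(u, v). f (x - t *\<^sub>R u) * g (x - t *\<^sub>R v) \<partial>?\<tau>) \<le> a * b" .
qed

text \<open>The values 0 and \<open>top\<close> of r are excluded because their reciprocals are
  \<open>top\<close> and 0, neither of them positive and finite.\<close>

lemma ennreal_reciprocal_unique:
  fixes r :: ennreal assumes "1 / r = ennreal s" "s > 0" shows "r = ennreal (1 / s)"
proof (cases r)
  case (real r')
  have "r' \<noteq> 0" using assms real by (auto simp: divide_ennreal_def)
  then have "1 / r' = s" using assms real by (simp add: divide_ennreal[of 1, simplified])
  then show ?thesis using real \<open>r' \<noteq> 0\<close> by auto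
next
  case top
  then show ?thesis using assms by (simp add: divide_ennreal_def)
qed

lemma weighted_arithmetic_geometric:
  fixes x y \<theta> :: real
  assumes "0 < \<theta>" "\<theta> < 1" "x \<ge> 0" "y \<ge> 0"
  shows "x * y \<le> \<theta> * x powr (1 / \<theta>) + (1 - \<theta>) * y powr (1 / (1 - \<theta>))"
proof (cases "x = 0 \<or> y = 0")
  case True
  then show ?thesis using assms by (auto intro!: add_nonneg_nonneg mult_nonneg_nonneg)
next
  case False
  then have "(x powr (1 / \<theta>)) powr \<theta> * (y powr (1 / (1 - \<theta>))) powr (1 - \<theta>)
      \<le> \<theta> * x powr (1 / \<theta>) + (1 - \<theta>) * y powr (1 / (1 - \<theta>))"
    using assms by (intro Youngs_inequality_0) auto
  then show ?thesis using assms False by (simp add: powr_powr)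
qed

text \<open>Young's inequality with both powers concerns finite p and q. If exactly one exponent is
  infinite, r is the other and the convex weight degenerates to 0 or 1; if both are, the averages
  are bounded by the product of the suprema, as the mass is at most 1.\<close>

theorem mainTheorem5:
  fixes p q r :: ennreal
  assumes "CARD('n::finite) \<ge> 3"
    and "1 \<le> p" and "1 \<le> q"
    and "1 / p + 1 / q < ennreal ((real CARD('n) - 1) / real CARD('n))"
    and "1 / r = 1 / p + 1 / q"
  shows "triangle_bounded TYPE('n) p q r"
proof -
  let ?d = "real CARD('n)"
  note d = assms(1)
  \<comment> \<open>The hypothesis on 1/p + 1/q, read for s = 1 / r, is the range of the spherical
    maximal theorem.\<close>
  have exponent: "?d / (?d - 1) < 1 / s" if "s > 0" "ennreal s < ennreal ((?d - 1) / ?d)" for s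
  proof -
    have "s < (?d - 1) / ?d" using that by (simp add: ennreal_less_iff)
    then have "inverse ((?d - 1) / ?d) < inverse s" using that(1) by (intro less_imp_inverse_less)
    then show ?thesis by (simp add: inverse_eq_divide)
  qed
  have recip: "1 / ennreal x = ennreal (1 / x)" if "x \<ge> 1" for x
    using that divide_ennreal[of 1 x] by simp
  consider "p = \<infinity>" "q = \<infinity>" | q' where "p = \<infinity>" "q = ennreal q'" "q' \<ge> 1"
    | p' where "p = ennreal p'" "p' \<ge> 1" "q = \<infinity>"
    | p' q' where "p = ennreal p'" "p' \<ge> 1" "q = ennreal q'" "q' \<ge> 1"
    using assms(2,3) by (cases p; cases q) auto
  then show ?thesis
  proof cases
    case 1
    then have r: "r = \<infinity>" using assms(5) by (cases r) (auto simp: divide_ennreal_def)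
    have "Lp_norm lborel \<infinity> (maximal_triangle f g)
        \<le> ennreal 1 * Lp_norm lborel \<infinity> (\<lambda>x. ennreal (norm (f x))) * Lp_norm lborel \<infinity> (\<lambda>x. ennreal (norm (g x)))"
      if f: "schwartz f" and g: "schwartz g" for f g :: "real ^ 'n \<Rightarrow> complex"
    proof -
      obtain a where a: "a \<ge> 0" "Lp_norm lborel \<infinity> (\<lambda>x. ennreal (norm (f x))) = ennreal a" "\<And>x. norm (f x) \<le> a"
        using Lp_norm_infinity[OF f] by metis
      obtain b where b: "b \<ge> 0" "Lp_norm lborel \<infinity> (\<lambda>x. ennreal (norm (g x))) = ennreal b" "\<And>x. norm (g x) \<le> b"
        using Lp_norm_infinity[OF g] by metis
      have "esssup lborel (maximal_triangle f g) \<le> ennreal (a * b)"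
        using measurable_maximal_triangle[OF f g]
        by (intro esssup_I) (auto intro: maximal_triangle_le_bound[OF a(3) b(3)])
      then show ?thesis using a b by (simp add: Lp_norm_def ennreal_mult)
    qed
    then show ?thesis unfolding triangle_bounded_def 1 r by blast
  next
    case (2 q')
    have "1 / r = ennreal (1 / q')" using assms(5) 2 recip by simp
    then have r: "r = ennreal q'" using ennreal_reciprocal_unique[of r "1 / q'"] 2 by simp
    have "?d / (?d - 1) < q'" using exponent[of "1 / q'"] assms(4) 2 recip by simp
    then obtain C where C: "C > 0" "\<And>(f :: real ^ 'n \<Rightarrow> complex) g K. convexly_dominated q' f g K \<Longrightarrow>
        Lp_norm lborel (ennreal q') (maximal_triangle f g) \<le> ennreal (C * K)"
      by (rule maximal_triangle_Lp_bound[OF d]) metis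
    have "Lp_norm lborel r (maximal_triangle f g)
        \<le> ennreal C * Lp_norm lborel \<infinity> (\<lambda>x. ennreal (norm (f x))) * Lp_norm lborel q (\<lambda>x. ennreal (norm (g x)))"
      if f: "schwartz f" and g: "schwartz g" for f g :: "real ^ 'n \<Rightarrow> complex"
    proof -
      obtain a where a: "a \<ge> 0" "Lp_norm lborel \<infinity> (\<lambda>x. ennreal (norm (f x))) = ennreal a" "\<And>x. norm (f x) \<le> a"
        using Lp_norm_infinity[OF f] by metis
      show ?thesis
      proof (cases rule: Lp_norm_normalize[OF g \<open>q' \<ge> 1\<close>])
        case 1
        then show ?thesis using C(2)[OF convexly_dominated_zero[of f g]] by (simp add: r)
      next
        case b: (2 b)
        \<comment> \<open>Weight \<theta> = 0: f enters through its supremum a, and only the second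
          marginal matters.\<close>
        have "norm (f x) * norm (g y) \<le> (a * b) * (0 * 0 + (1 - 0) * (norm (g y) / b))" for x y
          using b(1) mult_right_mono[OF a(3)[of x], of "norm (g y)"] by simp
        moreover have "tame (\<lambda>y. norm (g y) / b)" using tame_cmult[OF tame_schwartz[OF g], of "1 / b"] by simp
        ultimately have "convexly_dominated q' f g (a * b)"
          unfolding convexly_dominated_def using a b
          by (intro exI[of _ "\<lambda>_. 0"] exI[of _ "\<lambda>y. norm (g y) / b"] exI[of _ 0]) (simp add: tame_zero)
        then have "Lp_norm lborel r (maximal_triangle f g) \<le> ennreal (C * (a * b))" unfolding r by (rule C(2))
        then show ?thesis using a b C(1) 2 by (simp add: ennreal_mult mult.assoc)
      qed
    qed
    then show ?thesis unfolding triangle_bounded_def 2(1) by blast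
  next
    case (3 p')
    have "1 / r = ennreal (1 / p')" using assms(5) 3 recip by simp
    then have r: "r = ennreal p'" using ennreal_reciprocal_unique[of r "1 / p'"] 3 by simp
    have "?d / (?d - 1) < p'" using exponent[of "1 / p'"] assms(4) 3 recip by simp
    then obtain C where C: "C > 0" "\<And>(f :: real ^ 'n \<Rightarrow> complex) g K. convexly_dominated p' f g K \<Longrightarrow>
        Lp_norm lborel (ennreal p') (maximal_triangle f g) \<le> ennreal (C * K)"
      by (rule maximal_triangle_Lp_bound[OF d]) metis
    have "Lp_norm lborel r (maximal_triangle f g)
        \<le> ennreal C * Lp_norm lborel p (\<lambda>x. ennreal (norm (f x))) * Lp_norm lborel \<infinity> (\<lambda>x. ennreal (norm (g x)))"
      if f: "schwartz f" and g: "schwartz g" for f g :: "real ^ 'n \<Rightarrow> complex"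
    proof -
      obtain b where b: "b \<ge> 0" "Lp_norm lborel \<infinity> (\<lambda>x. ennreal (norm (g x))) = ennreal b" "\<And>x. norm (g x) \<le> b"
        using Lp_norm_infinity[OF g] by metis
      show ?thesis
      proof (cases rule: Lp_norm_normalize[OF f \<open>p' \<ge> 1\<close>])
        case 1
        then show ?thesis using C(2)[OF convexly_dominated_zero[of f g]] by (simp add: r)
      next
        case a: (2 a)
        \<comment> \<open>Weight \<theta> = 1: now g enters through its supremum b, and only the
          first marginal matters.\<close>
        have "norm (f x) * norm (g y) \<le> (a * b) * (1 * (norm (f x) / a) + (1 - 1) * 0)" for x y
          using a(1) mult_left_mono[OF b(3)[of y], of "norm (f x)"] by (simp add: mult.commute)
        moreover have "tame (\<lambda>y. norm (f y) / a)" using tame_cmult[OF tame_schwartz[OF f], of "1 / a"] by simp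
        ultimately have "convexly_dominated p' f g (a * b)"
          unfolding convexly_dominated_def using a b
          by (intro exI[of _ "\<lambda>x. norm (f x) / a"] exI[of _ "\<lambda>_. 0"] exI[of _ 1]) (simp add: tame_zero)
        then have "Lp_norm lborel r (maximal_triangle f g) \<le> ennreal (C * (a * b))" unfolding r by (rule C(2))
        then show ?thesis using a b C(1) 3 by (simp add: ennreal_mult mult.assoc)
      qed
    qed
    then show ?thesis unfolding triangle_bounded_def 3(3) by blast
  next
    case (4 p' q')
    define s where "s = 1 / (1 / p' + 1 / q')"
    \<comment> \<open>By 1 / s = 1 / p' + 1 / q' the weights s / p' and s / q' sum to 1, and 1 /
      \<theta> = p' / s is the power that Young's inequality puts on f.\<close>
    define \<theta> where "\<theta> = s / p'"
    have s: "s > 0" "1 / s = 1 / p' + 1 / q'" using 4 by (auto simp: s_def add_pos_pos)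
    have \<theta>: "0 < \<theta>" "1 - \<theta> = s / q'" using 4 s by (auto simp: \<theta>_def field_simps)
    have "0 < s / q'" using 4 s by simp
    then have \<theta>1: "\<theta> < 1" using \<theta> by linarith
    have exps: "1 / \<theta> = p' / s" "1 / (1 - \<theta>) = q' / s" using \<theta>(2) by (simp_all add: \<theta>_def)
    have "1 / r = ennreal (1 / s)" using assms(5) 4 recip by (simp add: s(2) ennreal_plus[symmetric] del: ennreal_plus)
    then have r: "r = ennreal s" using ennreal_reciprocal_unique[of r "1 / s"] s(1) by simp
    have "ennreal (1 / s) < ennreal ((?d - 1) / ?d)"
      using assms(4,5) \<open>1 / r = ennreal (1 / s)\<close> by simp
    then have sd: "?d / (?d - 1) < s" using exponent[of "1 / s"] s(1) by simp
    then obtain C where C: "C > 0" "\<And>(f :: real ^ 'n \<Rightarrow> complex) g K. convexly_dominated s f g K \<Longrightarrow>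
        Lp_norm lborel (ennreal s) (maximal_triangle f g) \<le> ennreal (C * K)"
      by (rule maximal_triangle_Lp_bound[OF d]) metis
    have ps: "p' / s \<ge> 1" "q' / s \<ge> 1" unfolding exps[symmetric] using \<theta>1 \<theta>(1) by (auto simp: le_divide_eq)
    have "Lp_norm lborel r (maximal_triangle f g)
        \<le> ennreal C * Lp_norm lborel p (\<lambda>x. ennreal (norm (f x))) * Lp_norm lborel q (\<lambda>x. ennreal (norm (g x)))"
      if f: "schwartz f" and g: "schwartz g" for f g :: "real ^ 'n \<Rightarrow> complex"
    proof (cases rule: Lp_norm_normalize[OF f \<open>p' \<ge> 1\<close>])
      case 1
      then show ?thesis using C(2)[OF convexly_dominated_zero[of f g]] by (simp add: r)
    next
      case a: (2 a)
      show ?thesis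
      proof (cases rule: Lp_norm_normalize[OF g \<open>q' \<ge> 1\<close>])
        case 1
        then show ?thesis using C(2)[OF convexly_dominated_zero[of f g]] by (simp add: r)
      next
        case b: (2 b)
        \<comment> \<open>The s-th powers of these functions are the p'-th and q'-th powers of the
          normalised moduli, so both have integral 1.\<close>
        let ?F = "\<lambda>x. (norm (f x) / a) powr (p' / s)" and ?G = "\<lambda>y. (norm (g y) / b) powr (q' / s)"
        have "tame (\<lambda>y. norm (f y) / a)" using tame_cmult[OF tame_schwartz[OF f], of "1 / a"] by simp
        then have tF: "tame ?F" using a(1) ps by (intro tame_powr) auto
        have "tame (\<lambda>y. norm (g y) / b)" using tame_cmult[OF tame_schwartz[OF g], of "1 / b"] by simp
        then have tG: "tame ?G" using b(1) ps by (intro tame_powr) auto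
        have "norm (f x) * norm (g y) \<le> (a * b) * (\<theta> * ?F x + (1 - \<theta>) * ?G y)" for x y
        proof -
          have "norm (f x) / a * (norm (g y) / b) \<le> \<theta> * ?F x + (1 - \<theta>) * ?G y"
            unfolding exps[symmetric] using a(1) b(1) by (intro weighted_arithmetic_geometric \<theta> \<theta>1) auto
          then have "(a * b) * (norm (f x) / a * (norm (g y) / b)) \<le> (a * b) * (\<theta> * ?F x + (1 - \<theta>) * ?G y)"
            using a(1) b(1) by (intro mult_left_mono) auto
          then show ?thesis using a(1) b(1) by simp
        qed
        then have "convexly_dominated s f g (a * b)"
          unfolding convexly_dominated_def using a b \<theta>(1) \<theta>1 s(1) tF tG
          by (intro exI[of _ ?F] exI[of _ ?G] exI[of _ \<theta>]) (simp add: powr_powr)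
        then have "Lp_norm lborel r (maximal_triangle f g) \<le> ennreal (C * (a * b))" unfolding r by (rule C(2))
        then show ?thesis using a b C(1) 4 by (simp add: ennreal_mult mult.assoc)
      qed
    qed
    then show ?thesis unfolding triangle_bounded_def by blast
  qed
qed

end
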